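(* Let $n\ge 2$ and let $X=\mathrm{IF}(1,2;E)$ be the odd symplectic partial flag manifold with $E=\mathbb{C}^{2n+1}$. Then Combinatorial Property $\mathcal{O}$ holds for $X$: the combinatorial quantum Bruhat graph $\mathcal{G}_n$ of $X$ is strongly connected, and the greatest common divisor of the lengths of its cycles equals $r=\gcd(2,2n-1)=1$.
   Context: Let $n\ge 2$ and $\bar i=2n+3-i$, so that labels are ordered $1<2<\dots<n+1<\overline{n+1}<\dots<\bar 2<\bar 1$. Let $E=\mathbb{C}^{2n+1}$ with basis $e_1,\dots,e_{n+1},e_{\overline{n+1}},\dots,e_{\bar 2}$, and let $\omega$ be the skew-symmetric bilinear form on $E$ with $\omega(e_i,e_j)=\delta_{i,\bar j}$ for all $1\le i\le j\le\bar 2$; its kernel is spanned by $e_1$. The odd symplectic partial flag manifold is $$\mathrm{IF}(1,2;E)=\{V_1\subset V_2\subset E:\ \dim V_i=i,\ \omega(x,y)=0\text{ for all }x,y\in V_i\}.$$ Let $\mathrm{Sp}_{2n+1}(E)=\{g\in \mathrm{GL}(E):\omega(gu,gv)=\omega(u,v)\ \forall u,v\in E\}$ and let $B$ be its subgroup of upper triangular matrices in the basis $e_1,\dots,e_{n+1},e_{\overline{n+1}},\dots,e_{\bar 2}$ of $E$. The $B$-orbits on $\mathrm{IF}(1,2;E)$ are indexed by the set, denoted here $W^{odd}$, of pairs $w=(a|b)$ with $a,b\in\{1,\dots,n+1,\overline{n+1},\dots,\bar 2\}$, $a\ne b$, $a\neq \bar b$. The Schubert variety $X(w)=X(a|b)$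 is the closure of the $B$-orbit of the flag $\langle e_a\rangle\subset\langle e_a,e_b\rangle$. Write $\ell(w)=\dim X(w)$, and let $v\le w$ (Bruhat order) mean $X(v)\subset X(w)$. A curve in $X=\mathrm{IF}(1,2;E)$ has degree $d=(d_1,d_2)$, where $d_1$ is its degree under the map $(V_1\subset V_2)\mapsto V_1\in\mathbb{P}(E)$ and $d_2$ is its degree under $(V_1\subset V_2)\mapsto V_2$ composed with the Plücker embedding (each counted as the degree of the pullback of $\mathcal{O}(1)$); this identifies effective classes in $H_2(X,\mathbb{Z})$ with $\mathbb{Z}_{\ge 0}^2$. For a closed subvariety $\Omega\subset X$ and an effective degree $d$, let $\overline{\mathcal{M}}_{0,2}(X,d)$ be the moduli space of genus $0$, degree $d$ stable maps with two marked points, with evaluation maps $\mathrm{ev}_1,\mathrm{ev}_2$ to $X$. The curve neighborhood is $\Gamma_d(\Omega)=\mathrm{ev}_2(\mathrm{ev}_1^{-1}(\Omega))\subset X$ with its reduced scheme structure. The first Chern class of $X$ is $c_1(X)=2\,\mathrm{Div}_1+(2n-1)\,\mathrm{Div}_2$, where $\mathrm{Div}_1,\mathrm{Div}_2$ are the two Schubert divisor classes, so that a curve of degree $(d_1,d_2)$ has anticanonical degree $2d_1+(2n-1)d_2$. The combinatorial quantum Bruhat graph $\mathcal{G}_n$ of $X$ is the directed graph with vertex set $W^{odd}$ (the vertex $w$ standing for the class $[X(w)]$) and the following edges: (1) an edge $u\to v$ whenever $v\le u$ and $\ell(v)=\ell(u)-1$ (these are the terms occurring with positive coefficient in classical multiplication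 of $[X(u)]$ by a hyperplane class); (2) an edge $u\to v$ whenever, for some effective degree $d=(d_1,d_2)\neq(0,0)$, $X(v)$ is an irreducible component of $\Gamma_d(X(u))$ and $\ell(v)-\ell(u)=2d_1+(2n-1)d_2-1$. A directed graph is strongly connected if there is a directed path from any vertex to any other. A cycle is a closed directed path $u_1\to u_2\to\dots\to u_k\to u_1$; its length is $k$. Combinatorial Property $\mathcal{O}$ holds for a Fano variety with $c_1=\sum_i a_i\mathrm{Div}_i$ if its combinatorial quantum Bruhat graph is strongly connected and the greatest common divisor of the cycle lengths is $r=\gcd(a_1,\dots,a_k)$. *)

theory Defs
  imports
    "HOL-Library.Function_Algebras"
    "HOL-Analysis.Abstract_Topology"
    "Graph_Theory.Pair_Digraph"
    "Graph_Theory.Digraph_Component"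
begin

section \<open>The odd symplectic space\<close>

text \<open>
  The label \<open>i\<close> or its bar is the natural number in \<open>{1..2n+2}\<close> giving its position in
  \<open>1 < 2 < \<dots> < n+1 < bar (n+1) < \<dots> < bar 2 < bar 1\<close>; the labels of the basis of \<open>E\<close> are
  \<open>{1..2n+1}\<close>.  Vectors are functions \<open>nat \<Rightarrow> complex\<close>, and \<open>E\<close> is the subspace of those
  supported on \<open>{1..2n+1}\<close>.
\<close>

type_synonym cvec = "nat \<Rightarrow> complex"

definition vscale :: "complex \<Rightarrow> cvec \<Rightarrow> cvec" where
  "vscale c x = (\<lambda>i. c * x i)"

global_interpretation cvec: vector_space vscale
  by unfold_locales (auto simp: vscale_def algebra_simps fun_eq_iff)

definition lbar :: "nat \<Rightarrow> nat \<Rightarrow> nat" where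
  "lbar n i = 2 * n + 3 - i"

definition E :: "nat \<Rightarrow> cvec set" where
  "E n = {x. \<forall>i. i \<notin> {1..2 * n + 1} \<longrightarrow> x i = 0}"

definition evec :: "nat \<Rightarrow> cvec" where
  "evec i = (\<lambda>k. if k = i then 1 else 0)"

definition omega_basis :: "nat \<Rightarrow> nat \<Rightarrow> nat \<Rightarrow> complex" where
  "omega_basis n i j = (if i = lbar n j then (if i \<le> j then 1 else - 1) else 0)"

definition omega :: "nat \<Rightarrow> cvec \<Rightarrow> cvec \<Rightarrow> complex" where
  "omega n x y = (\<Sum>i\<in>{1..2 * n + 1}. \<Sum>j\<in>{1..2 * n + 1}. x i * y j * omega_basis n i j)"


section \<open>The flag manifold and its Zariski topology\<close>

type_synonym flag = "cvec set \<times> cvec set"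

definition isotropic :: "nat \<Rightarrow> cvec set \<Rightarrow> bool" where
  "isotropic n V \<longleftrightarrow> (\<forall>x\<in>V. \<forall>y\<in>V. omega n x y = 0)"

definition IF :: "nat \<Rightarrow> flag set" where
  "IF n = {(V1, V2). cvec.subspace V1 \<and> cvec.subspace V2 \<and> V1 \<subseteq> V2 \<and> V2 \<subseteq> E n \<and>
     cvec.dim V1 = 1 \<and> cvec.dim V2 = 2 \<and> isotropic n V1 \<and> isotropic n V2}"

text \<open>
  Elements of the exterior square of \<open>E\<close> are written as antisymmetric families of coordinates;
  \<open>plucker y z\<close> is the bivector \<open>y \<and> z\<close>.
\<close>

type_synonym bivec = "nat \<times> nat \<Rightarrow> complex"

definition plucker :: "cvec \<Rightarrow> cvec \<Rightarrow> bivec" where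
  "plucker y z = (\<lambda>(i, j). y i * z j - y j * z i)"

text \<open>
  \<open>bihom a b P\<close>: \<open>P\<close> is a polynomial function, homogeneous of degree \<open>a\<close> in the coordinates of
  \<open>E\<close> and of degree \<open>b\<close> in those of its exterior square.
\<close>

inductive bihom :: "nat \<Rightarrow> nat \<Rightarrow> (cvec \<Rightarrow> bivec \<Rightarrow> complex) \<Rightarrow> bool" where
  const: "bihom 0 0 (\<lambda>x p. c)"
| coord1: "bihom 1 0 (\<lambda>x p. x i)"
| coord2: "bihom 0 1 (\<lambda>x p. p (i, j))"
| add: "bihom a b P \<Longrightarrow> bihom a b Q \<Longrightarrow> bihom a b (\<lambda>x p. P x p + Q x p)"
| mult: "bihom a b P \<Longrightarrow> bihom a' b' Q \<Longrightarrow> bihom (a + a') (b + b') (\<lambda>x p. P x p * Q x p)"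

text \<open>
  The flag \<open>(V1, V2)\<close> is identified with the point \<open>([x], [y \<and> z])\<close> of the product of the
  projective spaces of \<open>E\<close> and of its exterior square, where \<open>x\<close> spans \<open>V1\<close> and \<open>y, z\<close> span
  \<open>V2\<close>.  By bihomogeneity, nonvanishing of \<open>P\<close> does not depend on the choice of \<open>x, y, z\<close>.
  These nonvanishing loci form a basis of the Zariski topology.
\<close>

definition nonvanishing :: "nat \<Rightarrow> (cvec \<Rightarrow> bivec \<Rightarrow> complex) \<Rightarrow> flag set" where
  "nonvanishing n P = {(V1, V2) \<in> IF n.
     \<exists>x y z. V1 = cvec.span {x} \<and> V2 = cvec.span {y, z} \<and> P x (plucker y z) \<noteq> 0}"

definition zariski :: "nat \<Rightarrow> flag topology" where
  "zariski n = topology_generated_by {nonvanishing n P | P a b. bihom a b P}"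

definition irreducible_in :: "'a topology \<Rightarrow> 'a set \<Rightarrow> bool" where
  "irreducible_in T A \<longleftrightarrow> A \<subseteq> topspace T \<and> A \<noteq> {} \<and>
     (\<forall>C D. closedin T C \<and> closedin T D \<and> A \<subseteq> C \<union> D \<longrightarrow> A \<subseteq> C \<or> A \<subseteq> D)"

definition irreducible_component :: "'a topology \<Rightarrow> 'a set \<Rightarrow> 'a set \<Rightarrow> bool" where
  "irreducible_component T A Z \<longleftrightarrow> Z \<subseteq> A \<and> irreducible_in T Z \<and>
     (\<forall>Z'. Z \<subseteq> Z' \<and> Z' \<subseteq> A \<and> irreducible_in T Z' \<longrightarrow> Z' = Z)"

text \<open>
  The dimension of a variety is its Krull dimension.  The supremum is the one of \<open>nat\<close>, hence
  meaningful only if the lengths of chains are bounded, which holds for subspaces of \<open>zariski n\<close>.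
\<close>

definition krull_dim :: "'a topology \<Rightarrow> nat" where
  "krull_dim T = Sup {k. \<exists>Z :: nat \<Rightarrow> 'a set.
     (\<forall>i\<le>k. closedin T (Z i) \<and> irreducible_in T (Z i)) \<and> (\<forall>i<k. Z i \<subset> Z (Suc i))}"


section \<open>Schubert varieties\<close>

text \<open>
  Elements of \<open>GL(E)\<close> are represented by linear endomaps of the ambient space \<open>nat \<Rightarrow> complex\<close>
  that restrict to bijections of \<open>E\<close>; the behaviour outside \<open>E\<close> is irrelevant.
\<close>

definition GL :: "nat \<Rightarrow> (cvec \<Rightarrow> cvec) set" where
  "GL n = {g. Vector_Spaces.linear vscale vscale g \<and> bij_betw g (E n) (E n)}"

definition Sp :: "nat \<Rightarrow> (cvec \<Rightarrow> cvec) set" where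
  "Sp n = {g \<in> GL n. \<forall>u\<in>E n. \<forall>v\<in>E n. omega n (g u) (g v) = omega n u v}"

definition Borel :: "nat \<Rightarrow> (cvec \<Rightarrow> cvec) set" where
  "Borel n = {g \<in> Sp n. \<forall>i\<in>{1..2 * n + 1}. \<forall>j\<in>{1..2 * n + 1}. j < i \<longrightarrow> g (evec j) i = 0}"

definition Wodd :: "nat \<Rightarrow> (nat \<times> nat) set" where
  "Wodd n = {(a, b). a \<in> {1..2 * n + 1} \<and> b \<in> {1..2 * n + 1} \<and> a \<noteq> b \<and> a \<noteq> lbar n b}"

definition coord_flag :: "nat \<times> nat \<Rightarrow> flag" where
  "coord_flag = (\<lambda>(a, b). (cvec.span {evec a}, cvec.span {evec a, evec b}))"

definition Borel_orbit :: "nat \<Rightarrow> flag \<Rightarrow> flag set" where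
  "Borel_orbit n F = {(g ` fst F, g ` snd F) | g. g \<in> Borel n}"

definition Schubert :: "nat \<Rightarrow> nat \<times> nat \<Rightarrow> flag set" where
  "Schubert n w = zariski n closure_of Borel_orbit n (coord_flag w)"

definition ell :: "nat \<Rightarrow> nat \<times> nat \<Rightarrow> nat" where
  "ell n w = krull_dim (subtopology (zariski n) (Schubert n w))"

definition bruhat_le :: "nat \<Rightarrow> nat \<times> nat \<Rightarrow> nat \<times> nat \<Rightarrow> bool" where
  "bruhat_le n v w \<longleftrightarrow> Schubert n v \<subseteq> Schubert n w"


section \<open>Stable maps and curve neighborhoods\<close>

text \<open>
  Points of the projective line: \<open>Some z\<close> is \<open>[z : 1]\<close> and \<open>None\<close> is \<open>[1 : 0]\<close>.
\<close>

type_synonym P1 = "complex option"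

definition hcoords :: "P1 \<Rightarrow> complex \<times> complex" where
  "hcoords p = (case p of Some z \<Rightarrow> (z, 1) | None \<Rightarrow> (1, 0))"

text \<open>
  The value at \<open>p = [s : t]\<close> of the family (indexed by \<open>'i\<close>) of binary forms of degree \<open>k\<close>
  with coefficients \<open>c\<close>.
\<close>

definition form_value :: "nat \<Rightarrow> (nat \<Rightarrow> 'i \<Rightarrow> complex) \<Rightarrow> P1 \<Rightarrow> 'i \<Rightarrow> complex" where
  "form_value k c p =
     (case hcoords p of (s, t) \<Rightarrow> (\<lambda>i. \<Sum>j\<le>k. c j i * s ^ j * t ^ (k - j)))"

text \<open>
  A morphism from the projective line to a projective space, of degree \<open>k\<close> with respect to
  \<open>O(1)\<close>, is given by binary forms of degree \<open>k\<close> without common zero.  That the forms \<open>F\<close> and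
  \<open>G\<close> below have no common zero is automatic, because the spaces of a flag in \<open>IF n\<close> have
  dimensions 1 and 2.
\<close>

definition P1_morphism :: "nat \<Rightarrow> nat \<times> nat \<Rightarrow> (P1 \<Rightarrow> flag) \<Rightarrow> bool" where
  "P1_morphism n d f \<longleftrightarrow> (\<forall>p. f p \<in> IF n) \<and>
     (\<exists>F G. \<forall>p. fst (f p) = cvec.span {form_value (fst d) F p} \<and>
        (\<exists>y z. snd (f p) = cvec.span {y, z} \<and> plucker y z = form_value (snd d) G p))"

text \<open>
  A map to \<open>IF n\<close> from a nodal curve with rational components and two marked points.  A pair
  \<open>(v, p)\<close> is the point \<open>p\<close> of the component \<open>v\<close>; an element \<open>((u, p), (v, q))\<close> of \<open>nodes\<close> is
  the node obtained by gluing these two points, each node being listed in one order only.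
  \<open>cdeg\<close> gives the degrees of the restrictions of the map to the components.
\<close>

record two_pointed_map =
  comps :: "nat set"
  nodes :: "((nat \<times> P1) \<times> (nat \<times> P1)) set"
  cmap :: "nat \<Rightarrow> P1 \<Rightarrow> flag"
  cdeg :: "nat \<Rightarrow> nat \<times> nat"
  mark1 :: "nat \<times> P1"
  mark2 :: "nat \<times> P1"

definition node_branches :: "two_pointed_map \<Rightarrow> (nat \<times> P1) set" where
  "node_branches S = fst ` nodes S \<union> snd ` nodes S"

definition adjacent :: "two_pointed_map \<Rightarrow> (nat \<times> nat) set" where
  "adjacent S = {(u, v). \<exists>p q. ((u, p), (v, q)) \<in> nodes S}"

text \<open>
  For a connected nodal curve with rational components, the arithmetic genus is
  \<open>card nodes - card comps + 1\<close>.
\<close>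

definition genus0_curve :: "two_pointed_map \<Rightarrow> bool" where
  "genus0_curve S \<longleftrightarrow> finite (comps S) \<and> comps S \<noteq> {} \<and> finite (nodes S) \<and>
     node_branches S \<subseteq> comps S \<times> UNIV \<and>
     inj_on fst (nodes S) \<and> inj_on snd (nodes S) \<and> fst ` nodes S \<inter> snd ` nodes S = {} \<and>
     (\<forall>u\<in>comps S. \<forall>v\<in>comps S. (u, v) \<in> (adjacent S \<union> (adjacent S)\<inverse>)\<^sup>*) \<and>
     card (nodes S) + 1 = card (comps S)"

definition smooth_distinct_marks :: "two_pointed_map \<Rightarrow> bool" where
  "smooth_distinct_marks S \<longleftrightarrow> {mark1 S, mark2 S} \<subseteq> comps S \<times> UNIV \<and> mark1 S \<noteq> mark2 S \<and>
     {mark1 S, mark2 S} \<inter> node_branches S = {}"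

definition map_at :: "two_pointed_map \<Rightarrow> nat \<times> P1 \<Rightarrow> flag" where
  "map_at S x = cmap S (fst x) (snd x)"

definition morphism_to_IF :: "nat \<Rightarrow> two_pointed_map \<Rightarrow> bool" where
  "morphism_to_IF n S \<longleftrightarrow> (\<forall>v\<in>comps S. P1_morphism n (cdeg S v) (cmap S v)) \<and>
     (\<forall>(x, y)\<in>nodes S. map_at S x = map_at S y)"

definition stable :: "two_pointed_map \<Rightarrow> bool" where
  "stable S \<longleftrightarrow> (\<forall>v\<in>comps S. cdeg S v = (0, 0) \<longrightarrow>
     card {p. (v, p) \<in> node_branches S \<union> {mark1 S, mark2 S}} \<ge> 3)"

definition total_degree :: "two_pointed_map \<Rightarrow> nat \<times> nat" where
  "total_degree S = (\<Sum>v\<in>comps S. fst (cdeg S v), \<Sum>v\<in>comps S. snd (cdeg S v))"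

definition stable_maps :: "nat \<Rightarrow> nat \<times> nat \<Rightarrow> two_pointed_map set" where
  "stable_maps n d = {S. genus0_curve S \<and> smooth_distinct_marks S \<and> morphism_to_IF n S \<and>
     stable S \<and> total_degree S = d}"

text \<open>
  The moduli space enters the curve neighborhood only through the evaluations of its points,
  so isomorphic stable maps need not be identified.
\<close>

definition curve_nbhd :: "nat \<Rightarrow> nat \<times> nat \<Rightarrow> flag set \<Rightarrow> flag set" where
  "curve_nbhd n d \<Omega> = {map_at S (mark2 S) | S. S \<in> stable_maps n d \<and> map_at S (mark1 S) \<in> \<Omega>}"


section \<open>The combinatorial quantum Bruhat graph\<close>

definition anticanonical_degree :: "nat \<Rightarrow> nat \<times> nat \<Rightarrow> int" where
  "anticanonical_degree n d = 2 * int (fst d) + (2 * int n - 1) * int (snd d)"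

definition classical_edge :: "nat \<Rightarrow> nat \<times> nat \<Rightarrow> nat \<times> nat \<Rightarrow> bool" where
  "classical_edge n u v \<longleftrightarrow> bruhat_le n v u \<and> int (ell n v) = int (ell n u) - 1"

definition quantum_edge :: "nat \<Rightarrow> nat \<times> nat \<Rightarrow> nat \<times> nat \<Rightarrow> bool" where
  "quantum_edge n u v \<longleftrightarrow> (\<exists>d. d \<noteq> (0, 0) \<and>
     irreducible_component (zariski n) (curve_nbhd n d (Schubert n u)) (Schubert n v) \<and>
     int (ell n v) - int (ell n u) = anticanonical_degree n d - 1)"

definition quantum_bruhat_graph :: "nat \<Rightarrow> (nat \<times> nat, (nat \<times> nat) \<times> (nat \<times> nat)) pre_digraph"
  where
  "quantum_bruhat_graph n = with_proj \<lparr> pverts = Wodd n,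
     parcs = {(u, v). u \<in> Wodd n \<and> v \<in> Wodd n \<and> (classical_edge n u v \<or> quantum_edge n u v)} \<rparr>"

text \<open>\<open>as\<close> is the set of coefficients of the first Chern class in the Schubert divisors.\<close>

definition combinatorial_property_O :: "('a, 'b) pre_digraph \<Rightarrow> nat set \<Rightarrow> bool" where
  "combinatorial_property_O G as \<longleftrightarrow> strongly_connected G \<and>
     Gcd {length p | p. pre_digraph.cycle G p} = Gcd as"

end

theory Submission
  imports Defs "HOL-Computational_Algebra.Polynomial"
begin

text \<open>
  Borel orbits are described by leading indices: transvections show that \<open>B\<close> is transitive on the
  isotropic flags \<open>\<langle>x\<rangle> \<subset> \<langle>x, y\<rangle>\<close> with \<open>x\<close> leading at \<open>a\<close> and \<open>y\<close> at \<open>b\<close>, and these flags are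
  parametrized polynomially by an affine space.  Joining two parameters by a line gives
  irreducibility.  The Krull dimension of the closure is at most the number of parameters by
  a comparison of Hilbert functions: a form vanishing on a member of a chain of irreducible closed
  sets but not on the next one forces the Hilbert functions to grow by one degree at each step,
  while on the closure of a cell forms pull back to polynomials in the parameters.

  In the Bruhat order, \<open>(a|c) < (a|b)\<close> for \<open>c < b\<close> and \<open>(b|a) < (a|b)\<close> for \<open>b < a\<close>.  The covers of these
  two kinds lead from any vertex down to \<open>(1|2)\<close> and from the open cell down to any vertex.  The graph
  is strongly connected because of the quantum edges
  \<open>(1|2) \<rightarrow> (2|1) \<rightarrow> (1|2n+1) \<rightarrow> (2n+1|1) \<rightarrow> (2n+1|2n)\<close> of degrees \<open>(1,0)\<close>, \<open>(0,1)\<close>, \<open>(1,0)\<close>, \<open>(0,1)\<close>.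
  The cycle \<open>(1|2) \<rightarrow> (2|1) \<rightarrow> (1|2)\<close> has length \<open>2\<close>, and the cycle
  \<open>(2|1) \<rightarrow> (1|2n+1) \<rightarrow> (1|2n) \<rightarrow> \<dots> \<rightarrow> (1|2) \<rightarrow> (2|1)\<close> has length \<open>2n+1\<close>.
\<close>

section \<open>Lines and planes\<close>

text \<open>A curve of degree (1,0) keeps V2 fixed and one of degree (0,1) keeps V1 fixed.
  Conversely, two flags with the same V2 lie in the line P(V2), and two flags with the same V1 are
  joined by a pencil of isotropic planes through V1. So the four curve neighborhoods are found by
  linear algebra: pass to all flags that share V2, or V1, with a given one. Along the path the
  dimensions are 0, 1, 2n-1, 2n, 4n-2, and the jumps 1 and 2n-2 are the anticanonical degrees 2 and
  2n-1 minus one.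

  The obstacle is \<open>ell\<close>, a supremum in \<open>nat\<close> that carries information only
  once chains are known to be bounded. The Hilbert function bounds them by \<open>cell_dim\<close>;
  the reverse inequality comes from descending to the point (1|2) through Schubert varieties whose
  \<open>cell_dim\<close> drops by exactly one each time. These same covers are the classical
  edges.\<close>

lemma mem_span1: "v \<in> cvec.span {x} \<longleftrightarrow> (\<exists>c. v = vscale c x)"
  by (auto simp: cvec.span_singleton)

lemma mem_span2: "v \<in> cvec.span {x, y} \<longleftrightarrow> (\<exists>c d. v = vscale c x + vscale d y)"
proof -
  have "v - vscale c x = vscale d y \<longleftrightarrow> v = vscale c x + vscale d y" for c d
    by (auto simp: algebra_simps)
  then show ?thesis by (simp add: cvec.span_breakdown_eq[of v x] mem_span1)
qed

lemma plucker_apply: "plucker y z (i, j) = y i * z j - y j * z i"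
  by (simp add: plucker_def)

text \<open>The factor is the determinant of the change of basis, so a plane determines its bivector
  up to a scalar.\<close>

lemma plucker_comb:
  "plucker (vscale a y + vscale b z) (vscale c y + vscale d z) =
     (\<lambda>ij. (a * d - b * c) * plucker y z ij)"
  by (auto simp: fun_eq_iff plucker_apply vscale_def algebra_simps)

lemma plucker_zero [simp]: "plucker 0 z = 0" "plucker y 0 = 0"
  by (auto simp: fun_eq_iff plucker_apply)

lemma plucker_same: "plucker y y = 0"
  by (auto simp: fun_eq_iff plucker_apply)

lemma dependent_if_plucker_zero:
  assumes "plucker y z = 0"
  shows "y = 0 \<or> (\<exists>c. z = vscale c y)"
proof (cases "y = 0")
  case False
  then obtain j where j: "y j \<noteq> 0" by (auto simp: fun_eq_iff)
  have "z = vscale (z j / y j) y"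
  proof
    fix i
    have "plucker y z (j, i) = 0" using assms by simp
    then show "z i = vscale (z j / y j) y i"
      using j by (simp add: plucker_apply vscale_def field_simps)
  qed
  then show ?thesis by blast
qed simp

text \<open>The condition \<open>x \<noteq> y\<close> belongs to the left side because for
  \<open>x = y\<close> the set \<open>{x, y}\<close> is a singleton, independent as soon as x is
  nonzero.\<close>

lemma independent_pair_iff_plucker:
  "x \<noteq> y \<and> cvec.independent {x, y} \<longleftrightarrow> plucker x y \<noteq> 0"
proof
  assume a: "x \<noteq> y \<and> cvec.independent {x, y}"
  then have "x \<noteq> 0" "y \<noteq> 0" using cvec.dependent_zero[of "{x, y}"] by auto
  moreover have "y \<notin> cvec.span {x}"
    using a by (auto simp: insert_commute[of x y] cvec.independent_insert split: if_splits)
  ultimately show "plucker x y \<noteq> 0"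
    using dependent_if_plucker_zero[of x y] by (auto simp: mem_span1)
next
  assume p: "plucker x y \<noteq> 0"
  then have "x \<noteq> y" using plucker_same by auto
  have "y \<notin> cvec.span {x}"
  proof
    assume "y \<in> cvec.span {x}"
    then obtain c where "y = vscale c x" by (auto simp: mem_span1)
    then have "plucker x y = 0" by (auto simp: fun_eq_iff plucker_apply vscale_def)
    with p show False by simp
  qed
  moreover have "x \<noteq> 0"
    using p by auto
  ultimately have "cvec.independent {y, x}"
    by (intro cvec.independent_insertI) (auto simp: cvec.independent_empty)
  then show "x \<noteq> y \<and> cvec.independent {x, y}"
    using \<open>x \<noteq> y\<close> by (simp add: insert_commute)
qed

text \<open>The right-hand side is the vanishing of the trivector \<open>v \<and> y \<and> z\<close>.\<close>

lemma mem_span2_iff_plucker: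
  assumes "plucker y z \<noteq> 0"
  shows "v \<in> cvec.span {y, z} \<longleftrightarrow>
    (\<forall>i j k. v i * plucker y z (j, k) - v j * plucker y z (i, k) + v k * plucker y z (i, j) = 0)"
proof
  assume "v \<in> cvec.span {y, z}"
  then show "\<forall>i j k. v i * plucker y z (j, k) - v j * plucker y z (i, k) + v k * plucker y z (i, j) = 0"
    by (auto simp: mem_span2 plucker_apply vscale_def algebra_simps)
next
  assume a: "\<forall>i j k. v i * plucker y z (j, k) - v j * plucker y z (i, k) + v k * plucker y z (i, j) = 0"
  obtain j k where p: "plucker y z (j, k) \<noteq> 0"
    using assms by (auto simp: fun_eq_iff)
  define P where "P = plucker y z (j, k)"
  have "P \<noteq> 0" using p by (simp add: P_def)
  \<comment> \<open>The coefficients are those of Cramer's rule for the coordinates j and k, where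
    the minor \<open>P\<close> of y and z is nonzero.\<close>
  have "v = vscale ((v j * z k - v k * z j) / P) y + vscale ((v k * y j - v j * y k) / P) z"
  proof
    fix i
    have "v i * P - v j * plucker y z (i, k) + v k * plucker y z (i, j) = 0"
      using a by (simp add: P_def)
    then have "v i * P = v j * (y i * z k - y k * z i) - v k * (y i * z j - y j * z i)"
      by (simp add: plucker_apply algebra_simps)
    then have "v i = (v j * (y i * z k - y k * z i) - v k * (y i * z j - y j * z i)) / P"
      using \<open>P \<noteq> 0\<close> by (simp add: field_simps)
    also have "\<dots> = (vscale ((v j * z k - v k * z j) / P) y + vscale ((v k * y j - v j * y k) / P) z) i"
      using \<open>P \<noteq> 0\<close> by (simp add: vscale_def field_simps)
    finally show "v i = (vscale ((v j * z k - v k * z j) / P) y + vscale ((v k * y j - v j * y k) / P) z) i" .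
  qed
  then show "v \<in> cvec.span {y, z}" by (auto simp: mem_span2)
qed

lemma span_eq_if_plucker_eq:
  assumes "plucker y z \<noteq> 0" "plucker y' z' = plucker y z"
  shows "cvec.span {y', z'} = cvec.span {y, z}"
  using mem_span2_iff_plucker[of y z] mem_span2_iff_plucker[of y' z'] assms by auto

lemma plucker_scale_if_span_eq:
  assumes "cvec.span {y', z'} = cvec.span {y, z}" "plucker y z \<noteq> 0"
  obtains d where "d \<noteq> 0" "plucker y' z' = (\<lambda>ij. d * plucker y z ij)"
proof -
  have *: "\<exists>d. plucker u v = (\<lambda>ij. d * plucker y z ij)"
    if "cvec.span {u, v} = cvec.span {y, z}" for u v y z
  proof -
    have "u \<in> cvec.span {y, z}" "v \<in> cvec.span {y, z}"
      using that cvec.span_superset by blast+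
    then show ?thesis
      by (auto simp: mem_span2 plucker_comb)
  qed
  obtain d where d: "plucker y' z' = (\<lambda>ij. d * plucker y z ij)" using *[OF assms(1)] by auto
  obtain e where e: "plucker y z = (\<lambda>ij. e * plucker y' z' ij)" using *[OF assms(1)[symmetric]] by auto
  have "d \<noteq> 0"
  proof
    assume "d = 0"
    then have "plucker y z = 0" using e d by (auto simp: fun_eq_iff)
    with assms(2) show False by simp
  qed
  with d show ?thesis using that by blast
qed

text \<open>The two bivectors are proportional, so the linear equations of
  \<open>mem_span2_iff_plucker\<close> for the two planes coincide.\<close>

lemma span2_eq:
  assumes "u \<in> cvec.span {y, z}" "v \<in> cvec.span {y, z}" "plucker u v \<noteq> 0"
  shows "cvec.span {u, v} = cvec.span {y, z}"
proof -
  obtain d where d: "plucker u v = (\<lambda>ij. d * plucker y z ij)"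
    using assms(1,2) by (auto simp: mem_span2 plucker_comb)
  with assms(3) have "d \<noteq> 0" "plucker y z \<noteq> 0" by (auto simp: fun_eq_iff)
  then show ?thesis
    using mem_span2_iff_plucker[of y z] mem_span2_iff_plucker[of u v] assms(3) unfolding d
    by (intro set_eqI) (simp add: mult.left_commute[of _ d] flip: right_diff_distrib distrib_left)
qed

lemma span1_eq:
  assumes "u \<in> cvec.span {x}" "u \<noteq> 0"
  shows "cvec.span {u} = cvec.span {x}"
proof -
  obtain c where c: "u = vscale c x" using assms by (auto simp: mem_span1)
  then have "c \<noteq> 0" using assms by auto
  then have "x = vscale (1 / c) u" by (simp add: c)
  then have "x \<in> cvec.span {u}" by (metis mem_span1)
  then show ?thesis using assms(1) by (auto simp: cvec.span_eq)
qed

section \<open>The form and the flags\<close>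

text \<open>For a label i in {2..2n+1} this is the value of the form on e_i and its partner
  \<open>lbar n i\<close>: the label comes before its bar exactly when it is at most n+1.\<close>

definition osgn :: "nat \<Rightarrow> nat \<Rightarrow> complex" where
  "osgn n i = (if i \<le> n + 1 then 1 else - 1)"

lemma osgn_nonzero [simp]: "osgn n i \<noteq> 0"
  and osgn_square [simp]: "osgn n i * osgn n i = 1"
  by (simp_all add: osgn_def)

lemma osgn_lbar: "i \<in> {2..2 * n + 1} \<Longrightarrow> osgn n (lbar n i) = - osgn n i"
  by (auto simp: osgn_def lbar_def)

text \<open>Each row of the matrix of the form has at most one nonzero entry. The row of 1 has none,
  since the bar of 1 is 2n+2, which is no label of E.\<close>

lemma omega_eq: "omega n x y = (\<Sum>i\<in>{2..2 * n + 1}. osgn n i * x i * y (lbar n i))"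
proof -
  have *: "(\<Sum>j\<in>{1..2 * n + 1}. x i * y j * omega_basis n i j) =
      (if i \<in> {2..2 * n + 1} then osgn n i * x i * y (lbar n i) else 0)" if "i \<in> {1..2 * n + 1}" for i
  proof -
    have "x i * y j * omega_basis n i j = (if j = lbar n i then x i * y j * osgn n i else 0)"
      if j: "j \<in> {1..2 * n + 1}" for j
    proof (cases "i = lbar n j")
      case True
      then have "j = lbar n i" "i \<le> j \<longleftrightarrow> i \<le> n + 1" using j by (auto simp: lbar_def)
      with True show ?thesis by (simp add: omega_basis_def osgn_def)
    next
      case False
      then have "j \<noteq> lbar n i" using \<open>i \<in> _\<close> j by (auto simp: lbar_def)
      with False show ?thesis by (simp add: omega_basis_def)
    qed
    then have "(\<Sum>j\<in>{1..2 * n + 1}. x i * y j * omega_basis n i j) =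
       (\<Sum>j\<in>{1..2 * n + 1}. if j = lbar n i then x i * y j * osgn n i else 0)"
      by (intro sum.cong) auto
    also have "\<dots> = (if lbar n i \<in> {1..2 * n + 1} then x i * y (lbar n i) * osgn n i else 0)"
      by (subst sum.delta) auto
    also have "lbar n i \<in> {1..2 * n + 1} \<longleftrightarrow> i \<in> {2..2 * n + 1}" using that by (auto simp: lbar_def)
    finally show ?thesis by (simp add: mult_ac)
  qed
  have "omega n x y = (\<Sum>i\<in>{1..2 * n + 1}. if i \<in> {2..2 * n + 1} then osgn n i * x i * y (lbar n i) else 0)"
    unfolding omega_def by (intro sum.cong) (use * in auto)
  also have "\<dots> = (\<Sum>i\<in>{2..2 * n + 1}. osgn n i * x i * y (lbar n i))"
    by (intro sum.mono_neutral_cong_right) auto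
  finally show ?thesis .
qed

lemma omega_add_left: "omega n (x + x') y = omega n x y + omega n x' y"
  and omega_add_right: "omega n x (y + y') = omega n x y + omega n x y'"
  and omega_scale_left: "omega n (vscale c x) y = c * omega n x y"
  and omega_scale_right: "omega n x (vscale c y) = c * omega n x y"
  by (auto simp: omega_eq vscale_def algebra_simps sum.distrib sum_distrib_left)

text \<open>The involution \<open>lbar\<close> of {2..2n+1} exchanges the two arguments of each term
  and reverses its sign.\<close>

lemma omega_skew: "omega n x y = - omega n y x"
proof -
  have "omega n y x = (\<Sum>i\<in>{2..2 * n + 1}. osgn n (lbar n i) * y (lbar n i) * x (lbar n (lbar n i)))"
    unfolding omega_eq
    by (rule sum.reindex_bij_witness[of _ "lbar n" "lbar n"]) (auto simp: lbar_def)
  also have "\<dots> = (\<Sum>i\<in>{2..2 * n + 1}. - (osgn n i * x i * y (lbar n i)))"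
    by (intro sum.cong refl) (auto simp: osgn_lbar, simp add: lbar_def)
  finally show ?thesis by (simp add: omega_eq sum_negf)
qed

lemma omega_self [simp]: "omega n x x = 0"
  using omega_skew[of n x x] by simp

lemmas omega_bilinear = omega_add_left omega_add_right omega_scale_left omega_scale_right

lemma omega_evec_left:
  "omega n (evec i) y = (if i \<in> {2..2 * n + 1} then osgn n i * y (lbar n i) else 0)"
proof -
  have "omega n (evec i) y = (\<Sum>j\<in>{2..2 * n + 1}. if j = i then osgn n i * y (lbar n i) else 0)"
    unfolding omega_eq by (intro sum.cong) (auto simp: evec_def)
  then show ?thesis by (subst (asm) sum.delta) auto
qed

lemma omega_evec_right:
  "omega n x (evec i) = (if i \<in> {2..2 * n + 1} then - osgn n i * x (lbar n i) else 0)"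
  using omega_skew[of n x "evec i"] by (simp add: omega_evec_left)

lemma subspace_E: "cvec.subspace (E n)"
  by (auto simp: cvec.subspace_def E_def vscale_def)

lemma evec_E [simp]: "evec i \<in> E n \<longleftrightarrow> i \<in> {1..2 * n + 1}"
  by (auto simp: evec_def E_def)

text \<open>Flags are handled through a basis of V2 whose first vector spans V1, so that a form on
  flags becomes a polynomial in the coordinates of x and y.\<close>

definition flag_of :: "cvec \<Rightarrow> cvec \<Rightarrow> flag" where
  "flag_of x y = (cvec.span {x}, cvec.span {x, y})"

lemma flag_of_in_IF_iff:
  "flag_of x y \<in> IF n \<longleftrightarrow> x \<in> E n \<and> y \<in> E n \<and> plucker x y \<noteq> 0 \<and> omega n x y = 0"
proof
  assume "flag_of x y \<in> IF n"
  then have h: "cvec.span {x, y} \<subseteq> E n" "cvec.dim {x, y} = 2" "isotropic n (cvec.span {x, y})"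
    by (auto simp: IF_def flag_of_def)
  have xy: "x \<in> cvec.span {x, y}" "y \<in> cvec.span {x, y}" by (auto intro: cvec.span_base)
  have "x \<noteq> y \<and> cvec.independent {x, y}"
  proof -
    obtain B where B: "B \<subseteq> {x, y}" "cvec.independent B" "card B = 2"
      using cvec.basis_exists[of "{x, y}"] h(2) by metis
    have "card {x, y} \<le> 2" by (simp add: card_insert_if)
    then have "B = {x, y}" using B by (intro card_seteq) auto
    with B show ?thesis by auto
  qed
  then show "x \<in> E n \<and> y \<in> E n \<and> plucker x y \<noteq> 0 \<and> omega n x y = 0"
    using h xy independent_pair_iff_plucker by (auto simp: isotropic_def)
next
  assume a: "x \<in> E n \<and> y \<in> E n \<and> plucker x y \<noteq> 0 \<and> omega n x y = 0"
  then have ind: "x \<noteq> y" "cvec.independent {x, y}" using independent_pair_iff_plucker by auto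
  have "cvec.independent {x}" using ind(2) cvec.independent_mono by blast
  then have "cvec.dim {x} = 1" by (simp add: cvec.dim_eq_card_independent)
  moreover have "cvec.dim {x, y} = 2" using ind by (simp add: cvec.dim_eq_card_independent)
  moreover have "cvec.span {x, y} \<subseteq> E n" using a by (intro cvec.span_minimal subspace_E) auto
  moreover have "cvec.span {x} \<subseteq> cvec.span {x, y}" by (intro cvec.span_mono) auto
  moreover have "omega n y x = 0" using a omega_skew[of n y x] by simp
  then have "isotropic n (cvec.span {x, y})"
    using a by (auto simp: isotropic_def mem_span2 omega_bilinear)
  moreover from this and \<open>cvec.span {x} \<subseteq> cvec.span {x, y}\<close> have "isotropic n (cvec.span {x})"
    unfolding isotropic_def by blast
  ultimately show "flag_of x y \<in> IF n"
    by (simp add: IF_def flag_of_def)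
qed

lemma flag_cases:
  assumes "F \<in> IF n"
  obtains x y where "F = flag_of x y" "x \<in> E n" "y \<in> E n" "plucker x y \<noteq> 0" "omega n x y = 0"
proof -
  obtain V1 V2 where F: "F = (V1, V2)" by (cases F)
  with assms have h: "cvec.subspace V1" "cvec.subspace V2" "V1 \<subseteq> V2"
     "cvec.dim V1 = 1" "cvec.dim V2 = 2" by (auto simp: IF_def)
  obtain B where B: "B \<subseteq> V1" "cvec.independent B" "V1 \<subseteq> cvec.span B" "card B = 1"
    using cvec.basis_exists[of V1] h by metis
  then obtain x where x: "B = {x}" using card_1_singletonE by metis
  have V1: "V1 = cvec.span {x}"
    using B x h(1) cvec.span_minimal[of "{x}" V1] by auto
  obtain B' where B': "{x} \<subseteq> B'" "B' \<subseteq> V2" "cvec.independent B'" "V2 \<subseteq> cvec.span B'"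
    using cvec.maximal_independent_subset_extend[of "{x}" V2] B h x by auto
  have "card B' = 2" using cvec.dim_eq_card[of B' V2] B' h(2,5)
    by (metis cvec.span_minimal cvec.dim_span_eq_card_independent equalityI)
  with B'(1) obtain y where "B' = {x, y}" by (auto simp: card_2_iff)
  then have "V2 = cvec.span {x, y}" using B' h(2) cvec.span_minimal[of "{x, y}" V2] by auto
  then have "F = flag_of x y" using F V1 by (simp add: flag_of_def)
  then show ?thesis using that assms flag_of_in_IF_iff by blast
qed

lemma flag_of_eq:
  assumes "x' \<in> cvec.span {x}" "y' \<in> cvec.span {x, y}" "plucker x' y' \<noteq> 0"
  shows "flag_of x' y' = flag_of x y"
proof -
  have "x' \<noteq> 0" using assms(3) by auto
  moreover have "x' \<in> cvec.span {x, y}" using assms(1) cvec.span_mono[of "{x}" "{x, y}"] by auto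
  ultimately show ?thesis
    using span1_eq[OF assms(1)] span2_eq[OF _ assms(2,3)] unfolding flag_of_def by blast
qed

section \<open>The Zariski topology\<close>

lemma bihom_scale:
  "bihom a b P \<Longrightarrow> P (vscale c x) (\<lambda>ij. d * p ij) = c ^ a * d ^ b * P x p"
  by (induction rule: bihom.induct) (auto simp: vscale_def power_add algebra_simps)

lemma bihom_coord1_power: "bihom k 0 (\<lambda>x p. x i ^ k)"
proof (induction k)
  case (Suc k)
  then show ?case using bihom.mult[OF bihom.coord1 Suc] by simp
qed (simp add: bihom.const)

lemma bihom_coord2_power: "bihom 0 k (\<lambda>x p. p (i, j) ^ k)"
proof (induction k)
  case (Suc k)
  then show ?case using bihom.mult[OF bihom.coord2 Suc] by simp
qed (simp add: bihom.const)

lemma bihom_power: "bihom a b P \<Longrightarrow> bihom (k * a) (k * b) (\<lambda>x p. P x p ^ k)"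
proof (induction k)
  case (Suc k)
  then show ?case using bihom.mult[OF Suc.prems Suc.IH[OF Suc.prems]] by simp
qed (simp add: bihom.const)

text \<open>The rule \<open>const\<close> yields zero only in bidegree (0, 0); multiplying by powers
  of coordinates moves it to (a, b).\<close>

lemma bihom_zero: "bihom a b (\<lambda>x p. 0)"
proof -
  have "bihom (0 + a + 0) (0 + 0 + b) (\<lambda>x p. 0 * x 0 ^ a * p (0, 0) ^ b)"
    by (intro bihom.mult bihom.const bihom_coord1_power bihom_coord2_power)
  then show ?thesis by simp
qed

lemma bihom_scaled: "bihom a b P \<Longrightarrow> bihom a b (\<lambda>x p. c * P x p)"
  using bihom.mult[OF bihom.const[of c]] by fastforce

lemma bihom_sum:
  assumes "\<And>i. i \<in> S \<Longrightarrow> bihom a b (P i)"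
  shows "bihom a b (\<lambda>x p. \<Sum>i\<in>S. P i x p)"
  using assms by (induction S rule: infinite_finite_induct) (auto intro: bihom_zero bihom.add)

lemma flag_of_eq_spans:
  assumes "flag_of x y = (cvec.span {x'}, cvec.span {y', z'})" "plucker x y \<noteq> 0"
  obtains c d where "c \<noteq> 0" "d \<noteq> 0" "x' = vscale c x" "plucker y' z' = (\<lambda>ij. d * plucker x y ij)"
proof -
  have 1: "cvec.span {x'} = cvec.span {x}" "cvec.span {y', z'} = cvec.span {x, y}"
    using assms(1) by (auto simp: flag_of_def)
  obtain d where d: "d \<noteq> 0" "plucker y' z' = (\<lambda>ij. d * plucker x y ij)"
    using plucker_scale_if_span_eq[OF 1(2) assms(2)] by metis
  have "x' \<in> cvec.span {x}" "x \<in> cvec.span {x'}" using 1(1) cvec.span_superset by blast+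
  then obtain c e where "x' = vscale c x" "x = vscale e x'" unfolding mem_span1 by blast
  moreover have "x \<noteq> 0" using assms(2) by auto
  ultimately have "c \<noteq> 0" by (metis cvec.scale_zero_left cvec.scale_zero_right)
  then show ?thesis using that[OF _ d(1) _ d(2)] \<open>x' = _\<close> by blast
qed

lemma nonvanishing_iff:
  assumes "bihom a b P" "flag_of x y \<in> IF n"
  shows "flag_of x y \<in> nonvanishing n P \<longleftrightarrow> P x (plucker x y) \<noteq> 0"
proof
  assume "flag_of x y \<in> nonvanishing n P"
  then obtain x' y' z' where *: "flag_of x y = (cvec.span {x'}, cvec.span {y', z'})"
    "P x' (plucker y' z') \<noteq> 0" by (auto simp: nonvanishing_def)
  moreover have "plucker x y \<noteq> 0" using assms(2) by (simp add: flag_of_in_IF_iff)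
  ultimately obtain c d where "x' = vscale c x" "plucker y' z' = (\<lambda>ij. d * plucker x y ij)"
    using flag_of_eq_spans by blast
  with *(2) show "P x (plucker x y) \<noteq> 0"
    by (auto simp: bihom_scale[OF assms(1)])
next
  assume "P x (plucker x y) \<noteq> 0"
  then show "flag_of x y \<in> nonvanishing n P"
    using assms(2) by (auto simp: nonvanishing_def flag_of_def)
qed

lemma nonvanishing_subset: "nonvanishing n P \<subseteq> IF n"
  by (auto simp: nonvanishing_def)

lemma nonvanishing_mult:
  assumes "bihom a b P" "bihom a' b' Q"
  shows "nonvanishing n (\<lambda>x p. P x p * Q x p) = nonvanishing n P \<inter> nonvanishing n Q"
proof -
  have "F \<in> nonvanishing n (\<lambda>x p. P x p * Q x p) \<longleftrightarrow> F \<in> nonvanishing n P \<inter> nonvanishing n Q"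
    if "F \<in> IF n" for F
    using that by (rule flag_cases)
      (use that in \<open>simp add: nonvanishing_iff[OF bihom.mult[OF assms]]
        nonvanishing_iff[OF assms(1)] nonvanishing_iff[OF assms(2)]\<close>)
  then show ?thesis using nonvanishing_subset by blast
qed

lemma nonvanishing_const: "nonvanishing n (\<lambda>x p. 1) = IF n"
proof -
  have "F \<in> nonvanishing n (\<lambda>x p. 1)" if "F \<in> IF n" for F
    using that by (rule flag_cases) (use that in \<open>simp add: nonvanishing_iff[OF bihom.const]\<close>)
  then show ?thesis using nonvanishing_subset by blast
qed

text \<open>The nonvanishing loci are by definition only a subbasis; since products of forms realize
  their intersections, they are a basis.\<close>

lemma openin_zariski_basis:
  assumes "openin (zariski n) U" "F \<in> U"
  obtains a b P where "bihom a b P" "F \<in> nonvanishing n P" "nonvanishing n P \<subseteq> U"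
proof -
  have "generate_topology_on {nonvanishing n P | P a b. bihom a b P} U"
    using assms(1) by (simp add: zariski_def openin_topology_generated_by_iff)
  then have "\<forall>F\<in>U. \<exists>P a b. bihom a b P \<and> F \<in> nonvanishing n P \<and> nonvanishing n P \<subseteq> U"
  proof induction
    case (Int A B)
    show ?case
    proof
      fix F assume "F \<in> A \<inter> B"
      then obtain P a b Q a' b' where *: "bihom a b P" "F \<in> nonvanishing n P" "nonvanishing n P \<subseteq> A"
        "bihom a' b' Q" "F \<in> nonvanishing n Q" "nonvanishing n Q \<subseteq> B"
        using Int.IH by blast
      show "\<exists>P a b. bihom a b P \<and> F \<in> nonvanishing n P \<and> nonvanishing n P \<subseteq> A \<inter> B"
        using bihom.mult[OF *(1,4)] nonvanishing_mult[OF *(1,4)] * by blast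
    qed
  next
    case (UN K)
    then show ?case by (meson Union_iff Union_upper order_trans)
  qed blast+
  then show ?thesis using that assms(2) by blast
qed

lemma openin_nonvanishing: "bihom a b P \<Longrightarrow> openin (zariski n) (nonvanishing n P)"
  unfolding zariski_def by (rule topology_generated_by_Basis) blast

lemma topspace_zariski [simp]: "topspace (zariski n) = IF n"
proof
  show "topspace (zariski n) \<subseteq> IF n"
    unfolding zariski_def topology_generated_by_topspace using nonvanishing_subset by blast
  show "IF n \<subseteq> topspace (zariski n)"
    using openin_nonvanishing[OF bihom.const, of n 1] nonvanishing_const
    by (metis openin_subset)
qed

lemma closedin_vanishing: "bihom a b P \<Longrightarrow> closedin (zariski n) (IF n - nonvanishing n P)"
  using openin_nonvanishing by (metis closedin_diff closedin_topspace topspace_zariski)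

lemma in_closure_of_zariski:
  "F \<in> zariski n closure_of A \<longleftrightarrow>
     F \<in> IF n \<and> (\<forall>P a b. bihom a b P \<longrightarrow> F \<in> nonvanishing n P \<longrightarrow> (\<exists>G\<in>A. G \<in> nonvanishing n P))"
proof
  assume "F \<in> zariski n closure_of A"
  then show "F \<in> IF n \<and> (\<forall>P a b. bihom a b P \<longrightarrow> F \<in> nonvanishing n P \<longrightarrow> (\<exists>G\<in>A. G \<in> nonvanishing n P))"
    unfolding in_closure_of topspace_zariski using openin_nonvanishing by blast
next
  assume a: "F \<in> IF n \<and> (\<forall>P a b. bihom a b P \<longrightarrow> F \<in> nonvanishing n P \<longrightarrow> (\<exists>G\<in>A. G \<in> nonvanishing n P))"
  show "F \<in> zariski n closure_of A"
    unfolding in_closure_of topspace_zariski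
  proof (intro conjI allI impI)
    fix U assume "F \<in> U \<and> openin (zariski n) U"
    then obtain a b P where "bihom a b P" "F \<in> nonvanishing n P" "nonvanishing n P \<subseteq> U"
      using openin_zariski_basis by blast
    with a show "\<exists>y. y \<in> A \<and> y \<in> U" by blast
  qed (use a in simp)
qed

lemma nonvanishing_avoiding_closed:
  assumes "closedin (zariski n) C" "F \<in> IF n" "F \<notin> C"
  obtains a b P where "bihom a b P" "F \<in> nonvanishing n P" "C \<inter> nonvanishing n P = {}"
proof -
  have "openin (zariski n) (IF n - C)" using assms(1) by (simp add: closedin_def)
  then obtain a b P where "bihom a b P" "F \<in> nonvanishing n P" "nonvanishing n P \<subseteq> IF n - C"
    using openin_zariski_basis[of n "IF n - C" F] assms by blast
  then show ?thesis using that by blast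
qed

lemma irreducible_in_closure:
  assumes "irreducible_in T A"
  shows "irreducible_in T (T closure_of A)"
  unfolding irreducible_in_def
proof (intro conjI allI impI)
  show "T closure_of A \<subseteq> topspace T" by (rule closure_of_subset_topspace)
  have sub: "A \<subseteq> T closure_of A" using assms by (auto simp: irreducible_in_def closure_of_subset)
  then show "T closure_of A \<noteq> {}" using assms by (auto simp: irreducible_in_def)
  fix C D assume a: "closedin T C \<and> closedin T D \<and> T closure_of A \<subseteq> C \<union> D"
  then have "A \<subseteq> C \<or> A \<subseteq> D" using assms sub unfolding irreducible_in_def by blast
  then show "T closure_of A \<subseteq> C \<or> T closure_of A \<subseteq> D"
    using a by (meson closure_of_minimal)
qed

section \<open>Polynomial curves\<close>

definition is_poly :: "(complex \<Rightarrow> complex) \<Rightarrow> bool" where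
  "is_poly f \<longleftrightarrow> (\<exists>p. \<forall>t. f t = poly p t)"

lemma is_poly_const: "is_poly (\<lambda>t. c)"
  unfolding is_poly_def by (rule exI[of _ "[:c:]"]) auto

lemma is_poly_ident: "is_poly (\<lambda>t. t)"
  unfolding is_poly_def by (rule exI[of _ "[:0, 1:]"]) auto

lemma is_poly_add: "is_poly f \<Longrightarrow> is_poly g \<Longrightarrow> is_poly (\<lambda>t. f t + g t)"
  unfolding is_poly_def by (elim exE, rule_tac x="p + pa" in exI) simp

lemma is_poly_mult: "is_poly f \<Longrightarrow> is_poly g \<Longrightarrow> is_poly (\<lambda>t. f t * g t)"
  unfolding is_poly_def by (elim exE, rule_tac x="p * pa" in exI) simp

lemma is_poly_diff: "is_poly f \<Longrightarrow> is_poly g \<Longrightarrow> is_poly (\<lambda>t. f t - g t)"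
  unfolding is_poly_def by (elim exE, rule_tac x="p - pa" in exI) simp

lemmas is_poly_intros = is_poly_const is_poly_ident is_poly_add is_poly_mult is_poly_diff

lemma is_poly_finite_zeros: "is_poly f \<Longrightarrow> f t0 \<noteq> 0 \<Longrightarrow> finite {t. f t = 0}"
proof -
  assume "is_poly f" "f t0 \<noteq> 0"
  then obtain p where p: "\<And>t. f t = poly p t" by (auto simp: is_poly_def)
  with \<open>f t0 \<noteq> 0\<close> have "p \<noteq> 0" by auto
  then show ?thesis using poly_roots_finite[of p] by (simp add: p)
qed

lemma is_poly_bihom:
  assumes "bihom a b P" "\<And>i. is_poly (\<lambda>t. x t i)" "\<And>i. is_poly (\<lambda>t. y t i)"
  shows "is_poly (\<lambda>t. P (x t) (plucker (x t) (y t)))"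
  using assms(1)
  by (induction rule: bihom.induct)
    (auto simp: plucker_apply intro!: is_poly_intros assms(2,3))

text \<open>Along the curve a form is a polynomial in t. If it is nonzero at 0, it has finitely many
  zeros, so it is nonzero at some \<open>t \<noteq> 0\<close>, where the flag is known to lie in
  A.\<close>

lemma in_closure_of_curve:
  assumes "flag_of (x 0) (y 0) \<in> IF n" "A \<subseteq> IF n"
    and "\<And>t. t \<noteq> 0 \<Longrightarrow> flag_of (x t) (y t) \<in> A"
    and "\<And>i. is_poly (\<lambda>t. x t i)" "\<And>i. is_poly (\<lambda>t. y t i)"
  shows "flag_of (x 0) (y 0) \<in> zariski n closure_of A"
  unfolding in_closure_of_zariski
proof (intro conjI allI impI)
  fix P a b assume P: "bihom a b P" "flag_of (x 0) (y 0) \<in> nonvanishing n P"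
  define f where "f t = P (x t) (plucker (x t) (y t))" for t
  have "is_poly f" unfolding f_def by (rule is_poly_bihom[OF P(1) assms(4,5)])
  moreover have "f 0 \<noteq> 0" using P assms(1) by (simp add: f_def nonvanishing_iff[OF P(1)])
  ultimately have "finite (insert 0 {t. f t = 0})" using is_poly_finite_zeros by simp
  then obtain t where "t \<notin> insert 0 {t. f t = 0}"
    using ex_new_if_finite[OF infinite_UNIV_char_0] by blast
  then show "\<exists>G\<in>A. G \<in> nonvanishing n P"
    using assms(3)[of t] subsetD[OF assms(2) assms(3)[of t]]
    by (intro bexI[of _ "flag_of (x t) (y t)"]) (auto simp: f_def nonvanishing_iff[OF P(1)])
qed (use assms in auto)

text \<open>If C and D each missed a point of A, forms vanishing on C and on D would restrict to
  nonzero polynomials on the curve joining the two points, and some t would avoid the zeros of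
  both.\<close>

lemma irreducible_if_joined_by_curves:
  assumes "A \<subseteq> IF n" "A \<noteq> {}"
    and "\<And>F G. F \<in> A \<Longrightarrow> G \<in> A \<Longrightarrow> \<exists>x y. (\<forall>i. is_poly (\<lambda>t. x t i)) \<and> (\<forall>i. is_poly (\<lambda>t. y t i)) \<and>
       (\<forall>t. flag_of (x t) (y t) \<in> A) \<and> F = flag_of (x 0) (y 0) \<and> G = flag_of (x 1) (y 1)"
  shows "irreducible_in (zariski n) A"
  unfolding irreducible_in_def topspace_zariski
proof (intro conjI allI impI)
  fix C D assume CD: "closedin (zariski n) C \<and> closedin (zariski n) D \<and> A \<subseteq> C \<union> D"
  show "A \<subseteq> C \<or> A \<subseteq> D"
  proof (rule ccontr)
    assume "\<not> ?thesis"
    then obtain F G where FG: "F \<in> A" "F \<notin> C" "G \<in> A" "G \<notin> D" by blast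
    obtain x y where xy: "\<And>i. is_poly (\<lambda>t. x t i)" "\<And>i. is_poly (\<lambda>t. y t i)"
       "\<And>t. flag_of (x t) (y t) \<in> A" "F = flag_of (x 0) (y 0)" "G = flag_of (x 1) (y 1)"
      using assms(3)[OF FG(1,3)] by blast
    have IF: "flag_of (x t) (y t) \<in> IF n" for t using xy(3) assms(1) by blast
    obtain a b P where P: "bihom a b P" "F \<in> nonvanishing n P" "C \<inter> nonvanishing n P = {}"
      using nonvanishing_avoiding_closed[of n C F] CD FG assms(1) by (metis subsetD)
    obtain a' b' Q where Q: "bihom a' b' Q" "G \<in> nonvanishing n Q" "D \<inter> nonvanishing n Q = {}"
      using nonvanishing_avoiding_closed[of n D G] CD FG assms(1) by (metis subsetD)
    define f g where "f t = P (x t) (plucker (x t) (y t))"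
      and "g t = Q (x t) (plucker (x t) (y t))" for t
    have "is_poly f" "is_poly g" unfolding f_def g_def by (rule is_poly_bihom[OF P(1) xy(1,2)], rule is_poly_bihom[OF Q(1) xy(1,2)])
    moreover have "f 0 \<noteq> 0" "g 1 \<noteq> 0"
      using P(2) Q(2) unfolding f_def g_def xy(4,5) nonvanishing_iff[OF P(1) IF] nonvanishing_iff[OF Q(1) IF] .
    ultimately have "finite ({t. f t = 0} \<union> {t. g t = 0})" using is_poly_finite_zeros by simp
    then obtain t where "t \<notin> {t. f t = 0} \<union> {t. g t = 0}"
      using ex_new_if_finite[OF infinite_UNIV_char_0] by blast
    then have "flag_of (x t) (y t) \<in> nonvanishing n P" "flag_of (x t) (y t) \<in> nonvanishing n Q"
      unfolding nonvanishing_iff[OF P(1) IF] nonvanishing_iff[OF Q(1) IF] by (auto simp: f_def g_def)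
    then show False using CD xy(3)[of t] P(3) Q(3) by blast
  qed
qed (use assms in auto)

section \<open>Krull dimension\<close>

text \<open>The chains of \<open>krull_dim\<close>, stated in the ambient topology: for closed S,
  the closed irreducible subsets of the subspace are those of T contained in S. A chain of length k
  has k+1 members.\<close>

definition irreducible_chain :: "'a topology \<Rightarrow> 'a set \<Rightarrow> nat \<Rightarrow> (nat \<Rightarrow> 'a set) \<Rightarrow> bool" where
  "irreducible_chain T S k Z \<longleftrightarrow>
     (\<forall>i\<le>k. closedin T (Z i) \<and> Z i \<subseteq> S \<and> irreducible_in T (Z i)) \<and> (\<forall>i<k. Z i \<subset> Z (Suc i))"

lemma irreducible_inD:
  "irreducible_in T A \<Longrightarrow> closedin T C \<Longrightarrow> closedin T D \<Longrightarrow> A \<subseteq> C \<union> D \<Longrightarrow> A \<subseteq> C \<or> A \<subseteq> D"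
  by (simp add: irreducible_in_def)

lemma irreducible_in_subtopology:
  assumes "closedin T S" "A \<subseteq> S"
  shows "irreducible_in (subtopology T S) A \<longleftrightarrow> irreducible_in T A"
proof
  assume i: "irreducible_in (subtopology T S) A"
  show "irreducible_in T A"
    unfolding irreducible_in_def
  proof (intro conjI allI impI)
    fix C D assume a: "closedin T C \<and> closedin T D \<and> A \<subseteq> C \<union> D"
    have "closedin (subtopology T S) (C \<inter> S)" "closedin (subtopology T S) (D \<inter> S)"
      using a by (auto simp: closedin_subtopology)
    moreover have "A \<subseteq> (C \<inter> S) \<union> (D \<inter> S)" using a assms by blast
    ultimately have "A \<subseteq> C \<inter> S \<or> A \<subseteq> D \<inter> S"
      using i unfolding irreducible_in_def by blast
    then show "A \<subseteq> C \<or> A \<subseteq> D" by blast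
  qed (use i in \<open>auto simp: irreducible_in_def\<close>)
next
  assume i: "irreducible_in T A"
  then show "irreducible_in (subtopology T S) A"
    using assms unfolding irreducible_in_def
    by (auto simp: closedin_closed_subtopology)
qed

lemma krull_dim_eq:
  assumes "closedin T S"
  shows "krull_dim (subtopology T S) = Sup {k. \<exists>Z. irreducible_chain T S k Z}"
proof -
  have *: "(\<forall>i\<le>k. closedin (subtopology T S) (Z i) \<and> irreducible_in (subtopology T S) (Z i)) \<longleftrightarrow>
     (\<forall>i\<le>k. closedin T (Z i) \<and> Z i \<subseteq> S \<and> irreducible_in T (Z i))" for Z k
    using irreducible_in_subtopology[OF assms] by (auto simp: closedin_closed_subtopology[OF assms])
  show ?thesis unfolding krull_dim_def irreducible_chain_def * ..
qed

text \<open>The bound makes both suprema genuine. A longest chain in S exists, and appending S'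
  gives a longer chain in S'.\<close>

lemma krull_dim_less:
  assumes "closedin T S" "closedin T S'" "irreducible_in T S" "irreducible_in T S'" "S \<subset> S'"
    and bound: "\<And>k Z. irreducible_chain T S' k Z \<Longrightarrow> k \<le> d"
  shows "krull_dim (subtopology T S) < krull_dim (subtopology T S')"
proof -
  let ?K = "\<lambda>S. {k. \<exists>Z. irreducible_chain T S k Z}"
  have bound': "k \<le> d" if "k \<in> ?K S" for k
    using that assms(5) bound unfolding irreducible_chain_def by blast
  have "irreducible_chain T S 0 (\<lambda>_. S)" using assms by (simp add: irreducible_chain_def)
  then have ne: "?K S \<noteq> {}" by blast
  have "finite (?K S)" using bound' by (meson finite_nat_set_iff_bounded_le)
  then have "Max (?K S) \<in> ?K S" using ne by (rule Max_in)
  then have "Sup (?K S) \<in> ?K S" using ne unfolding Sup_nat_def by presburger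
  then obtain k Z where k: "k = Sup (?K S)" and Z: "irreducible_chain T S k Z" by blast
  have Z_S: "Z i \<subseteq> S'" if "i \<le> k" for i using Z that assms(5) by (auto simp: irreducible_chain_def)
  have "irreducible_chain T S' (Suc k) (\<lambda>i. if i \<le> k then Z i else S')"
    using Z assms(2,4,5) unfolding irreducible_chain_def
    by (auto simp: less_Suc_eq le_Suc_eq psubset_eq intro: Z_S[THEN subsetD, rotated])
  then have "Suc k \<in> ?K S'" by blast
  moreover have "bdd_above (?K S')" using bound by (auto intro!: bdd_aboveI)
  ultimately have "Suc k \<le> Sup (?K S')" by (rule cSup_upper)
  then show ?thesis by (simp add: krull_dim_eq assms k)
qed

lemma krull_dim_le:
  assumes "closedin T S" "irreducible_in T S" "\<And>k Z. irreducible_chain T S k Z \<Longrightarrow> k \<le> d"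
  shows "krull_dim (subtopology T S) \<le> d"
proof -
  have "irreducible_chain T S 0 (\<lambda>_. S)" using assms by (simp add: irreducible_chain_def)
  then show ?thesis
    unfolding krull_dim_eq[OF assms(1)] by (intro cSup_least) (use assms(3) in auto)
qed

section \<open>Hilbert functions with respect to forms of bidegree (m, m)\<close>

definition independent_forms :: "flag set \<Rightarrow> nat \<Rightarrow> nat \<Rightarrow> (nat \<Rightarrow> cvec \<Rightarrow> bivec \<Rightarrow> complex) \<Rightarrow> bool" where
  "independent_forms A m k P \<longleftrightarrow> (\<forall>i<k. bihom m m (P i)) \<and>
     (\<forall>c. (\<forall>x y. flag_of x y \<in> A \<longrightarrow> (\<Sum>i<k. c i * P i x (plucker x y)) = 0) \<longrightarrow> (\<forall>i<k. c i = 0))"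

text \<open>The value at \<open>m\<close> of the Hilbert function of \<open>A\<close> is at least \<open>k\<close>.\<close>

definition hilbert_ge :: "flag set \<Rightarrow> nat \<Rightarrow> nat \<Rightarrow> bool" where
  "hilbert_ge A m k \<longleftrightarrow> (\<exists>P. independent_forms A m k P)"

lemma independent_formsD:
  assumes "independent_forms A m k P"
  shows "\<And>i. i < k \<Longrightarrow> bihom m m (P i)"
    and "\<And>c. \<lbrakk>\<And>x y. flag_of x y \<in> A \<Longrightarrow> (\<Sum>i<k. c i * P i x (plucker x y)) = 0\<rbrakk> \<Longrightarrow> \<forall>i<k. c i = 0"
  using assms by (simp_all add: independent_forms_def)

lemma hilbert_ge_mono_set:
  assumes "hilbert_ge A m k" "A \<subseteq> B"
  shows "hilbert_ge B m k"
proof -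
  obtain P where "independent_forms A m k P" using assms(1) unfolding hilbert_ge_def ..
  note P = independent_formsD[OF this]
  show ?thesis unfolding hilbert_ge_def independent_forms_def
  proof (intro exI[of _ P] conjI allI impI)
    fix c i assume "\<forall>x y. flag_of x y \<in> B \<longrightarrow> (\<Sum>i<k. c i * P i x (plucker x y)) = 0" "i < k"
    then show "c i = 0" using P(2)[of c] subsetD[OF assms(2)] by simp
  qed (use P(1) in simp)
qed

lemma hilbert_ge_mono:
  assumes "hilbert_ge A m k" "k' \<le> k"
  shows "hilbert_ge A m k'"
proof -
  obtain P where "independent_forms A m k P" using assms(1) unfolding hilbert_ge_def ..
  note P = independent_formsD[OF this]
  show ?thesis unfolding hilbert_ge_def independent_forms_def
  proof (intro exI[of _ P] conjI allI impI)
    fix c i assume c: "\<forall>x y. flag_of x y \<in> A \<longrightarrow> (\<Sum>i<k'. c i * P i x (plucker x y)) = 0" and "i < k'"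
    define c' where "c' i = (if i < k' then c i else 0)" for i
    have "(\<Sum>i<k. c' i * P i x (plucker x y)) = (\<Sum>i<k'. c i * P i x (plucker x y))" for x y
      using assms(2) by (intro sum.mono_neutral_cong_right) (auto simp: c'_def)
    then have "\<forall>i<k. c' i = 0" using c by (intro P(2)) auto
    then show "c i = 0" using \<open>i < k'\<close> assms(2) by (metis c'_def order_less_le_trans)
  qed (use P(1) assms(2) in auto)
qed

text \<open>Geometric form of the fact that the coordinate ring of an irreducible set is a
  domain.\<close>

lemma irreducible_nonvanishing_mult:
  assumes "irreducible_in (zariski n) Z" "bihom a b P" "bihom a' b' Q"
    and "Z \<inter> nonvanishing n P \<noteq> {}" "Z \<inter> nonvanishing n Q \<noteq> {}"
  shows "Z \<inter> nonvanishing n (\<lambda>x p. P x p * Q x p) \<noteq> {}"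
proof
  assume "Z \<inter> nonvanishing n (\<lambda>x p. P x p * Q x p) = {}"
  moreover have "Z \<subseteq> IF n" using assms(1) by (auto simp: irreducible_in_def)
  ultimately have "Z \<subseteq> (IF n - nonvanishing n P) \<union> (IF n - nonvanishing n Q)"
    unfolding nonvanishing_mult[OF assms(2,3)] by blast
  then have "Z \<subseteq> IF n - nonvanishing n P \<or> Z \<subseteq> IF n - nonvanishing n Q"
    by (rule irreducible_inD[OF assms(1) closedin_vanishing[OF assms(2)] closedin_vanishing[OF assms(3)]])
  then show False using assms(4,5) by blast
qed

lemma sum_lessThan_add: "(\<Sum>i<r + s. g i) = (\<Sum>i<r. g i) + (\<Sum>i<s. (g (r + i) :: complex))" for r s :: nat
  by (induction s) (auto simp: add_ac)

text \<open>
  Multiplication by \<open>f\<close> is injective on forms on the irreducible set \<open>Z'\<close>, and the image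
  consists of forms vanishing on \<open>Z\<close>.
\<close>

lemma hilbert_ge_add:
  assumes "Z \<subseteq> Z'" "irreducible_in (zariski n) Z'" "hilbert_ge Z (m + k) r" "hilbert_ge Z' m s"
    and f: "bihom k k f" "Z \<inter> nonvanishing n f = {}" "Z' \<inter> nonvanishing n f \<noteq> {}"
  shows "hilbert_ge Z' (m + k) (r + s)"
proof -
  obtain P where "independent_forms Z (m + k) r P" using assms(3) unfolding hilbert_ge_def ..
  note P = independent_formsD[OF this]
  obtain Q where "independent_forms Z' m s Q" using assms(4) unfolding hilbert_ge_def ..
  note Q = independent_formsD[OF this]
  have Z': "Z' \<subseteq> IF n" using assms(2) by (simp add: irreducible_in_def)
  \<comment> \<open>Of these forms, the last s contain the factor f and so vanish on Z, while the
    first r are independent there.\<close>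
  define R where "R i = (if i < r then P i else (\<lambda>x p. Q (i - r) x p * f x p))" for i
  show ?thesis unfolding hilbert_ge_def independent_forms_def
  proof (intro exI[of _ R] conjI)
    show "\<forall>i<r + s. bihom (m + k) (m + k) (R i)"
      using P(1) bihom.mult[OF Q(1) f(1)] by (auto simp: R_def)
    show "\<forall>c. (\<forall>x y. flag_of x y \<in> Z' \<longrightarrow> (\<Sum>i<r + s. c i * R i x (plucker x y)) = 0) \<longrightarrow>
            (\<forall>i<r + s. c i = 0)"
    proof (intro allI impI)
      fix c i assume c: "\<forall>x y. flag_of x y \<in> Z' \<longrightarrow> (\<Sum>i<r + s. c i * R i x (plucker x y)) = 0"
        and i: "i < r + s"
      define g where "g x p = (\<Sum>i<s. c (r + i) * Q i x p)" for x p
      have g: "bihom m m g" unfolding g_def by (intro bihom_sum bihom_scaled Q(1)) auto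
      have *: "(\<Sum>i<r. c i * P i x (plucker x y)) + g x (plucker x y) * f x (plucker x y) = 0"
        if "flag_of x y \<in> Z'" for x y
      proof -
        have "(\<Sum>i<r + s. c i * R i x (plucker x y)) =
           (\<Sum>i<r. c i * P i x (plucker x y)) + g x (plucker x y) * f x (plucker x y)"
          by (simp add: sum_lessThan_add R_def g_def sum_distrib_right sum_distrib_left mult_ac)
        then show ?thesis using c that by simp
      qed
      have cr: "\<forall>i<r. c i = 0"
      proof (rule P(2))
        fix x y assume "flag_of x y \<in> Z"
        moreover from this have "flag_of x y \<in> Z'" "flag_of x y \<in> IF n" using assms(1) Z' by blast+
        ultimately have "f x (plucker x y) = 0"
          using f(2) nonvanishing_iff[OF f(1), of x y n] by blast
        then show "(\<Sum>i<r. c i * P i x (plucker x y)) = 0" using *[OF \<open>flag_of x y \<in> Z'\<close>] by simp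
      qed
      then have gf: "g x (plucker x y) * f x (plucker x y) = 0" if "flag_of x y \<in> Z'" for x y
        using *[OF that] by simp
      have "Z' \<inter> nonvanishing n (\<lambda>x p. g x p * f x p) = {}"
      proof (rule ccontr)
        assume "\<not> ?thesis"
        then obtain F where "F \<in> Z'" "F \<in> nonvanishing n (\<lambda>x p. g x p * f x p)" by blast
        moreover from this obtain x y where "F = flag_of x y" using Z' flag_cases by blast
        ultimately show False using gf[of x y] Z' nonvanishing_iff[OF bihom.mult[OF g f(1)]] by blast
      qed
      \<comment> \<open>Since Z' is irreducible and f is not identically zero on it, f can be
        cancelled from the relation.\<close>
      then have Z'g: "Z' \<inter> nonvanishing n g = {}"
        using irreducible_nonvanishing_mult[OF assms(2) g f(1) _ f(3)] by blast
      have "\<forall>i<s. c (r + i) = 0"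
      proof (rule Q(2))
        fix x y assume "flag_of x y \<in> Z'"
        then have "flag_of x y \<in> IF n" "flag_of x y \<notin> nonvanishing n g"
          using Z' Z'g by blast+
        then show "(\<Sum>i<s. c (r + i) * Q i x (plucker x y)) = 0"
          by (simp add: nonvanishing_iff[OF g] g_def)
      qed
      then have "c i = 0" if "\<not> i < r"
        using that i by (metis add_diff_inverse_nat nat_add_left_cancel_less)
      then show "c i = 0" using cr by (cases "i < r") auto
    qed
  qed
qed

text \<open>These monomials exist in every bidegree, so they can change the bidegree of a form
  without making it vanish at F.\<close>

lemma coordinate_form_nonzero:
  assumes "F \<in> IF n"
  obtains i j k where "\<forall>a b. F \<in> nonvanishing n (\<lambda>x p. x i ^ a * p (j, k) ^ b)"
proof -
  obtain x y where F: "F = flag_of x y" "plucker x y \<noteq> 0" using assms by (rule flag_cases)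
  then have "x \<noteq> 0" by auto
  then obtain i where i: "x i \<noteq> 0" by (auto simp: fun_eq_iff)
  obtain j k where jk: "plucker x y (j, k) \<noteq> 0" using F(2) by (auto simp: fun_eq_iff)
  have "F \<in> nonvanishing n (\<lambda>x p. x i ^ a * p (j, k) ^ b)" for a b
    using nonvanishing_iff[OF bihom.mult[OF bihom_coord1_power[of a i] bihom_coord2_power[of b j k]], of x y n]
      assms i jk F(1) by simp
  then show ?thesis using that by blast
qed

text \<open>A separating form of bidegree (a, b) is multiplied by a monomial of bidegree (b+1, a+1),
  which balances the two degrees. The extra 1 keeps the common degree positive even if a = b =
  0.\<close>

lemma separating_form:
  assumes "closedin (zariski n) Z" "Z \<subset> Z'" "Z' \<subseteq> IF n"
  obtains k f where "k > 0" "bihom k k f" "Z \<inter> nonvanishing n f = {}" "Z' \<inter> nonvanishing n f \<noteq> {}"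
proof -
  obtain F where F: "F \<in> Z'" "F \<notin> Z" "F \<in> IF n" using assms(2,3) by blast
  obtain a b P where P: "bihom a b P" "F \<in> nonvanishing n P" "Z \<inter> nonvanishing n P = {}"
    using nonvanishing_avoiding_closed[OF assms(1) F(3,2)] .
  obtain i j k where c: "\<forall>a b. F \<in> nonvanishing n (\<lambda>x p. x i ^ a * p (j, k) ^ b)"
    using coordinate_form_nonzero[OF F(3)] by blast
  define Q where "Q = (\<lambda>(x :: cvec) (p :: bivec). x i ^ Suc b * p (j, k) ^ Suc a)"
  have Q: "bihom (Suc b) (Suc a) Q"
    unfolding Q_def using bihom.mult[OF bihom_coord1_power[of "Suc b" i] bihom_coord2_power[of "Suc a" j k]] by simp
  have "bihom (a + Suc b) (a + Suc b) (\<lambda>x p. P x p * Q x p)"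
    using bihom.mult[OF P(1) Q] by (simp add: add_ac)
  moreover have "F \<in> nonvanishing n Q" using c by (simp add: Q_def del: power_Suc)
  ultimately show ?thesis
    using nonvanishing_mult[OF P(1) Q, of n] P F(1) by (intro that[of "a + Suc b" "\<lambda>x p. P x p * Q x p"]) auto
qed

lemma nonvanishing_power:
  assumes "bihom a b f" "k > 0"
  shows "nonvanishing n (\<lambda>x p. f x p ^ k) = nonvanishing n f"
proof -
  have "F \<in> nonvanishing n (\<lambda>x p. f x p ^ k) \<longleftrightarrow> F \<in> nonvanishing n f" if "F \<in> IF n" for F
    using that by (rule flag_cases)
      (use that assms in \<open>simp add: nonvanishing_iff[OF bihom_power[OF assms(1)]] nonvanishing_iff[OF assms(1)]\<close>)
  then show ?thesis using nonvanishing_subset by blast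
qed

lemma hilbert_ge_one:
  assumes "F \<in> A" "A \<subseteq> IF n"
  shows "hilbert_ge A m 1"
proof -
  have "F \<in> IF n" using assms by blast
  obtain i j k where c: "F \<in> nonvanishing n (\<lambda>x p. x i ^ m * p (j, k) ^ m)"
    using coordinate_form_nonzero[OF \<open>F \<in> IF n\<close>] by metis
  obtain x y where F: "F = flag_of x y" using \<open>F \<in> IF n\<close> by (rule flag_cases)
  have b: "bihom (m + 0) (0 + m) (\<lambda>x p. x i ^ m * p (j, k) ^ m)"
    by (intro bihom.mult bihom_coord1_power bihom_coord2_power)
  have "x i ^ m * plucker x y (j, k) ^ m \<noteq> 0"
    using c \<open>F \<in> IF n\<close> nonvanishing_iff[OF b] unfolding F by simp
  then show ?thesis
    unfolding hilbert_ge_def independent_forms_def using b assms(1)[unfolded F]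
    by (intro exI[of _ "\<lambda>_ x p. x i ^ m * p (j, k) ^ m"]) force
qed

text \<open>
  Along a chain the Hilbert function of the \<open>j\<close>-th member grows at least like a polynomial of
  degree \<open>j\<close>; the induction is Pascal's rule.
\<close>

lemma hilbert_ge_chain:
  assumes "irreducible_chain (zariski n) S k Z" "j \<le> k"
  shows "\<exists>K>0. \<forall>m. hilbert_ge (Z j) (K * m) ((m + j) choose j)"
  using assms(2)
proof (induction j)
  case 0
  have "Z 0 \<noteq> {}" "Z 0 \<subseteq> IF n"
    using assms(1) by (auto simp: irreducible_chain_def irreducible_in_def)
  then have "hilbert_ge (Z 0) m 1" for m using hilbert_ge_one[of _ "Z 0"] by blast
  then show ?case by (intro exI[of _ 1]) simp
next
  case (Suc j)
  then obtain K where K: "K > 0" "\<And>m. hilbert_ge (Z j) (K * m) ((m + j) choose j)" by auto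
  have Z: "closedin (zariski n) (Z j)" "Z j \<subset> Z (Suc j)" "irreducible_in (zariski n) (Z (Suc j))"
    using assms(1) Suc.prems by (auto simp: irreducible_chain_def)
  then have "Z (Suc j) \<subseteq> IF n" by (simp add: irreducible_in_def)
  obtain d f where f: "d > 0" "bihom d d f" "Z j \<inter> nonvanishing n f = {}" "Z (Suc j) \<inter> nonvanishing n f \<noteq> {}"
    using separating_form[OF Z(1,2) \<open>Z (Suc j) \<subseteq> IF n\<close>] .
  \<comment> \<open>The bound for \<open>Z j\<close> is available only in degrees that are multiples
    of K; the power brings the degree of the separating form to the multiple K * d.\<close>
  define g where "g = (\<lambda>x p. f x p ^ K)"
  have g: "bihom (K * d) (K * d) g" "Z j \<inter> nonvanishing n g = {}" "Z (Suc j) \<inter> nonvanishing n g \<noteq> {}"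
    using bihom_power[OF f(2)] f(3,4) nonvanishing_power[OF f(2) K(1)] by (simp_all add: g_def)
  have "hilbert_ge (Z (Suc j)) (K * d * m) ((m + Suc j) choose Suc j)" for m
  proof (induction m)
    case 0
    have "Z (Suc j) \<noteq> {}" using Z by auto
    then show ?case using hilbert_ge_one[of _ "Z (Suc j)" n 0] \<open>Z (Suc j) \<subseteq> IF n\<close> by auto
  next
    case (Suc m)
    \<comment> \<open>Degree K * d * (m+1) is the (d * (m+1))-th multiple of K, where the known
      bound is at least the binomial that Pascal's rule requires.\<close>
    have "(Suc m + j) choose j \<le> (d * Suc m + j) choose j"
      using mult_le_mono1[of 1 d "Suc m"] f(1) by (intro binomial_right_mono add_right_mono) simp
    then have "hilbert_ge (Z j) (K * d * m + K * d) ((Suc m + j) choose j)"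
      using hilbert_ge_mono[OF K(2)[of "d * Suc m"]] by (simp add: algebra_simps)
    then have "hilbert_ge (Z (Suc j)) (K * d * m + K * d) ((Suc m + j choose j) + (m + Suc j choose Suc j))"
      using hilbert_ge_add[OF _ Z(3) _ Suc.IH g] Z(2) by blast
    then show ?case by (simp add: algebra_simps)
  qed
  then show ?case using K(1) f(1) by (intro exI[of _ "K * d"]) simp
qed

section \<open>Polynomial functions of bounded degree in finitely many parameters\<close>

global_interpretation cfun: vector_space "\<lambda>(c :: complex) (f :: cvec \<Rightarrow> complex) s. c * f s"
  by unfold_locales (auto simp: algebra_simps fun_eq_iff)

inductive polyfun :: "nat set \<Rightarrow> nat \<Rightarrow> (cvec \<Rightarrow> complex) \<Rightarrow> bool" for I where
  const: "polyfun I 0 (\<lambda>s. c)"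
| var: "i \<in> I \<Longrightarrow> polyfun I 1 (\<lambda>s. s i)"
| add: "polyfun I d f \<Longrightarrow> polyfun I d g \<Longrightarrow> polyfun I d (\<lambda>s. f s + g s)"
| mult: "polyfun I d f \<Longrightarrow> polyfun I d' g \<Longrightarrow> polyfun I (d + d') (\<lambda>s. f s * g s)"
| mono: "polyfun I d f \<Longrightarrow> d \<le> d' \<Longrightarrow> polyfun I d' f"

lemma polyfun_scaled: "polyfun I d f \<Longrightarrow> polyfun I d (\<lambda>s. c * f s)"
  using polyfun.mult[OF polyfun.const[of I c], of d f] by simp

lemma polyfun_diff: "polyfun I d f \<Longrightarrow> polyfun I d g \<Longrightarrow> polyfun I d (\<lambda>s. f s - g s)"
  using polyfun.add[OF _ polyfun_scaled[of I d g "-1"], of f] by simp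

lemma polyfun_sum:
  assumes "\<And>i. i \<in> S \<Longrightarrow> polyfun I d (f i)"
  shows "polyfun I d (\<lambda>s. \<Sum>i\<in>S. f i s)"
  using assms by (induction S rule: infinite_finite_induct)
    (auto intro: polyfun.add polyfun.mono[OF polyfun.const])

lemma polyfun_along_curve:
  assumes "polyfun I d f" "\<And>i. is_poly (\<lambda>t. s t i)"
  shows "is_poly (\<lambda>t. f (s t))"
  using assms(1) by induction (auto intro: is_poly_intros assms(2))

text \<open>The factor 2 is there because Plucker coordinates are quadratic in x and y; for the
  coordinates of x the bound 2 * d is merely generous.\<close>

lemma polyfun_bihom:
  assumes "bihom a b P" "\<And>i. polyfun I d (\<lambda>s. x s i)" "\<And>i. polyfun I d (\<lambda>s. y s i)"
  shows "polyfun I ((a + b) * (2 * d)) (\<lambda>s. P (x s) (plucker (x s) (y s)))"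
  using assms(1)
proof induction
  case (const c)
  then show ?case by (simp add: polyfun.const)
next
  case (coord1 i)
  then show ?case by (auto intro: polyfun.mono[OF assms(2)])
next
  case (coord2 i j)
  have "polyfun I (d + d) (\<lambda>s. x s i * y s j - x s j * y s i)"
    by (intro polyfun_diff polyfun.mult assms(2,3))
  then show ?case by (simp add: plucker_apply mult_2)
next
  case (add a b P Q)
  then show ?case by (intro polyfun.add)
next
  case (mult a b P a' b' Q)
  have "(a + a' + (b + b')) * (2 * d) = (a + b) * (2 * d) + (a' + b') * (2 * d)"
    by (simp add: algebra_simps)
  then show ?case using polyfun.mult[OF mult.IH] by simp
qed

text \<open>Each exponent is bounded separately, instead of the total degree: a box is easy to
  count, and its size is still polynomial in d of degree \<open>card I\<close>.\<close>

definition monomials :: "nat set \<Rightarrow> nat \<Rightarrow> (cvec \<Rightarrow> complex) set" where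
  "monomials I d = (\<lambda>e s. \<Prod>i\<in>I. s i ^ e i) ` (I \<rightarrow>\<^sub>E {..d})"

lemma monomials_mult:
  assumes "f \<in> monomials I d" "g \<in> monomials I d'"
  shows "f * g \<in> monomials I (d + d')"
proof -
  obtain e e' where e: "e \<in> I \<rightarrow>\<^sub>E {..d}" "f = (\<lambda>s. \<Prod>i\<in>I. s i ^ e i)"
    "e' \<in> I \<rightarrow>\<^sub>E {..d'}" "g = (\<lambda>s. \<Prod>i\<in>I. s i ^ e' i)"
    using assms by (auto simp: monomials_def)
  have "(\<lambda>i\<in>I. e i + e' i) \<in> I \<rightarrow>\<^sub>E {..d + d'}"
    using e(1,3) by (fastforce simp: PiE_iff intro: add_mono)
  moreover have "f * g = (\<lambda>s. \<Prod>i\<in>I. s i ^ (\<lambda>i\<in>I. e i + e' i) i)"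
    by (simp add: e fun_eq_iff power_add prod.distrib)
  ultimately show ?thesis unfolding monomials_def by blast
qed

lemma span_monomials_mult:
  assumes "f \<in> cfun.span (monomials I d)" "g \<in> cfun.span (monomials I d')"
  shows "f * g \<in> cfun.span (monomials I (d + d'))"
  using assms(1)
proof (induction rule: cfun.span_induct_alt)
  case base
  then show ?case using cfun.span_zero by (simp add: zero_fun_def)
next
  case (step c h k)
  have hg: "h * g \<in> cfun.span (monomials I (d + d'))" if "h \<in> monomials I d" for h
    using assms(2)
  proof (induction rule: cfun.span_induct_alt)
    case base
    then show ?case using cfun.span_zero by (simp add: zero_fun_def)
  next
    case (step c' h' k')
    have *: "h * ((\<lambda>s. c' * h' s) + k') = (\<lambda>s. c' * (h * h') s) + h * k'"
      by (simp add: fun_eq_iff algebra_simps)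
    show ?case
      unfolding * by (intro cfun.span_add cfun.span_scale cfun.span_base monomials_mult that step)
  qed
  have *: "((\<lambda>s. c * h s) + k) * g = (\<lambda>s. c * (h * g) s) + k * g"
    by (simp add: fun_eq_iff algebra_simps)
  show ?case
    unfolding * by (intro cfun.span_add cfun.span_scale step hg)
qed

lemma polyfun_in_span:
  assumes "polyfun I d f" "finite I"
  shows "f \<in> cfun.span (monomials I d)"
  using assms(1)
proof induction
  case (const c)
  have "(\<lambda>s. 1) \<in> monomials I 0"
    unfolding monomials_def by (rule image_eqI[of _ _ "\<lambda>i\<in>I. 0"]) auto
  then have "(\<lambda>s. c * (\<lambda>s. 1) s) \<in> cfun.span (monomials I 0)"
    by (intro cfun.span_scale cfun.span_base)
  then show ?case by simp
next
  case (var i)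
  define e where "e = (\<lambda>j\<in>I. if j = i then 1 else 0 :: nat)"
  have "e \<in> I \<rightarrow>\<^sub>E {..1}" by (auto simp: e_def)
  moreover have "(\<Prod>j\<in>I. s j ^ e j) = s i" for s :: cvec
  proof -
    have "(\<Prod>j\<in>I. s j ^ e j) = (\<Prod>j\<in>I. if j = i then s j else 1)"
      by (intro prod.cong) (auto simp: e_def)
    then show ?thesis using var assms(2) by (simp add: prod.delta)
  qed
  then have "(\<lambda>s. \<Prod>j\<in>I. s j ^ e j) = (\<lambda>s :: cvec. s i)" by (rule ext)
  ultimately have "(\<lambda>s. s i) \<in> monomials I 1"
    unfolding monomials_def by (intro image_eqI[of _ _ e]) simp_all
  then show ?case by (rule cfun.span_base)
next
  case (add d f g)
  then show ?case using cfun.span_add[of f _ g] by (simp add: plus_fun_def)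
next
  case (mult d f d' g)
  then show ?case using span_monomials_mult[of f I d g d'] by (simp add: times_fun_def)
next
  case (mono d f d')
  have "I \<rightarrow>\<^sub>E {..d} \<subseteq> I \<rightarrow>\<^sub>E {..d'}" using mono(2) by (intro PiE_mono) auto
  then have "monomials I d \<subseteq> monomials I d'" unfolding monomials_def by blast
  then show ?case using mono cfun.span_mono by blast
qed

lemma card_monomials_le:
  assumes "finite I"
  shows "finite (monomials I d)" "card (monomials I d) \<le> (d + 1) ^ card I"
proof -
  have fin: "finite (I \<rightarrow>\<^sub>E {..d})" using assms by (intro finite_PiE) auto
  then show "finite (monomials I d)" by (simp add: monomials_def)
  have "card (monomials I d) \<le> card (I \<rightarrow>\<^sub>E {..d})"
    unfolding monomials_def by (rule card_image_le[OF fin])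
  then show "card (monomials I d) \<le> (d + 1) ^ card I" using assms by (simp add: card_PiE)
qed

section \<open>Sets of flags parametrized polynomially by an affine space\<close>

locale affine_parametrization =
  fixes n :: nat and I :: "nat set" and d :: nat and x y :: "cvec \<Rightarrow> cvec" and A :: "flag set"
  assumes finite_I: "finite I"
    and polyfun_x: "\<And>i. polyfun I d (\<lambda>s. x s i)"
    and polyfun_y: "\<And>i. polyfun I d (\<lambda>s. y s i)"
    and A_eq: "A = range (\<lambda>s. flag_of (x s) (y s))"
    and A_IF: "A \<subseteq> IF n"
begin

lemma irreducible: "irreducible_in (zariski n) A"
proof (rule irreducible_if_joined_by_curves[OF A_IF])
  fix F G assume "F \<in> A" "G \<in> A"
  then obtain s u where su: "F = flag_of (x s) (y s)" "G = flag_of (x u) (y u)" using A_eq by auto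
  define c where "c t i = s i + t * (u i - s i)" for t i
  have c: "is_poly (\<lambda>t. c t i)" for i unfolding c_def by (intro is_poly_intros)
  have "c 0 = s" "c 1 = u" by (auto simp: c_def)
  then show "\<exists>x y. (\<forall>i. is_poly (\<lambda>t. x t i)) \<and> (\<forall>i. is_poly (\<lambda>t. y t i)) \<and>
       (\<forall>t. flag_of (x t) (y t) \<in> A) \<and> F = flag_of (x 0) (y 0) \<and> G = flag_of (x 1) (y 1)"
    using su polyfun_along_curve[OF polyfun_x c] polyfun_along_curve[OF polyfun_y c]
    by (intro exI[of _ "\<lambda>t. x (c t)"] exI[of _ "\<lambda>t. y (c t)"]) (auto simp: A_eq)
qed (simp add: A_eq)

text \<open>A form that is zero on A is zero on its closure, so forms independent on the closure
  pull back to linearly independent functions of the parameters. Their degree is at most 4 * d * m: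
  one factor 2 from the bidegree (m, m), another from the Plucker coordinates.\<close>

lemma hilbert_ge_bound:
  assumes "hilbert_ge (zariski n closure_of A) m k"
  shows "k \<le> (4 * d * m + 1) ^ card I"
proof -
  obtain P where "independent_forms (zariski n closure_of A) m k P" using assms unfolding hilbert_ge_def ..
  note P = independent_formsD[OF this]
  define q where "q i s = P i (x s) (plucker (x s) (y s))" for i s
  have indep: "\<forall>i<k. c i = 0" if c: "\<And>s. (\<Sum>i<k. c i * q i s) = 0" for c
  proof (rule P(2))
    fix u v assume uv: "flag_of u v \<in> zariski n closure_of A"
    then have IF: "flag_of u v \<in> IF n" by (simp add: in_closure_of_zariski)
    have b: "bihom m m (\<lambda>x p. \<Sum>i<k. c i * P i x p)" by (intro bihom_sum bihom_scaled P(1)) auto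
    show "(\<Sum>i<k. c i * P i u (plucker u v)) = 0"
    proof (rule ccontr)
      assume "\<not> ?thesis"
      then obtain G where "G \<in> A" "G \<in> nonvanishing n (\<lambda>x p. \<Sum>i<k. c i * P i x p)"
        using uv b nonvanishing_iff[OF b IF] unfolding in_closure_of_zariski by blast
      moreover from this obtain s where "G = flag_of (x s) (y s)" using A_eq by blast
      ultimately show False using nonvanishing_iff[OF b, of "x s" "y s" n] A_IF c[of s]
        by (auto simp: q_def)
    qed
  qed
  have inj: "inj_on q {..<k}"
  proof (rule inj_onI, rule ccontr)
    fix i j assume ij: "i \<in> {..<k}" "j \<in> {..<k}" "q i = q j" "i \<noteq> j"
    define c :: "nat \<Rightarrow> complex" where "c l = (if l = i then 1 else if l = j then -1 else 0)" for l
    have "(\<Sum>l<k. c l * q l s) = (\<Sum>l\<in>{i, j}. c l * q l s)" for s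
      using ij by (intro sum.mono_neutral_right) (auto simp: c_def)
    then have "(\<Sum>l<k. c l * q l s) = 0" for s using ij by (simp add: c_def)
    then have "c i = 0" using indep ij by blast
    then show False by (simp add: c_def)
  qed
  have scalars_zero: "a f = 0"
    if a: "(\<Sum>f\<in>q ` {..<k}. (\<lambda>s. a f * f s)) = 0" and f: "f \<in> q ` {..<k}" for a f
  proof -
    have sum_apply: "(\<Sum>i\<in>S. h i) s = (\<Sum>i\<in>S. h i s)" for S s and h :: "nat \<Rightarrow> cvec \<Rightarrow> complex"
      by (induction S rule: infinite_finite_induct) auto
    have "(\<Sum>i<k. a (q i) * q i s) = 0" for s
      using fun_cong[OF a, of s] by (simp add: sum.reindex[OF inj] sum_apply)
    then have "\<forall>i<k. a (q i) = 0" by (rule indep)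
    then show ?thesis using f by blast
  qed
  have "cfun.independent (q ` {..<k})"
    using cfun.independent_if_scalars_zero[of "q ` {..<k}"] scalars_zero by blast
  moreover have "q ` {..<k} \<subseteq> cfun.span (monomials I (4 * d * m))"
  proof safe
    fix i assume "i < k"
    have "polyfun I ((m + m) * (2 * d)) (q i)"
      unfolding q_def by (intro polyfun_bihom P(1) \<open>i < k\<close> polyfun_x polyfun_y)
    moreover have "(m + m) * (2 * d) = 4 * d * m" by simp
    ultimately show "q i \<in> cfun.span (monomials I (4 * d * m))"
      using polyfun_in_span[OF _ finite_I] by simp
  qed
  ultimately have "card (q ` {..<k}) \<le> card (monomials I (4 * d * m))"
    using cfun.independent_span_bound card_monomials_le(1)[OF finite_I] by blast
  then show ?thesis
    using card_monomials_le(2)[OF finite_I, of "4 * d * m"] by (simp add: card_image[OF inj])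
qed

text \<open>With D parameters the Hilbert function grows at most like the D-th power of the degree,
  while a chain of length D+1 would make it grow at least like the (D+1)-st power.\<close>

lemma chain_length_bound:
  assumes "irreducible_chain (zariski n) (zariski n closure_of A) k Z"
  shows "k \<le> card I"
proof (rule ccontr)
  define D where "D = card I"
  assume "\<not> k \<le> card I"
  then have "Suc D \<le> k" by (simp add: D_def)
  then obtain K where K: "\<And>m. hilbert_ge (Z (Suc D)) (K * m) ((m + Suc D) choose Suc D)"
    using hilbert_ge_chain[OF assms] by blast
  have "Z (Suc D) \<subseteq> zariski n closure_of A"
    using assms \<open>Suc D \<le> k\<close> by (simp add: irreducible_chain_def)
  then have *: "(m + Suc D) choose Suc D \<le> (4 * d * (K * m) + 1) ^ D" for m
    using hilbert_ge_bound hilbert_ge_mono_set K unfolding D_def by blast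
  define C where "C = 4 * d * K * Suc D + 1"
  have "real (t + 1) \<le> real C ^ D" for t
  proof -
    \<comment> \<open>The degree parameter is taken to be m = (D+1) * t, so that the standard lower
      bound for the binomial coefficient becomes exactly the (D+1)-st power of t+1.\<close>
    have "real (Suc D * t + Suc D) = real (Suc D) * real (t + 1)" by (simp add: algebra_simps)
    then have "real (t + 1) ^ Suc D = (real (Suc D * t + Suc D) / real (Suc D)) ^ Suc D" by simp
    also have "\<dots> \<le> real ((Suc D * t + Suc D) choose Suc D)"
      by (rule binomial_ge_n_over_k_pow_k) simp
    also have "\<dots> \<le> real ((4 * d * (K * (Suc D * t)) + 1) ^ D)"
      using * of_nat_le_iff by blast
    also have "\<dots> \<le> real ((C * (t + 1)) ^ D)"
      by (intro of_nat_mono power_mono) (auto simp: C_def algebra_simps)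
    also have "\<dots> = real C ^ D * real (t + 1) ^ D" by (simp only: of_nat_power of_nat_mult power_mult_distrib)
    finally have "real (t + 1) * real (t + 1) ^ D \<le> real C ^ D * real (t + 1) ^ D" by simp
    then show ?thesis by (rule mult_right_le_imp_le) simp
  qed
  from this[of "C ^ D"] show False by simp
qed

end

section \<open>Borel orbits\<close>

lemma linear_cvec_iff:
  "Vector_Spaces.linear vscale vscale g \<longleftrightarrow>
     (\<forall>x y. g (x + y) = g x + g y) \<and> (\<forall>c x. g (vscale c x) = vscale c (g x))"
  using cvec.vector_space_axioms by (simp add: Vector_Spaces.linear_iff)

lemma E_add: "x \<in> E n \<Longrightarrow> y \<in> E n \<Longrightarrow> x + y \<in> E n"
  and E_scale: "x \<in> E n \<Longrightarrow> vscale c x \<in> E n"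
  and E_diff: "x \<in> E n \<Longrightarrow> y \<in> E n \<Longrightarrow> x - y \<in> E n"
  using subspace_E cvec.subspace_add cvec.subspace_scale cvec.subspace_diff by blast+

lemma E_zero_outside: "x \<in> E n \<Longrightarrow> i \<notin> {1..2 * n + 1} \<Longrightarrow> x i = 0"
  by (simp add: E_def)

text \<open>Within E this is the span of e_1, ..., e_k, a member of the flag preserved by B.\<close>

definition supp_le :: "nat \<Rightarrow> cvec \<Rightarrow> bool" where
  "supp_le k x \<longleftrightarrow> (\<forall>i>k. x i = 0)"

lemma supp_le_E: "x \<in> E n \<Longrightarrow> supp_le (2 * n + 1) x"
  by (simp add: E_def supp_le_def)

lemma evec_supp_le [simp]: "supp_le i (evec i)"
  by (simp add: supp_le_def evec_def)

lemma evec_same [simp]: "evec i i = 1"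
  by (simp add: evec_def)

lemma Borel_add: "g \<in> Borel n \<Longrightarrow> g (x + y) = g x + g y"
  and Borel_scale: "g \<in> Borel n \<Longrightarrow> g (vscale c x) = vscale c (g x)"
  and Borel_bij: "g \<in> Borel n \<Longrightarrow> bij_betw g (E n) (E n)"
  and Borel_omega: "g \<in> Borel n \<Longrightarrow> x \<in> E n \<Longrightarrow> y \<in> E n \<Longrightarrow> omega n (g x) (g y) = omega n x y"
  by (auto simp: Borel_def Sp_def GL_def linear_cvec_iff)

lemma Borel_diff: "g \<in> Borel n \<Longrightarrow> g (x - y) = g x - g y"
  using Borel_add[of g n "x - y" y] by (simp add: algebra_simps)

lemma Borel_zero: "g \<in> Borel n \<Longrightarrow> g 0 = 0"
  using Borel_diff[of g n 0 0] by simp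

lemma Borel_E: "g \<in> Borel n \<Longrightarrow> x \<in> E n \<Longrightarrow> g x \<in> E n"
  using Borel_bij bij_betw_apply by metis

lemma Borel_supp_le_evec: "g \<in> Borel n \<Longrightarrow> j \<in> {1..2 * n + 1} \<Longrightarrow> supp_le j (g (evec j))"
proof -
  assume g: "g \<in> Borel n" "j \<in> {1..2 * n + 1}"
  have "g (evec j) i = 0" if "i > j" for i
  proof (cases "i \<in> {1..2 * n + 1}")
    case True
    then show ?thesis using g that by (auto simp: Borel_def)
  next
    case False
    then show ?thesis using g Borel_E[OF g(1), of "evec j"] E_zero_outside by simp
  qed
  then show ?thesis by (simp add: supp_le_def)
qed

text \<open>Triangularity on the basis passes to all of E by splitting off the top coordinate; the
  leading coordinate is multiplied by the diagonal entry.\<close>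

lemma Borel_supp_le:
  assumes "g \<in> Borel n" "x \<in> E n" "supp_le k x"
  shows "supp_le k (g x)" "k \<in> {1..2 * n + 1} \<Longrightarrow> g x k = x k * g (evec k) k"
proof -
  have "supp_le k (g x) \<and> (k \<in> {1..2 * n + 1} \<longrightarrow> g x k = x k * g (evec k) k)"
    using assms(2,3)
  proof (induction k arbitrary: x)
    case 0
    then have "x i = 0" for i by (cases "i = 0") (auto simp: supp_le_def E_def)
    then have "x = 0" by (auto simp: fun_eq_iff)
    show ?case unfolding \<open>x = 0\<close> Borel_zero[OF assms(1)] by (simp add: supp_le_def)
  next
    case (Suc k)
    show ?case
    proof (cases "Suc k \<in> {1..2 * n + 1}")
      case True
      define y where "y = x - vscale (x (Suc k)) (evec (Suc k))"
      have "y \<in> E n" using Suc.prems(1) True unfolding y_def by (intro E_diff E_scale) auto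
      moreover have "supp_le k y"
        using Suc.prems(2) by (auto simp: y_def supp_le_def vscale_def evec_def Suc_lessI)
      ultimately have y: "supp_le k (g y)" using Suc.IH by blast
      have gx: "g x = g y + vscale (x (Suc k)) (g (evec (Suc k)))"
        using Borel_add[OF assms(1), of y "vscale (x (Suc k)) (evec (Suc k))"]
        unfolding Borel_scale[OF assms(1)] by (simp add: y_def)
      have e: "supp_le (Suc k) (g (evec (Suc k)))" using Borel_supp_le_evec[OF assms(1) True] .
      show ?thesis unfolding gx using y e by (auto simp: supp_le_def vscale_def)
    next
      case False
      then have "x (Suc k) = 0" using Suc.prems(1) E_zero_outside by blast
      then have "supp_le k x" using Suc.prems(2) by (auto simp: supp_le_def) (metis Suc_lessI)
      then show ?thesis using False Suc.IH[OF Suc.prems(1)] by (auto simp: supp_le_def)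
    qed
  qed
  then show "supp_le k (g x)" "k \<in> {1..2 * n + 1} \<Longrightarrow> g x k = x k * g (evec k) k" by blast+
qed

text \<open>The bar reverses the order: for k > i the factor \<open>x k\<close> is zero, for k < i
  the factor \<open>y (lbar n k)\<close> is zero, and one term remains.\<close>

lemma omega_leading:
  assumes "i \<in> {2..2 * n + 1}" "supp_le i x" "supp_le (lbar n i) y"
  shows "omega n x y = osgn n i * x i * y (lbar n i)"
proof -
  have "omega n x y = (\<Sum>k\<in>{2..2 * n + 1}. if k = i then osgn n i * x i * y (lbar n i) else 0)"
    unfolding omega_eq
  proof (intro sum.cong refl)
    fix k assume k: "k \<in> {2..2 * n + 1}"
    have "x k = 0" if "k > i" using assms(2) that by (simp add: supp_le_def)
    moreover have "y (lbar n k) = 0" if "k < i"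
      using assms that k by (auto simp: supp_le_def lbar_def)
    ultimately show "osgn n k * x k * y (lbar n k) = (if k = i then osgn n i * x i * y (lbar n i) else 0)"
      by (cases k i rule: linorder_cases) auto
  qed
  also have "\<dots> = osgn n i * x i * y (lbar n i)" using assms(1) by (subst sum.delta) auto
  finally show ?thesis .
qed

text \<open>For \<open>i \<noteq> 1\<close> preservation of the form makes the diagonal entries at i
  and at its bar inverse to each other. The kernel vector e_1 has no partner in E, and there
  injectivity is used.\<close>

lemma Borel_diagonal_nonzero:
  assumes g: "g \<in> Borel n" and i: "i \<in> {1..2 * n + 1}"
  shows "g (evec i) i \<noteq> 0"
proof (cases "i = 1")
  case True
  have "supp_le i (g (evec i))" using Borel_supp_le_evec[OF g i] .
  moreover have "g (evec i) 0 = 0" using Borel_E[OF g, of "evec i"] i E_zero_outside by simp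
  ultimately have "g (evec i) = 0" if "g (evec i) i = 0"
    using that True by (auto simp: supp_le_def fun_eq_iff) (metis One_nat_def less_one linorder_neqE_nat)
  moreover have "g (evec i) \<noteq> g 0"
  proof
    assume "g (evec i) = g 0"
    moreover have "evec i \<in> E n" "0 \<in> E n" using i by (auto simp: E_def evec_def)
    ultimately have "evec i = 0" using Borel_bij[OF g] by (auto simp: bij_betw_def inj_on_def)
    then show False using evec_same[of i] by (metis zero_fun_apply zero_neq_one)
  qed
  ultimately show ?thesis using Borel_zero[OF g] by auto
next
  case False
  define j where "j = lbar n i"
  have ij: "i \<in> {2..2 * n + 1}" "j \<in> {2..2 * n + 1}" using i False by (auto simp: j_def lbar_def)
  have "omega n (g (evec i)) (g (evec j)) = osgn n i * g (evec i) i * g (evec j) j"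
    using omega_leading[OF ij(1), of "g (evec i)" "g (evec j)"] Borel_supp_le_evec[OF g i]
      Borel_supp_le_evec[OF g, of j] ij(2) by (simp add: j_def)
  then have "osgn n i * g (evec i) i * g (evec j) j = omega n (evec i) (evec j)"
    using Borel_omega[OF g, of "evec i" "evec j"] i ij by simp
  also have "\<dots> \<noteq> 0" using ij by (simp add: omega_evec_left j_def)
  finally show ?thesis by auto
qed

lemma Borel_comp:
  assumes g: "g \<in> Borel n" and h: "h \<in> Borel n"
  shows "g \<circ> h \<in> Borel n"
  unfolding Borel_def Sp_def GL_def
proof (intro CollectI conjI ballI impI)
  show "Vector_Spaces.linear vscale vscale (g \<circ> h)"
    by (simp add: linear_cvec_iff Borel_add[OF g] Borel_add[OF h] Borel_scale[OF g] Borel_scale[OF h])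
  show "bij_betw (g \<circ> h) (E n) (E n)" using Borel_bij[OF g] Borel_bij[OF h] bij_betw_trans by blast
  show "omega n ((g \<circ> h) u) ((g \<circ> h) v) = omega n u v" if "u \<in> E n" "v \<in> E n" for u v
    using that by (simp add: Borel_omega[OF g] Borel_omega[OF h] Borel_E[OF h])
  fix i j assume ij: "i \<in> {1..2 * n + 1}" "j \<in> {1..2 * n + 1}" "j < i"
  have "supp_le j (g (h (evec j)))"
    using Borel_supp_le(1)[OF g Borel_E[OF h] Borel_supp_le_evec[OF h]] ij by simp
  then show "(g \<circ> h) (evec j) i = 0" using ij by (simp add: supp_le_def)
qed

lemma Borel_id: "(\<lambda>x. x) \<in> Borel n"
  by (auto simp: Borel_def Sp_def GL_def linear_cvec_iff evec_def bij_betw_def)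

lemma leading_index_exists:
  assumes "x \<in> E n" "x \<noteq> 0"
  obtains a where "a \<in> {1..2 * n + 1}" "x a \<noteq> 0" "supp_le a x"
proof -
  define S where "S = {i. x i \<noteq> 0}"
  have "S \<subseteq> {1..2 * n + 1}" using assms by (auto simp: S_def E_def)
  then have fin: "finite S" using finite_subset by blast
  moreover have "S \<noteq> {}" using assms(2) by (auto simp: S_def fun_eq_iff)
  ultimately have "Max S \<in> S" by (rule Max_in)
  moreover have "supp_le (Max S) x" using Max_ge[OF fin] by (force simp: supp_le_def S_def)
  ultimately show ?thesis using that[of "Max S"] \<open>S \<subseteq> _\<close> by (auto simp: S_def)
qed

text \<open>Nonzero diagonal entries preserve leading indices in both directions, which does the
  work of an inverse of g.\<close>

lemma Borel_supp_le_iff: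
  assumes g: "g \<in> Borel n" and x: "x \<in> E n"
  shows "supp_le k (g x) \<longleftrightarrow> supp_le k x"
proof
  assume a: "supp_le k (g x)"
  show "supp_le k x"
  proof (rule ccontr)
    assume "\<not> supp_le k x"
    then obtain i where i: "i > k" "x i \<noteq> 0" by (auto simp: supp_le_def)
    then have "x \<noteq> 0" by auto
    then obtain m where m: "m \<in> {1..2 * n + 1}" "x m \<noteq> 0" "supp_le m x"
      using leading_index_exists[OF x] by blast
    then have "g x m \<noteq> 0"
      using Borel_supp_le(2)[OF g x m(3,1)] Borel_diagonal_nonzero[OF g m(1)] by simp
    moreover have "i \<le> m" using i(2) m(3) by (metis supp_le_def not_less)
    ultimately show False using a i(1) by (simp add: supp_le_def)
  qed
qed (use Borel_supp_le[OF g x] in blast)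

text \<open>The exponential of the element \<open>z \<mapsto> \<omega>(u, z) v + \<omega>(v, z) u\<close> of the Lie algebra, which has
  square zero if \<open>\<omega>(u, v) = 0\<close>.\<close>

definition transvection :: "nat \<Rightarrow> cvec \<Rightarrow> cvec \<Rightarrow> cvec \<Rightarrow> cvec" where
  "transvection n u v z = z + (vscale (omega n u z) v + vscale (omega n v z) u)"

lemma transvection_omega:
  assumes "omega n u v = 0"
  shows "omega n (transvection n u v x) (transvection n u v y) = omega n x y"
proof -
  have "omega n v u = 0" "omega n x u = - omega n u x" "omega n x v = - omega n v x"
    using assms omega_skew[of n v u] omega_skew[of n x u] omega_skew[of n x v] by auto
  with assms show ?thesis
    by (simp add: transvection_def omega_bilinear algebra_simps)
qed

lemma transvection_inverse:
  assumes "omega n u v = 0"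
  shows "transvection n u (- v) (transvection n u v z) = z"
proof -
  define w where "w = transvection n u v z"
  have "omega n v u = 0" using assms omega_skew[of n v u] by simp
  then have w: "omega n u w = omega n u z" "omega n v w = omega n v z"
    using assms by (simp_all add: w_def transvection_def omega_bilinear)
  have "omega n (- v) w = - omega n v w" using omega_scale_left[of n "- 1" v w] by simp
  with w have "transvection n u (- v) w = w + (vscale (omega n u z) (- v) + vscale (- omega n v z) u)"
    by (simp add: transvection_def)
  also have "\<dots> = z" by (simp add: w_def transvection_def vscale_def fun_eq_iff)
  finally show ?thesis by (simp add: w_def)
qed

lemma transvection_E: "u \<in> E n \<Longrightarrow> v \<in> E n \<Longrightarrow> z \<in> E n \<Longrightarrow> transvection n u v z \<in> E n"
  unfolding transvection_def by (intro E_add E_scale)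

lemma transvection_in_Sp:
  assumes "u \<in> E n" "v \<in> E n" "omega n u v = 0"
  shows "transvection n u v \<in> Sp n"
proof -
  have "omega n u (- v) = 0" "- v \<in> E n"
    using assms omega_scale_right[of n u "- 1" v] by (auto simp: E_def)
  then have "bij_betw (transvection n u v) (E n) (E n)"
    using assms transvection_inverse[OF assms(3)] transvection_inverse[of n u "- v"]
    by (intro bij_betw_byWitness[where f' = "transvection n u (- v)"])
      (auto intro!: transvection_E)
  moreover have "Vector_Spaces.linear vscale vscale (transvection n u v)"
    by (simp add: linear_cvec_iff transvection_def omega_bilinear)
      (simp add: vscale_def fun_eq_iff algebra_simps)
  ultimately show ?thesis using transvection_omega[OF assms(3)] by (simp add: Sp_def GL_def)
qed

text \<open>With u proportional to the partner e_b of e_a, scaled so that omega(u, z) = z_a, a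
  transvection sends e_a to x. The last property allows a second vector to be moved later while e_a
  stays in place.\<close>

lemma Borel_transitive_on_vectors:
  assumes a: "a \<in> {1..2 * n + 1}" and x: "x \<in> E n" "x a = 1" "supp_le a x"
  obtains g where "g \<in> Borel n" "g (evec a) = x"
    "\<And>c. c \<in> {1..2 * n + 1} \<Longrightarrow> c \<noteq> a \<Longrightarrow> x (lbar n c) = 0 \<Longrightarrow> g (evec c) = evec c"
proof (cases "a = 1")
  case True
  have "x = evec a"
  proof
    fix i show "x i = evec a i"
      using x True E_zero_outside[of x n i] by (cases i "1 :: nat" rule: linorder_cases) (auto simp: evec_def supp_le_def)
  qed
  then show ?thesis using that[OF Borel_id] by simp
next
  case False
  define b where "b = lbar n a"
  \<comment> \<open>No label is its own bar, because 2n+3 is odd.\<close>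
  have "a \<noteq> 2 * n + 3 - a" using a by (simp, presburger)
  then have ab: "a \<in> {2..2 * n + 1}" "b \<in> {2..2 * n + 1}" "lbar n b = a" "a \<noteq> b"
    using a False by (auto simp: b_def lbar_def)
  define u where "u = vscale (osgn n b) (evec b)"
  \<comment> \<open>The e_b-component of x - e_a arises twice, from v itself and from the term
    omega(v, e_a) u; each contributes half of \<open>x b\<close>.\<close>
  define v where "v = (x - evec a) - vscale (x b / 2) (evec b)"
  have u: "omega n u z = z a" for z
    using ab by (simp add: u_def omega_bilinear omega_evec_left flip: mult.assoc)
  have v: "v b = x b / 2" "v a = 0" "\<And>i. i \<noteq> a \<Longrightarrow> i \<noteq> b \<Longrightarrow> v i = x i" "supp_le a v"
    using ab x by (auto simp: v_def evec_def vscale_def supp_le_def)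
  have uv: "u \<in> E n" "v \<in> E n" using ab x unfolding u_def v_def by (auto intro!: E_diff E_scale)
  have ve: "omega n v (evec c) = (if c \<in> {2..2 * n + 1} then - osgn n c * v (lbar n c) else 0)" for c
    by (rule omega_evec_right)
  have "omega n u v = 0" using u v by simp
  note Sp = transvection_in_Sp[OF uv this]
  define g where "g = transvection n u v"
  have "g \<in> Borel n"
    unfolding Borel_def
  proof (intro CollectI conjI ballI impI)
    show "g \<in> Sp n" unfolding g_def by (rule Sp)
    fix i j assume ij: "i \<in> {1..2 * n + 1}" "j \<in> {1..2 * n + 1}" "j < i"
    have 1: "evec j a * v i = 0" using v(4) ij by (auto simp: evec_def supp_le_def)
    \<comment> \<open>The vector v is supported below a, so omega(v, e_j) can be nonzero only for j
      > b; the multiple of e_b added to e_j then lies above the diagonal.\<close>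
    have "u i = 0" if "omega n v (evec j) \<noteq> 0"
    proof -
      have "v (lbar n j) \<noteq> 0" using that ve[of j] by (cases "v (lbar n j) = 0") (simp_all split: if_splits)
      then have "lbar n j < a" using v(2,4) by (metis linorder_neqE_nat supp_le_def)
      then have "j > b" using ab ij by (auto simp: b_def lbar_def)
      then show ?thesis using ij by (simp add: u_def vscale_def evec_def)
    qed
    then have 2: "omega n v (evec j) * u i = 0" by auto
    have "g (evec j) i = evec j i + (evec j a * v i + omega n v (evec j) * u i)"
      by (simp add: g_def transvection_def u vscale_def)
    then show "g (evec j) i = 0" unfolding 1 2 using ij by (simp add: evec_def)
  qed
  moreover have "g (evec a) = x"
  proof -
    have "omega n v (evec a) * osgn n b = x b / 2"
      using ab osgn_lbar[of a n] by (simp add: ve b_def[symmetric] v(1))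
    then have "vscale (omega n v (evec a)) u = vscale (x b / 2) (evec b)" by (simp add: u_def)
    then have "g (evec a) = evec a + (v + vscale (x b / 2) (evec b))"
      by (simp add: g_def transvection_def u)
    then show ?thesis by (simp add: v_def)
  qed
  moreover have "g (evec c) = evec c" if c: "c \<in> {1..2 * n + 1}" "c \<noteq> a" "x (lbar n c) = 0" for c
  proof -
    have "lbar n c \<noteq> b" using c(1,2) a by (auto simp: b_def lbar_def)
    then have "v (lbar n c) = 0" using v(2,3) c(3) by (cases "lbar n c = a") auto
    then have "omega n v (evec c) = 0" using ve by simp
    moreover have "omega n u (evec c) = 0" using c(2) by (simp add: u evec_def)
    ultimately show ?thesis by (simp add: g_def transvection_def)
  qed
  ultimately show ?thesis using that by blast
qed

text \<open>The normalizations are those of a reduced echelon form: the flag determines x and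
  y.\<close>

definition cell :: "nat \<Rightarrow> nat \<times> nat \<Rightarrow> flag set" where
  "cell n w = (case w of (a, b) \<Rightarrow> {flag_of x y | x y. x \<in> E n \<and> y \<in> E n \<and> omega n x y = 0 \<and>
     x a = 1 \<and> supp_le a x \<and> y b = 1 \<and> y a = 0 \<and> supp_le b y})"

lemma cell_iff: "F \<in> cell n (a, b) \<longleftrightarrow> (\<exists>x y. F = flag_of x y \<and> x \<in> E n \<and> y \<in> E n \<and>
     omega n x y = 0 \<and> x a = 1 \<and> supp_le a x \<and> y b = 1 \<and> y a = 0 \<and> supp_le b y)"
  by (simp add: cell_def)

lemma plucker_nonzero:
  assumes "x a \<noteq> 0" "supp_le a x" "y b \<noteq> 0" "supp_le b y" "a \<noteq> b"
  shows "plucker x y \<noteq> 0"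
proof
  assume "plucker x y = 0"
  then have "x a * y b = x b * y a" using plucker_apply[of x y a b] by simp
  moreover have "x b * y a = 0"
    using assms by (cases a b rule: linorder_cases) (auto simp: supp_le_def)
  ultimately show False using assms by simp
qed

lemma flag_of_in_cell:
  assumes "x \<in> E n" "y \<in> E n" "omega n x y = 0" "x a \<noteq> 0" "supp_le a x" "y b \<noteq> 0" "supp_le b y" "a \<noteq> b"
  shows "flag_of x y \<in> cell n (a, b)"
proof -
  define x' where "x' = vscale (1 / x a) x"
  define y0 where "y0 = vscale (1 / y b) y"
  define y' where "y' = y0 - vscale (y0 a) x'"
  have x': "x' \<in> E n" "x' a = 1" "supp_le a x'"
    using assms by (auto simp: x'_def vscale_def supp_le_def E_def)
  have y0: "y0 \<in> E n" "y0 b = 1" "supp_le b y0"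
    using assms by (auto simp: y0_def vscale_def supp_le_def E_def)
  have "y' \<in> E n" unfolding y'_def using x' y0 by (intro E_diff E_scale)
  moreover have "y' a = 0" using x' by (simp add: y'_def vscale_def)
  \<comment> \<open>If a > b there is nothing to subtract, as \<open>y0 a\<close> is zero; if a < b
    the subtracted vector vanishes from b on. In both cases the leading term of y0 survives.\<close>
  moreover have "y0 a * x' i = 0" if "i \<ge> b" for i
    using x' y0 that assms(8) by (cases a b rule: linorder_cases) (auto simp: supp_le_def)
  then have "y' b = 1" "supp_le b y'"
    using y0 by (auto simp: y'_def vscale_def supp_le_def)
  moreover have "omega n x' y' = 0"
  proof -
    have "omega n x' y0 = 0" using assms(3) by (simp add: x'_def y0_def omega_bilinear)
    moreover have "y0 = y' + vscale (y0 a) x'" by (simp add: y'_def)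
    ultimately show ?thesis by (metis add.right_neutral mult_zero_right omega_add_right omega_scale_right omega_self)
  qed
  moreover have "flag_of x' y' = flag_of x y"
  proof (rule flag_of_eq)
    show "x' \<in> cvec.span {x}" by (auto simp: x'_def mem_span1)
    have "y' = vscale (- (y0 a / x a)) x + vscale (1 / y b) y"
      by (simp add: y'_def y0_def x'_def vscale_def fun_eq_iff)
    then show "y' \<in> cvec.span {x, y}" unfolding mem_span2 by blast
    show "plucker x' y' \<noteq> 0"
      using plucker_nonzero[of x' a y' b] x' \<open>y' b = 1\<close> \<open>supp_le b y'\<close> assms(8) by simp
  qed
  ultimately show ?thesis using x' unfolding cell_iff by (intro exI[of _ x'] exI[of _ y']) simp
qed

lemma cell_subset_IF: "a \<noteq> b \<Longrightarrow> cell n (a, b) \<subseteq> IF n"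
proof
  fix F assume "a \<noteq> b" "F \<in> cell n (a, b)"
  then obtain x y where "F = flag_of x y" "x \<in> E n" "y \<in> E n" "omega n x y = 0"
     "x a = 1" "supp_le a x" "y b = 1" "supp_le b y" by (auto simp: cell_def)
  then show "F \<in> IF n" using plucker_nonzero[of x a y b] \<open>a \<noteq> b\<close> by (simp add: flag_of_in_IF_iff)
qed

lemma Borel_flag_of:
  assumes "g \<in> Borel n"
  shows "(g ` fst (flag_of x y), g ` snd (flag_of x y)) = flag_of (g x) (g y)"
proof -
  have "module_hom vscale vscale g"
    using assms by (simp add: Borel_def Sp_def GL_def module_hom_iff_linear)
  then have "g ` cvec.span S = cvec.span (g ` S)" for S by (rule module_hom.span_image[symmetric])
  then show ?thesis by (simp add: flag_of_def)
qed

lemma coord_flag_eq: "coord_flag (a, b) = flag_of (evec a) (evec b)"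
  by (simp add: coord_flag_def flag_of_def)

lemma Borel_orbit_eq: "Borel_orbit n (coord_flag (a, b)) = {flag_of (g (evec a)) (g (evec b)) | g. g \<in> Borel n}"
  unfolding Borel_orbit_def coord_flag_eq by (rule Collect_cong) (metis Borel_flag_of)

lemma omega_evec_evec:
  assumes "(a, b) \<in> Wodd n"
  shows "omega n (evec a) (evec b) = 0"
  unfolding omega_evec_left using assms by (auto simp: Wodd_def evec_def lbar_def)

text \<open>One element g of B takes e_a to x. Pulled back by g and reduced modulo e_a, the second
  vector becomes a v with leading index b; a further element h takes e_b to v and fixes e_a, so g
  \<circ> h carries the coordinate flag to the given one.\<close>

lemma Borel_orbit_eq_cell:
  assumes w: "(a, b) \<in> Wodd n"
  shows "Borel_orbit n (coord_flag (a, b)) = cell n (a, b)"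
proof
  have ab: "a \<in> {1..2 * n + 1}" "b \<in> {1..2 * n + 1}" "a \<noteq> b" using w by (auto simp: Wodd_def)
  show "Borel_orbit n (coord_flag (a, b)) \<subseteq> cell n (a, b)"
  proof
    fix F assume "F \<in> Borel_orbit n (coord_flag (a, b))"
    then obtain g where g: "g \<in> Borel n" "F = flag_of (g (evec a)) (g (evec b))"
      by (auto simp: Borel_orbit_eq)
    show "F \<in> cell n (a, b)" unfolding g(2)
      using ab omega_evec_evec[OF w]
      by (intro flag_of_in_cell) (auto simp: Borel_E[OF g(1)] Borel_omega[OF g(1)]
          Borel_diagonal_nonzero[OF g(1)] Borel_supp_le_evec[OF g(1)])
  qed
  show "cell n (a, b) \<subseteq> Borel_orbit n (coord_flag (a, b))"
  proof
    fix F assume "F \<in> cell n (a, b)"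
    then obtain x y where F: "F = flag_of x y" and xy: "x \<in> E n" "y \<in> E n" "omega n x y = 0"
       "x a = 1" "supp_le a x" "y b = 1" "supp_le b y" by (auto simp: cell_def)
    obtain g where g: "g \<in> Borel n" "g (evec a) = x"
      using Borel_transitive_on_vectors[OF ab(1) xy(1,4,5)] by blast
    have "y \<in> g ` E n" using bij_betw_imp_surj_on[OF Borel_bij[OF g(1)]] xy(2) by simp
    then obtain z where z: "z \<in> E n" "g z = y" by blast
    have "supp_le b z" using Borel_supp_le_iff[OF g(1) z(1)] z(2) xy(7) by simp
    moreover from this have "z b \<noteq> 0"
      using Borel_supp_le(2)[OF g(1) z(1) _ ab(2)] z(2) xy(6) by auto
    moreover have "omega n (evec a) z = 0"
      using Borel_omega[OF g(1), of "evec a" z] ab z g(2) xy(3) by simp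
    ultimately have z': "supp_le b z" "z b \<noteq> 0" "omega n (evec a) z = 0" by blast+
    define v where "v = vscale (1 / z b) (z - vscale (z a) (evec a))"
    have "v \<in> E n" unfolding v_def by (intro E_scale E_diff z(1)) (use ab in simp)
    moreover have "v a = 0" by (simp add: v_def vscale_def)
    ultimately have v: "v \<in> E n" "v a = 0" .
    have "z a * evec a i = 0" if "i \<ge> b" for i
      using that z'(1) ab(3) by (cases a b rule: linorder_cases) (auto simp: supp_le_def evec_def)
    then have vb: "v b = 1" "supp_le b v"
      using z' by (auto simp: v_def vscale_def supp_le_def)
    have "omega n (evec a) v = 0"
    proof -
      have "vscale (z b) v + vscale (z a) (evec a) = z" using z'(2) by (simp add: v_def vscale_def fun_eq_iff)
      then have "z b * omega n (evec a) v + z a * omega n (evec a) (evec a) = 0"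
        using z'(3) by (metis omega_add_right omega_scale_right)
      then show ?thesis using z'(2) by simp
    qed
    \<comment> \<open>Isotropy enters here: it is exactly the condition under which h fixes e_a. For
      a = 1 the index 2n+2 lies outside the support of E.\<close>
    then have "v (lbar n a) = 0"
      using E_zero_outside[OF v(1), of "lbar n a"] ab(1)
      by (cases "a = 1") (simp_all add: omega_evec_left, simp add: lbar_def)
    then obtain h where h: "h \<in> Borel n" "h (evec b) = v" "h (evec a) = evec a"
      using Borel_transitive_on_vectors[OF ab(2) v(1) vb] ab by metis
    have "(g \<circ> h) (evec a) = x" using h g by simp
    moreover have "(g \<circ> h) (evec b) = vscale (1 / z b) (y - vscale (z a) x)"
      using h g z by (simp add: v_def Borel_scale[OF g(1)] Borel_diff[OF g(1)])
    moreover have "flag_of x (vscale (1 / z b) (y - vscale (z a) x)) = flag_of x y"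
    proof (rule flag_of_eq)
      show "x \<in> cvec.span {x}" by (rule cvec.span_base) simp
      show "vscale (1 / z b) (y - vscale (z a) x) \<in> cvec.span {x, y}"
        by (intro cvec.span_scale cvec.span_diff cvec.span_base) auto
      have "plucker x (vscale (1 / z b) (y - vscale (z a) x)) = (\<lambda>ij. 1 / z b * plucker x y ij)"
        by (auto simp: fun_eq_iff plucker_apply vscale_def algebra_simps diff_divide_distrib)
      moreover have "plucker x y \<noteq> 0" using plucker_nonzero[of x a y b] xy ab by simp
      ultimately show "plucker x (vscale (1 / z b) (y - vscale (z a) x)) \<noteq> 0"
        using z'(2) by (auto simp: fun_eq_iff)
    qed
    ultimately show "F \<in> Borel_orbit n (coord_flag (a, b))"
      unfolding F Borel_orbit_eq using Borel_comp[OF g(1) h(1)] by (auto intro!: exI[of _ "g \<circ> h"])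
  qed
qed

lemma Schubert_eq: "w \<in> Wodd n \<Longrightarrow> Schubert n w = zariski n closure_of cell n w"
  using Borel_orbit_eq_cell by (cases w) (simp add: Schubert_def)

section \<open>Cells as affine spaces\<close>

definition cell_dim :: "nat \<Rightarrow> nat \<times> nat \<Rightarrow> nat" where
  "cell_dim n w = (case w of (a, b) \<Rightarrow> (a - 1) + card ({1..<b} - {a, lbar n a}))"

text \<open>
  The parameter \<open>s\<close> lists the free coordinates of \<open>x\<close>, then (shifted by \<open>2n+2\<close>) those of \<open>y\<close>;
  isotropy determines the coordinate of \<open>y\<close> at the bar of \<open>a\<close>, because \<open>x a = 1\<close>.
\<close>

definition cell_index :: "nat \<Rightarrow> nat \<times> nat \<Rightarrow> nat set" where
  "cell_index n w = (case w of (a, b) \<Rightarrow>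
     {1..<a} \<union> (\<lambda>i. 2 * n + 2 + i) ` ({1..<b} - {a, lbar n a}))"

definition cell_x :: "nat \<Rightarrow> nat \<times> nat \<Rightarrow> cvec \<Rightarrow> cvec" where
  "cell_x n w s = (case w of (a, b) \<Rightarrow> (\<lambda>i. if i = a then 1 else if i \<in> {1..<a} then s i else 0))"

definition cell_y0 :: "nat \<Rightarrow> nat \<times> nat \<Rightarrow> cvec \<Rightarrow> cvec" where
  "cell_y0 n w s = (case w of (a, b) \<Rightarrow>
     (\<lambda>i. if i = b then 1 else if i \<in> {1..<b} - {a, lbar n a} then s (2 * n + 2 + i) else 0))"

text \<open>As \<open>osgn n a\<close> is its own inverse, the value at \<open>lbar n a\<close>
  solves omega(x, y) = 0. If \<open>lbar n a\<close> is beyond b, leading indices alone force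
  isotropy and the coordinate is zero.\<close>

definition cell_y :: "nat \<Rightarrow> nat \<times> nat \<Rightarrow> cvec \<Rightarrow> cvec" where
  "cell_y n w s = (case w of (a, b) \<Rightarrow> (\<lambda>i. if i = lbar n a \<and> lbar n a < b
     then - osgn n a * omega n (cell_x n w s) (cell_y0 n w s) else cell_y0 n w s i))"

lemma card_cell_index: "(a, b) \<in> Wodd n \<Longrightarrow> card (cell_index n (a, b)) = cell_dim n (a, b)"
proof -
  assume "(a, b) \<in> Wodd n"
  then have "a \<le> 2 * n + 1" by (simp add: Wodd_def)
  then have "{1..<a} \<inter> (\<lambda>i. 2 * n + 2 + i) ` ({1..<b} - {a, lbar n a}) = {}" by auto
  moreover have "inj_on (\<lambda>i. 2 * n + 2 + i) S" for S by (simp add: inj_on_def)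
  ultimately show ?thesis
    unfolding cell_index_def cell_dim_def prod.case by (subst card_Un_disjoint) (simp_all only: card_image, auto)
qed

text \<open>Isolates the one coordinate of y for which the isotropy equation is solved.\<close>

lemma omega_coordinate:
  assumes "a \<in> {2..2 * n + 1}" "x a = 1" "\<And>i. i \<noteq> lbar n a \<Longrightarrow> y i = y' i"
  shows "omega n x y = osgn n a * (y (lbar n a) - y' (lbar n a)) + omega n x y'"
proof -
  define c where "c = y (lbar n a) - y' (lbar n a)"
  have y: "y = y' + vscale c (evec (lbar n a))"
    using assms(3) by (auto simp: fun_eq_iff vscale_def evec_def c_def)
  have "omega n x (evec (lbar n a)) = osgn n a"
    using assms osgn_lbar[of a n] by (auto simp: omega_evec_right lbar_def)
  then have "omega n x y = omega n x y' + c * osgn n a" unfolding y by (simp add: omega_bilinear)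
  then show ?thesis by (simp add: c_def)
qed

lemma cell_param:
  assumes w: "(a, b) \<in> Wodd n"
  shows "cell n (a, b) = range (\<lambda>s. flag_of (cell_x n (a, b) s) (cell_y n (a, b) s))"
proof
  have ab: "a \<in> {1..2 * n + 1}" "b \<in> {1..2 * n + 1}" "a \<noteq> b" "b \<noteq> lbar n a"
    using w by (auto simp: Wodd_def lbar_def)
  \<comment> \<open>The bar of every label up to a is then beyond b, so in each term of the form one
    of the two coordinates vanishes.\<close>
  have isotropic: "omega n x y = 0" if "supp_le a x" "supp_le b y" "\<not> lbar n a < b" for x y
    unfolding omega_eq
  proof (intro sum.neutral ballI)
    fix i assume "i \<in> {2..2 * n + 1}"
    moreover have "x i = 0" if "i > a" using that \<open>supp_le a x\<close> by (simp add: supp_le_def)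
    moreover have "y (lbar n i) = 0" if "i \<le> a" "i \<in> {2..2 * n + 1}"
    proof -
      have "lbar n i \<ge> lbar n a" using that ab by (simp add: lbar_def)
      then have "lbar n i > b" using \<open>\<not> lbar n a < b\<close> ab by linarith
      then show ?thesis using \<open>supp_le b y\<close> by (simp add: supp_le_def)
    qed
    ultimately show "osgn n i * x i * y (lbar n i) = 0" by (cases "i \<le> a") auto
  qed
  have a2: "a \<in> {2..2 * n + 1}" if "lbar n a < b" using that ab by (cases "a = 1") (auto simp: lbar_def)
  show "cell n (a, b) \<subseteq> range (\<lambda>s. flag_of (cell_x n (a, b) s) (cell_y n (a, b) s))"
  proof
    fix F assume "F \<in> cell n (a, b)"
    then obtain x y where F: "F = flag_of x y" and xy: "x \<in> E n" "y \<in> E n" "omega n x y = 0"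
       "x a = 1" "supp_le a x" "y b = 1" "y a = 0" "supp_le b y" by (auto simp: cell_def)
    define s where "s i = (if i \<le> 2 * n + 1 then x i else y (i - (2 * n + 2)))" for i
    have x: "cell_x n (a, b) s = x"
    proof
      fix i show "cell_x n (a, b) s i = x i"
        using xy ab E_zero_outside[OF xy(1), of 0]
        by (cases "i = 0") (auto simp: cell_x_def s_def supp_le_def not_less)
    qed
    have y0: "cell_y0 n (a, b) s i = y i" if "i \<noteq> lbar n a" for i
      using xy ab that E_zero_outside[OF xy(2), of 0]
      by (cases "i = 0") (auto simp: cell_y0_def s_def supp_le_def not_less)
    have "cell_y n (a, b) s i = y i" for i
    proof (cases "i = lbar n a")
      case True
      show ?thesis
      proof (cases "lbar n a < b")
        case l: True
        have "omega n x y = osgn n a * (y (lbar n a) - cell_y0 n (a, b) s (lbar n a)) + omega n x (cell_y0 n (a, b) s)"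
          using a2[OF l] xy y0 by (intro omega_coordinate) auto
        moreover have "cell_y0 n (a, b) s (lbar n a) = 0" using ab by (simp add: cell_y0_def)
        ultimately have "omega n x (cell_y0 n (a, b) s) = - (osgn n a * y (lbar n a))"
          using xy(3) by (simp add: add_eq_0_iff)
        then show ?thesis using True l x by (simp add: cell_y_def flip: mult.assoc)
      next
        case False
        then have "y (lbar n a) = 0" using xy(8) ab by (simp add: supp_le_def)
        then show ?thesis using True False ab by (simp add: cell_y_def cell_y0_def)
      qed
    qed (simp add: cell_y_def y0)
    then have "cell_y n (a, b) s = y" by blast
    then show "F \<in> range (\<lambda>s. flag_of (cell_x n (a, b) s) (cell_y n (a, b) s))" using F x by blast
  qed
  show "range (\<lambda>s. flag_of (cell_x n (a, b) s) (cell_y n (a, b) s)) \<subseteq> cell n (a, b)"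
  proof (rule image_subsetI)
    fix s
    define x y where "x = cell_x n (a, b) s" and "y = cell_y n (a, b) s"
    have x: "x \<in> E n" "x a = 1" "supp_le a x" using ab by (auto simp: x_def cell_x_def E_def supp_le_def)
    have "cell_y0 n (a, b) s \<in> E n" using ab by (auto simp: cell_y0_def E_def)
    then have y: "y \<in> E n" "y b = 1" "supp_le b y"
      using ab by (auto simp: y_def cell_y_def cell_y0_def E_def supp_le_def lbar_def)
    have "omega n x y = 0"
    proof (cases "lbar n a < b")
      case True
      have "omega n x y = osgn n a * (y (lbar n a) - cell_y0 n (a, b) s (lbar n a)) + omega n x (cell_y0 n (a, b) s)"
        using a2[OF True] x by (intro omega_coordinate) (auto simp: y_def cell_y_def)
      moreover have "cell_y0 n (a, b) s (lbar n a) = 0" using ab by (simp add: cell_y0_def)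
      ultimately show ?thesis
        using True by (simp add: y_def cell_y_def x_def[symmetric] flip: mult.assoc)
    next
      case False
      then show ?thesis using isotropic x y by blast
    qed
    then show "flag_of (cell_x n (a, b) s) (cell_y n (a, b) s) \<in> cell n (a, b)"
      unfolding x_def[symmetric] y_def[symmetric] using x y ab
      by (intro flag_of_in_cell) auto
  qed
qed

text \<open>The degree 2 is caused by the coordinate of y at \<open>lbar n a\<close>, a quadratic
  expression in the parameters; all other coordinates have degree at most 1.\<close>

lemma cell_affine_parametrization:
  assumes w: "(a, b) \<in> Wodd n"
  shows "affine_parametrization n (cell_index n (a, b)) 2 (cell_x n (a, b)) (cell_y n (a, b)) (cell n (a, b))"
proof
  let ?I = "cell_index n (a, b)"
  show "finite ?I" by (simp add: cell_index_def)
  have const: "polyfun ?I d (\<lambda>s. c)" for c d by (rule polyfun.mono[OF polyfun.const]) simp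
  have x: "polyfun ?I 1 (\<lambda>s. cell_x n (a, b) s i)" for i
  proof (cases "i \<in> {1..<a}")
    case True
    then have "i \<in> ?I" by (auto simp: cell_index_def)
    then show ?thesis using True polyfun.var[of i ?I] by (simp add: cell_x_def)
  next
    case False
    then have "(\<lambda>s. cell_x n (a, b) s i) = (\<lambda>s. if i = a then 1 else 0)" by (auto simp: cell_x_def)
    then show ?thesis by (simp only: const)
  qed
  have y0: "polyfun ?I 1 (\<lambda>s. cell_y0 n (a, b) s i)" for i
  proof (cases "i \<in> {1..<b} - {a, lbar n a}")
    case True
    then have "2 * n + 2 + i \<in> ?I" by (auto simp: cell_index_def)
    then show ?thesis using True polyfun.var[of "2 * n + 2 + i" ?I] by (simp add: cell_y0_def)
  next
    case False
    then have "(\<lambda>s. cell_y0 n (a, b) s i) = (\<lambda>s. if i = b then 1 else 0)" by (auto simp: cell_y0_def)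
    then show ?thesis by (simp only: const)
  qed
  have "polyfun ?I 2 (\<lambda>s. omega n (cell_x n (a, b) s) (cell_y0 n (a, b) s))"
    unfolding omega_eq
  proof (intro polyfun_sum)
    fix i
    have "polyfun ?I (0 + 1 + 1) (\<lambda>s. osgn n i * cell_x n (a, b) s i * cell_y0 n (a, b) s (lbar n i))"
      by (intro polyfun.mult polyfun.const x y0)
    then show "polyfun ?I 2 (\<lambda>s. osgn n i * cell_x n (a, b) s i * cell_y0 n (a, b) s (lbar n i))"
      by (simp add: numeral_2_eq_2)
  qed
  note om = this
  show "polyfun ?I 2 (\<lambda>s. cell_x n (a, b) s i)" for i using polyfun.mono[OF x] by simp
  show "polyfun ?I 2 (\<lambda>s. cell_y n (a, b) s i)" for i
  proof (cases "i = lbar n a \<and> lbar n a < b")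
    case True
    then show ?thesis using polyfun_scaled[OF om, of "- osgn n a"] by (simp add: cell_y_def)
  next
    case False
    then show ?thesis using polyfun.mono[OF y0[of i], of 2] by (auto simp: cell_y_def)
  qed
  show "cell n (a, b) = range (\<lambda>s. flag_of (cell_x n (a, b) s) (cell_y n (a, b) s))"
    by (rule cell_param[OF w])
  show "cell n (a, b) \<subseteq> IF n" using w by (intro cell_subset_IF) (auto simp: Wodd_def)
qed

lemma closedin_Schubert: "closedin (zariski n) (Schubert n w)"
  by (simp add: Schubert_def)

lemma cell_subset_Schubert: "w \<in> Wodd n \<Longrightarrow> cell n w \<subseteq> Schubert n w"
  using cell_affine_parametrization affine_parametrization.A_IF
  by (cases w) (metis Schubert_eq closure_of_subset topspace_zariski)

lemma irreducible_Schubert: "w \<in> Wodd n \<Longrightarrow> irreducible_in (zariski n) (Schubert n w)"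
  using affine_parametrization.irreducible[OF cell_affine_parametrization]
  by (cases w) (simp add: Schubert_eq irreducible_in_closure)

lemma Schubert_chain_bound:
  "w \<in> Wodd n \<Longrightarrow> irreducible_chain (zariski n) (Schubert n w) k Z \<Longrightarrow> k \<le> cell_dim n w"
  using affine_parametrization.chain_length_bound[OF cell_affine_parametrization] card_cell_index
  by (cases w) (metis Schubert_eq)

lemma ell_le_cell_dim: "w \<in> Wodd n \<Longrightarrow> ell n w \<le> cell_dim n w"
  unfolding ell_def
  by (intro krull_dim_le closedin_Schubert irreducible_Schubert Schubert_chain_bound)

lemma ell_less:
  assumes "v \<in> Wodd n" "w \<in> Wodd n" "Schubert n v \<subset> Schubert n w"
  shows "ell n v < ell n w"
  unfolding ell_def using assms
  by (intro krull_dim_less[where d = "cell_dim n w"] closedin_Schubert irreducible_Schubert Schubert_chain_bound)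

section \<open>The Bruhat order\<close>

lemma Wodd_iff: "(a, b) \<in> Wodd n \<longleftrightarrow> a \<in> {1..2 * n + 1} \<and> b \<in> {1..2 * n + 1} \<and> a \<noteq> b \<and> b \<noteq> lbar n a"
  by (auto simp: Wodd_def lbar_def)

lemma Wodd_commute: "(a, b) \<in> Wodd n \<longleftrightarrow> (b, a) \<in> Wodd n"
  by (auto simp: Wodd_def lbar_def)

text \<open>A Schubert variety is an orbit closure, so it suffices to place the orbit in the closed
  set X(a|b).\<close>

lemma bruhat_le_if_orbit:
  assumes "(a', b') \<in> Wodd n" "(a, b) \<in> Wodd n"
    and "\<And>g. g \<in> Borel n \<Longrightarrow> flag_of (g (evec a')) (g (evec b')) \<in> zariski n closure_of cell n (a, b)"
  shows "bruhat_le n (a', b') (a, b)"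
proof -
  have "Borel_orbit n (coord_flag (a', b')) \<subseteq> zariski n closure_of cell n (a, b)"
    using assms(3) by (auto simp: Borel_orbit_eq)
  then show ?thesis
    unfolding bruhat_le_def Schubert_eq[OF assms(2)] Schubert_def[of n "(a', b')"]
    by (rule closure_of_minimal) simp
qed

lemma is_poly_line: "is_poly (\<lambda>t. (u + vscale t v) i)"
  by (auto simp: vscale_def intro!: is_poly_intros)

lemma Borel_flag_in_IF:
  assumes "g \<in> Borel n" "(a, b) \<in> Wodd n"
  shows "flag_of (g (evec a)) (g (evec b)) \<in> IF n"
proof -
  have "flag_of (g (evec a)) (g (evec b)) \<in> cell n (a, b)"
    using assms Borel_orbit_eq_cell[OF assms(2)] by (auto simp: Borel_orbit_eq)
  then show ?thesis using assms(2) cell_subset_IF by (auto simp: Wodd_def)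
qed

text \<open>Up to translation by g, the second vector e_c is the limit at t = 0 of e_c + t e_b,
  whose leading index is b for nonzero t.\<close>

lemma bruhat_le_second:
  assumes w: "(a, b) \<in> Wodd n" "(a, c) \<in> Wodd n" and "c < b"
  shows "bruhat_le n (a, c) (a, b)"
proof (rule bruhat_le_if_orbit[OF w(2,1)])
  fix g assume g: "g \<in> Borel n"
  have gE: "g (evec i) \<in> E n" and gd: "g (evec i) i \<noteq> 0" and gs: "supp_le i (g (evec i))"
    if "i \<in> {1..2 * n + 1}" for i
    using that Borel_E[OF g, of "evec i"] Borel_diagonal_nonzero[OF g that] Borel_supp_le_evec[OF g that] by simp_all
  let ?y = "\<lambda>t. g (evec c) + vscale t (g (evec b))"
  have ab: "a \<in> {1..2 * n + 1}" "b \<in> {1..2 * n + 1}" "c \<in> {1..2 * n + 1}" "a \<noteq> b"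
    using w by (auto simp: Wodd_def)
  have c: "supp_le c (g (evec c))" by (rule Borel_supp_le_evec[OF g ab(3)])
  have "flag_of (g (evec a)) (?y 0) \<in> zariski n closure_of cell n (a, b)"
  proof (rule in_closure_of_curve[where x = "\<lambda>t. g (evec a)" and y = ?y])
    show "flag_of (g (evec a)) (?y 0) \<in> IF n" using Borel_flag_in_IF[OF g w(2)] by simp
    show "cell n (a, b) \<subseteq> IF n" using ab by (intro cell_subset_IF)
    fix t :: complex assume "t \<noteq> 0"
    show "flag_of (g (evec a)) (?y t) \<in> cell n (a, b)"
    proof (rule flag_of_in_cell)
      show "omega n (g (evec a)) (?y t) = 0"
        using ab omega_evec_evec[OF w(1)] omega_evec_evec[OF w(2)] by (simp add: omega_bilinear Borel_omega[OF g])
      show "?y t b \<noteq> 0"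
        using c \<open>c < b\<close> \<open>t \<noteq> 0\<close> Borel_diagonal_nonzero[OF g ab(2)] by (simp add: supp_le_def vscale_def)
      show "supp_le b (?y t)"
        using c \<open>c < b\<close> Borel_supp_le_evec[OF g ab(2)] by (simp add: supp_le_def vscale_def)
    qed (use ab in \<open>simp_all add: gE gd gs E_add E_scale\<close>)
  qed (rule is_poly_const, rule is_poly_line)
  then show "flag_of (g (evec a)) (g (evec c)) \<in> zariski n closure_of cell n (a, b)" by simp
qed

text \<open>Here the first vector degenerates: e_c is the limit of e_c + t e_a.\<close>

lemma bruhat_le_first:
  assumes w: "(a, b) \<in> Wodd n" "(c, b) \<in> Wodd n" and "c < a"
  shows "bruhat_le n (c, b) (a, b)"
proof (rule bruhat_le_if_orbit[OF w(2,1)])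
  fix g assume g: "g \<in> Borel n"
  have gE: "g (evec i) \<in> E n" and gd: "g (evec i) i \<noteq> 0" and gs: "supp_le i (g (evec i))"
    if "i \<in> {1..2 * n + 1}" for i
    using that Borel_E[OF g, of "evec i"] Borel_diagonal_nonzero[OF g that] Borel_supp_le_evec[OF g that] by simp_all
  let ?x = "\<lambda>t. g (evec c) + vscale t (g (evec a))"
  have ab: "a \<in> {1..2 * n + 1}" "b \<in> {1..2 * n + 1}" "c \<in> {1..2 * n + 1}" "a \<noteq> b"
    using w by (auto simp: Wodd_def)
  have c: "supp_le c (g (evec c))" by (rule Borel_supp_le_evec[OF g ab(3)])
  have "flag_of (?x 0) (g (evec b)) \<in> zariski n closure_of cell n (a, b)"
  proof (rule in_closure_of_curve[where y = "\<lambda>t. g (evec b)" and x = ?x])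
    show "flag_of (?x 0) (g (evec b)) \<in> IF n" using Borel_flag_in_IF[OF g w(2)] by simp
    show "cell n (a, b) \<subseteq> IF n" using ab by (intro cell_subset_IF)
    fix t :: complex assume "t \<noteq> 0"
    show "flag_of (?x t) (g (evec b)) \<in> cell n (a, b)"
    proof (rule flag_of_in_cell)
      show "omega n (?x t) (g (evec b)) = 0"
        using ab omega_evec_evec[OF w(1)] omega_evec_evec[OF w(2)] by (simp add: omega_bilinear Borel_omega[OF g])
      show "?x t a \<noteq> 0"
        using c \<open>c < a\<close> \<open>t \<noteq> 0\<close> Borel_diagonal_nonzero[OF g ab(1)] by (simp add: supp_le_def vscale_def)
      show "supp_le a (?x t)"
        using c \<open>c < a\<close> Borel_supp_le_evec[OF g ab(1)] by (simp add: supp_le_def vscale_def)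
    qed (use ab in \<open>simp_all add: gE gd gs E_add E_scale\<close>)
  qed (rule is_poly_line, rule is_poly_const)
  then show "flag_of (g (evec c)) (g (evec b)) \<in> zariski n closure_of cell n (a, b)" by simp
qed

text \<open>The line moves inside a fixed plane. For nonzero t it is spanned by e_b + t e_a, with
  leading index a, and e_b completes it to a basis of the plane.\<close>

lemma bruhat_le_swap:
  assumes w: "(a, b) \<in> Wodd n" and "b < a"
  shows "bruhat_le n (b, a) (a, b)"
proof (rule bruhat_le_if_orbit)
  show w': "(b, a) \<in> Wodd n" using w Wodd_commute by blast
  fix g assume g: "g \<in> Borel n"
  have gE: "g (evec i) \<in> E n" and gd: "g (evec i) i \<noteq> 0" and gs: "supp_le i (g (evec i))"
    if "i \<in> {1..2 * n + 1}" for i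
    using that Borel_E[OF g, of "evec i"] Borel_diagonal_nonzero[OF g that] Borel_supp_le_evec[OF g that] by simp_all
  let ?x = "\<lambda>t. g (evec b) + vscale t (g (evec a))"
  have ab: "a \<in> {1..2 * n + 1}" "b \<in> {1..2 * n + 1}" "a \<noteq> b"
    using w by (auto simp: Wodd_def)
  have b: "supp_le b (g (evec b))" by (rule Borel_supp_le_evec[OF g ab(2)])
  have "flag_of (?x 0) (g (evec a)) \<in> zariski n closure_of cell n (a, b)"
  proof (rule in_closure_of_curve[where y = "\<lambda>t. g (evec a)" and x = ?x])
    show "flag_of (?x 0) (g (evec a)) \<in> IF n" using Borel_flag_in_IF[OF g w'] by simp
    show "cell n (a, b) \<subseteq> IF n" using ab by (intro cell_subset_IF)
    fix t :: complex assume "t \<noteq> 0"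
    have x: "?x t a \<noteq> 0" "supp_le a (?x t)"
      using b \<open>b < a\<close> \<open>t \<noteq> 0\<close> Borel_diagonal_nonzero[OF g ab(1)] Borel_supp_le_evec[OF g ab(1)]
      by (simp_all add: supp_le_def vscale_def)
    have "flag_of (?x t) (g (evec b)) \<in> cell n (a, b)"
    proof (rule flag_of_in_cell)
      show "omega n (?x t) (g (evec b)) = 0"
        using ab omega_evec_evec[OF w] by (simp add: omega_bilinear Borel_omega[OF g])
    qed (use ab x in \<open>simp_all add: gE gd gs E_add E_scale\<close>)
    moreover have "flag_of (?x t) (g (evec a)) = flag_of (?x t) (g (evec b))"
    proof (rule flag_of_eq)
      show "?x t \<in> cvec.span {?x t}" by (rule cvec.span_base) simp
      have "g (evec a) = vscale (1 / t) (?x t) + vscale (- (1 / t)) (g (evec b))"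
        using \<open>t \<noteq> 0\<close> by (simp add: vscale_def fun_eq_iff field_simps)
      then show "g (evec a) \<in> cvec.span {?x t, g (evec b)}" unfolding mem_span2 by blast
      have "plucker (?x t) (g (evec a)) = plucker (g (evec b)) (g (evec a))"
        by (auto simp: fun_eq_iff plucker_apply vscale_def algebra_simps)
      then show "plucker (?x t) (g (evec a)) \<noteq> 0"
        using Borel_flag_in_IF[OF g w'] by (simp add: flag_of_in_IF_iff)
    qed
    ultimately show "flag_of (?x t) (g (evec a)) \<in> cell n (a, b)" by simp
  qed (rule is_poly_line, rule is_poly_const)
  then show "flag_of (g (evec b)) (g (evec a)) \<in> zariski n closure_of cell n (a, b)" by simp
qed (use w in auto)

text \<open>The source of all equations for Schubert varieties below: a form that is zero on the
  normal forms of a cell is zero on its closure.\<close>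

lemma form_zero_on_Schubert:
  assumes "(a, b) \<in> Wodd n" "bihom k l P" "flag_of x y \<in> Schubert n (a, b)"
    and "\<And>x y. \<lbrakk>x a = 1; supp_le a x; y b = 1; y a = 0; supp_le b y; x \<in> E n; y \<in> E n\<rbrakk> \<Longrightarrow> P x (plucker x y) = 0"
  shows "P x (plucker x y) = 0"
proof (rule ccontr)
  have cl: "flag_of x y \<in> zariski n closure_of cell n (a, b)"
    using assms(3) unfolding Schubert_eq[OF assms(1)] .
  then have IF: "flag_of x y \<in> IF n" unfolding in_closure_of_zariski by (rule conjunct1)
  assume "P x (plucker x y) \<noteq> 0"
  then have "flag_of x y \<in> nonvanishing n P" by (simp add: nonvanishing_iff[OF assms(2) IF])
  then obtain G where G: "G \<in> cell n (a, b)" "G \<in> nonvanishing n P"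
    using cl assms(2) unfolding in_closure_of_zariski by blast
  then obtain x' y' where xy: "G = flag_of x' y'" "x' a = 1" "supp_le a x'" "y' b = 1" "y' a = 0" "supp_le b y'" "x' \<in> E n" "y' \<in> E n"
    unfolding cell_iff by blast
  have "G \<in> IF n" using G(2) nonvanishing_subset by blast
  then have "P x' (plucker x' y') \<noteq> 0" using G(2) unfolding xy(1) by (simp add: nonvanishing_iff[OF assms(2)])
  then show False using assms(4) xy by blast
qed

lemma Schubert_IF: "Schubert n w \<subseteq> IF n"
  unfolding Schubert_def using closure_of_subset_topspace[of "zariski n"] by simp

lemma Schubert_fst_supp:
  assumes "(a, b) \<in> Wodd n" "flag_of x y \<in> Schubert n (a, b)"
  shows "supp_le a x"
  unfolding supp_le_def using form_zero_on_Schubert[OF assms(1) bihom.coord1 assms(2)]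
  by (auto simp: supp_le_def)

lemma coord_flag_in_Schubert:
  assumes "(a, b) \<in> Wodd n"
  shows "flag_of (evec a) (evec b) \<in> Schubert n (a, b)"
proof -
  have "flag_of (evec a) (evec b) \<in> Borel_orbit n (coord_flag (a, b))"
    unfolding Borel_orbit_eq using Borel_id by fastforce
  then show ?thesis using cell_subset_Schubert[OF assms] Borel_orbit_eq_cell[OF assms] by blast
qed

text \<open>The Plucker coordinate (a, b) vanishes on X(a|c) but not at the coordinate flag of
  (a|b).\<close>

lemma Schubert_second_strict:
  assumes w: "(a, b) \<in> Wodd n" "(a, c) \<in> Wodd n" and "c < b"
  shows "Schubert n (a, c) \<subset> Schubert n (a, b)"
proof -
  have "flag_of (evec a) (evec b) \<notin> Schubert n (a, c)"
  proof
    assume a: "flag_of (evec a) (evec b) \<in> Schubert n (a, c)"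
    have "plucker (evec a) (evec b) (a, b) = 0"
    proof (rule form_zero_on_Schubert[OF w(2) bihom.coord2 a])
      fix x y :: cvec assume "x a = 1" "supp_le a x" "supp_le c y" "y a = 0"
      then show "plucker x y (a, b) = 0" using \<open>c < b\<close> by (simp add: plucker_apply supp_le_def)
    qed
    then show False using w by (auto simp: plucker_apply evec_def Wodd_def)
  qed
  then show ?thesis
    using bruhat_le_second[OF assms] coord_flag_in_Schubert[OF w(1)] unfolding bruhat_le_def by blast
qed

lemma Schubert_swap_strict:
  assumes w: "(a, b) \<in> Wodd n" and "b < a"
  shows "Schubert n (b, a) \<subset> Schubert n (a, b)"
proof -
  have "flag_of (evec a) (evec b) \<notin> Schubert n (b, a)"
  proof
    assume "flag_of (evec a) (evec b) \<in> Schubert n (b, a)"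
    moreover have "(b, a) \<in> Wodd n" using w Wodd_commute[of a b n] by simp
    ultimately have "supp_le b (evec a)" using Schubert_fst_supp by blast
    then have "evec a a = 0" unfolding supp_le_def using \<open>b < a\<close> by blast
    then show False by simp
  qed
  then show ?thesis
    using bruhat_le_swap[OF assms] coord_flag_in_Schubert[OF w] unfolding bruhat_le_def by blast
qed

section \<open>Covers and the dimension formula\<close>

lemma cell_dim_swap:
  assumes w: "(a, b) \<in> Wodd n" and "b < a"
  shows "cell_dim n (a, b) = Suc (cell_dim n (b, a))"
proof -
  have ab: "a \<in> {1..2 * n + 1}" "b \<in> {1..2 * n + 1}" "b \<noteq> lbar n a" using w by (auto simp: Wodd_iff)
  have "b \<noteq> 2 * n + 3 - b" using ab(2) by (simp, presburger)
  then have b: "lbar n b \<noteq> b" by (simp add: lbar_def)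
  have l: "1 \<le> lbar n a" "1 \<le> lbar n b" "lbar n a \<ge> 2" using ab by (auto simp: lbar_def)
  have eq1: "{1..<b} - {a, lbar n a} = {1..<b} - {lbar n a}" using \<open>b < a\<close> by auto
  have 1: "card ({1..<b} - {a, lbar n a}) = b - 1 - (if lbar n a < b then 1 else 0)"
    unfolding eq1 card_Diff_singleton_if using l by simp
  have eq2: "{1..<a} - {b, lbar n b} = ({1..<a} - {lbar n b}) - {b}" by auto
  have 2: "card ({1..<a} - {b, lbar n b}) = a - 1 - (if lbar n b < a then 1 else 0) - 1"
    unfolding eq2 card_Diff_singleton_if using l ab b \<open>b < a\<close> by simp
  \<comment> \<open>Both conditions say a + b > 2n + 3, so these corrections cancel; the remaining
    difference of one is the label b excluded below a.\<close>
  have "lbar n b < a \<longleftrightarrow> lbar n a < b" using ab by (auto simp: lbar_def)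
  then show ?thesis unfolding cell_dim_def prod.case 1 2 using ab l \<open>b < a\<close> by auto
qed

lemma cell_dim_second:
  assumes "{1..<b} - {a, lbar n a} = insert c ({1..<c} - {a, lbar n a})" "c \<notin> {1..<c}"
  shows "cell_dim n (a, b) = Suc (cell_dim n (a, c))"
  unfolding cell_dim_def prod.case assms(1) by simp

text \<open>Meant for c the largest admissible label below b: lowering b to c removes just c from
  the index set, so the dimension drops by one.\<close>

lemma interval_diff_Max:
  fixes b c m :: nat
  assumes "c \<in> {m..<b} - X" "\<And>i. i \<in> {m..<b} - X \<Longrightarrow> i \<le> c"
  shows "{m..<b} - X = insert c ({m..<c} - X)"
proof (intro set_eqI iffI)
  fix i assume i: "i \<in> {m..<b} - X"
  then show "i \<in> insert c ({m..<c} - X)" using assms(2)[OF i] by auto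
qed (use assms(1) in auto)

lemma interval_diff_Min:
  fixes b c m :: nat
  assumes "c \<in> {b<..N} - X" "\<And>i. i \<in> {b<..N} - X \<Longrightarrow> c \<le> i" "b \<notin> X" "m \<le> b"
  shows "{m..<c} - X = insert b ({m..<b} - X)"
proof (intro set_eqI iffI)
  fix i assume i: "i \<in> {m..<c} - X"
  then have "i \<notin> {b<..N} - X" using assms(2)[of i] by auto
  then show "i \<in> insert b ({m..<b} - X)" using i assms(1) by auto
qed (use assms in auto)

text \<open>Lower b to the next admissible label. If there is none, then b = 1 and the labels can be
  swapped: \<open>b \<ge> 2\<close> would force a = 1, and then b = 2, the excluded vertex.\<close>

lemma lower_cover:
  assumes w: "w \<in> Wodd n" "w \<noteq> (1, 2)"
  obtains v where "v \<in> Wodd n" "cell_dim n w = Suc (cell_dim n v)" "Schubert n v \<subset> Schubert n w"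
proof -
  obtain a b where ab: "w = (a, b)" by (cases w)
  let ?S = "{1..<b} - {a, lbar n a}"
  show ?thesis
  proof (cases "?S = {}")
    case False
    define c where "c = Max ?S"
    have c: "c \<in> ?S" unfolding c_def by (rule Max_in[OF _ False]) simp
    then have v: "(a, c) \<in> Wodd n" "c < b" using w ab by (auto simp: Wodd_iff)
    have "i \<le> c" if "i \<in> ?S" for i unfolding c_def by (rule Max_ge[OF _ that]) simp
    note interval_diff_Max[OF c this]
    then show ?thesis
      using that[of "(a, c)"] v w ab cell_dim_second Schubert_second_strict by simp
  next
    case True
    then have sub: "{1..<b} \<subseteq> {a, lbar n a}" by blast
    have "b = 1"
    proof (rule ccontr)
      assume "b \<noteq> 1"
      then have b: "b \<ge> 2" using w ab by (auto simp: Wodd_iff)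
      then have "1 \<in> {a, lbar n a}" by (intro subsetD[OF sub]) simp
      then have "a = 1" using w ab by (auto simp: Wodd_iff lbar_def)
      then have "b > 2" using w ab b by auto
      then have "2 \<in> {a, lbar n a}" by (intro subsetD[OF sub]) simp
      then show False using \<open>a = 1\<close> \<open>b > 2\<close> w ab by (auto simp: lbar_def Wodd_iff)
    qed
    then have "b < a" using w ab by (auto simp: Wodd_iff)
    then show ?thesis
      using that[of "(b, a)"] w ab cell_dim_swap Schubert_swap_strict Wodd_commute by simp
  qed
qed

text \<open>Raise b to the next admissible label, or swap if a < b. If neither is possible, 2n+1 is
  a or its bar: a = 2n+1 forces b = 2n, the excluded vertex, and a = 2 leaves the label 3 admissible
  because n is at least 2.\<close>

lemma upper_cover:
  assumes w: "w \<in> Wodd n" "w \<noteq> (2 * n + 1, 2 * n)" and n: "n \<ge> 2"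
  obtains u where "u \<in> Wodd n" "cell_dim n u = Suc (cell_dim n w)" "Schubert n w \<subset> Schubert n u"
proof -
  obtain a b where ab: "w = (a, b)" by (cases w)
  let ?S = "{b<..2 * n + 1} - {a, lbar n a}"
  show ?thesis
  proof (cases "?S = {}")
    case False
    define c where "c = Min ?S"
    have c: "c \<in> ?S" unfolding c_def by (rule Min_in[OF _ False]) simp
    then have v: "(a, c) \<in> Wodd n" "b < c" using w ab by (auto simp: Wodd_iff)
    have "c \<le> i" if "i \<in> ?S" for i unfolding c_def by (rule Min_le[OF _ that]) simp
    moreover have "b \<notin> {a, lbar n a}" "1 \<le> b" using w ab by (auto simp: Wodd_iff)
    ultimately have "{1..<c} - {a, lbar n a} = insert b ({1..<b} - {a, lbar n a})"
      by (intro interval_diff_Min[OF c])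
    then show ?thesis
      using that[of "(a, c)"] v w ab cell_dim_second Schubert_second_strict by simp
  next
    case True
    have "a < b"
    proof (rule ccontr)
      assume "\<not> a < b"
      then have "b < a" using w ab by (auto simp: Wodd_iff)
      have S: "i = a \<or> i = lbar n a" if "b < i" "i \<le> 2 * n + 1" for i using True that by auto
      have "2 * n + 1 = a \<or> 2 * n + 1 = lbar n a" using \<open>b < a\<close> w ab by (intro S) (auto simp: Wodd_iff)
      then show False
      proof
        assume a: "2 * n + 1 = a"
        then have "lbar n a = 2" by (simp add: lbar_def)
        then have "\<not> b < 2 * n" using S[of "2 * n"] a n by auto
        then show False using \<open>b < a\<close> a w ab by auto
      next
        assume "2 * n + 1 = lbar n a"
        then have "a = 2" by (simp add: lbar_def)
        then have "b < 3" using \<open>b < a\<close> by simp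
        then show False using S[of 3] \<open>a = 2\<close> n by (auto simp: lbar_def)
      qed
    qed
    then show ?thesis
      using that[of "(b, a)"] w ab cell_dim_swap Schubert_swap_strict Wodd_commute by simp
  qed
qed

text \<open>A crude bound, sufficient for inductions that climb along \<open>upper_cover\<close> to
  terminate.\<close>

lemma cell_dim_le: "w \<in> Wodd n \<Longrightarrow> cell_dim n w \<le> 4 * n"
proof -
  assume w: "w \<in> Wodd n"
  obtain a b where ab: "w = (a, b)" by (cases w)
  have "card ({1..<b} - {a, lbar n a}) \<le> card {1..<b}" by (intro card_mono) auto
  then show ?thesis using w ab by (auto simp: cell_dim_def Wodd_iff)
qed

lemma ell_eq: "w \<in> Wodd n \<Longrightarrow> ell n w = cell_dim n w"
proof (induction "cell_dim n w" arbitrary: w rule: less_induct)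
  case less
  show ?case
  proof (cases "w = (1, 2)")
    case True
    have "cell_dim n (1, 2) = 0" by (simp add: cell_dim_def numeral_2_eq_2)
    then show ?thesis using ell_le_cell_dim[OF less.prems] True by simp
  next
    case False
    obtain v where v: "v \<in> Wodd n" "cell_dim n w = Suc (cell_dim n v)" "Schubert n v \<subset> Schubert n w"
      using lower_cover[OF less.prems False] .
    then have "cell_dim n v < ell n w"
      using less.hyps[of v] ell_less[OF v(1) less.prems v(3)] by simp
    then show ?thesis using ell_le_cell_dim[OF less.prems] v(2) by simp
  qed
qed

lemma classical_edge_if_cover:
  assumes "v \<in> Wodd n" "w \<in> Wodd n" "cell_dim n w = Suc (cell_dim n v)" "Schubert n v \<subset> Schubert n w"
  shows "classical_edge n w v"
  using assms by (auto simp: classical_edge_def bruhat_le_def ell_eq)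

section \<open>Some Schubert varieties\<close>

text \<open>The labels are the leading index of x and that of y reduced modulo x. They cannot be
  bars of each other, since the form would then be the product of the leading coordinates up to
  sign.\<close>

lemma flag_in_some_cell:
  assumes "F \<in> IF n"
  obtains a b where "(a, b) \<in> Wodd n" "F \<in> cell n (a, b)"
proof -
  obtain x y where F: "F = flag_of x y" "x \<in> E n" "y \<in> E n" "plucker x y \<noteq> 0" "omega n x y = 0"
    using assms by (rule flag_cases)
  have "x \<noteq> 0" using F(4) by auto
  then obtain a where a: "a \<in> {1..2 * n + 1}" "x a \<noteq> 0" "supp_le a x"
    using leading_index_exists[OF F(2)] by blast
  define z where "z = y - vscale (y a / x a) x"
  have y: "y = z + vscale (y a / x a) x" by (simp add: z_def)
  have z: "z \<in> E n" unfolding z_def using F by (intro E_diff E_scale)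
  have za: "z a = 0" using a by (simp add: z_def vscale_def)
  have pl: "plucker x z = plucker x y"
    by (auto simp: z_def fun_eq_iff plucker_apply vscale_def algebra_simps)
  then have "z \<noteq> 0" using F(4) by auto
  then obtain b where b: "b \<in> {1..2 * n + 1}" "z b \<noteq> 0" "supp_le b z"
    using leading_index_exists[OF z] by blast
  have "a \<noteq> b" using za b by auto
  have oz: "omega n x z = 0" using F(5) by (subst (asm) y) (simp add: omega_bilinear)
  have "b \<noteq> lbar n a"
  proof
    assume bl: "b = lbar n a"
    then have a2: "a \<in> {2..2 * n + 1}" using a b by (auto simp: lbar_def)
    then have "omega n x z = osgn n a * x a * z b" using a b bl by (simp add: omega_leading)
    then show False using oz a b by simp
  qed
  then have "(a, b) \<in> Wodd n" using a b \<open>a \<noteq> b\<close> by (simp add: Wodd_iff)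
  moreover have "flag_of x z \<in> cell n (a, b)"
    using a b oz F z \<open>a \<noteq> b\<close> by (intro flag_of_in_cell)
  moreover have "flag_of x z = flag_of x y"
  proof (rule flag_of_eq)
    show "x \<in> cvec.span {x}" by (rule cvec.span_base) simp
    show "z \<in> cvec.span {x, y}" unfolding z_def
      by (intro cvec.span_diff cvec.span_scale cvec.span_base) auto
    show "plucker x z \<noteq> 0" using pl F by simp
  qed
  ultimately show ?thesis using that F(1) by simp
qed

lemma Schubert_top:
  assumes "n \<ge> 2"
  shows "Schubert n (2 * n + 1, 2 * n) = IF n"
proof
  have *: "Schubert n w \<subseteq> Schubert n (2 * n + 1, 2 * n)" if "w \<in> Wodd n" for w
    using that
  proof (induction "4 * n - cell_dim n w" arbitrary: w rule: less_induct)
    case less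
    show ?case
    proof (cases "w = (2 * n + 1, 2 * n)")
      case False
      obtain u where u: "u \<in> Wodd n" "cell_dim n u = Suc (cell_dim n w)" "Schubert n w \<subset> Schubert n u"
        using upper_cover[OF less.prems False assms] .
      have "cell_dim n u \<le> 4 * n" by (rule cell_dim_le[OF u(1)])
      then have "Schubert n u \<subseteq> Schubert n (2 * n + 1, 2 * n)"
        using u(2) by (intro less.hyps[OF _ u(1)]) simp
      then show ?thesis using u(3) by blast
    qed simp
  qed
  show "IF n \<subseteq> Schubert n (2 * n + 1, 2 * n)"
  proof
    fix F assume "F \<in> IF n"
    then obtain a b where ab: "(a, b) \<in> Wodd n" "F \<in> cell n (a, b)" by (rule flag_in_some_cell)
    then show "F \<in> Schubert n (2 * n + 1, 2 * n)"
      using *[OF ab(1)] cell_subset_Schubert[OF ab(1)] by blast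
  qed
qed (rule Schubert_IF)

lemma supp_le_1_in_span:
  assumes "x \<in> E n" "supp_le 1 x"
  shows "x \<in> cvec.span {evec 1}"
proof -
  have "x = vscale (x 1) (evec 1)"
  proof
    fix i show "x i = vscale (x 1) (evec 1) i"
      using assms E_zero_outside[OF assms(1), of i]
      by (cases i "1 :: nat" rule: linorder_cases) (auto simp: vscale_def evec_def supp_le_def)
  qed
  then show ?thesis unfolding mem_span1 by blast
qed

lemma Schubert_line_fixed:
  assumes "n \<ge> 2"
  shows "Schubert n (1, 2 * n + 1) = {F \<in> IF n. fst F = cvec.span {evec 1}}"
proof (intro set_eqI iffI)
  have w: "(1, 2 * n + 1) \<in> Wodd n" using assms by (auto simp: Wodd_iff lbar_def)
  fix F
  {
    assume a: "F \<in> Schubert n (1, 2 * n + 1)"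
    then have IF: "F \<in> IF n" using Schubert_IF by blast
    then obtain x y where F: "F = flag_of x y" "x \<in> E n" "plucker x y \<noteq> 0" by (rule flag_cases)
    have "supp_le 1 x" using Schubert_fst_supp[OF w] a F(1) by simp
    then have "x \<in> cvec.span {evec 1}" using supp_le_1_in_span[OF F(2)] by blast
    moreover have "x \<noteq> 0" using F(3) by auto
    ultimately show "F \<in> {F \<in> IF n. fst F = cvec.span {evec 1}}"
      using IF span1_eq by (simp add: F(1) flag_of_def)
  }
  assume "F \<in> {F \<in> IF n. fst F = cvec.span {evec 1}}"
  then have F: "F \<in> IF n" "fst F = cvec.span {evec 1}" by auto
  obtain a b where ab: "(a, b) \<in> Wodd n" "F \<in> cell n (a, b)" using F(1) by (rule flag_in_some_cell)
  then obtain x y where xy: "F = flag_of x y" "x a = 1" unfolding cell_iff by blast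
  have "x \<in> cvec.span {evec 1}" using F(2) xy(1) cvec.span_base[of x "{x}"] by (simp add: flag_of_def)
  then have "a = 1" using xy(2) by (auto simp: mem_span1 vscale_def evec_def split: if_splits)
  have "Schubert n (a, b) \<subseteq> Schubert n (1, 2 * n + 1)"
    using bruhat_le_second[OF w, of b] ab(1) \<open>a = 1\<close>
    by (cases "b = 2 * n + 1") (auto simp: bruhat_le_def Wodd_iff)
  then show "F \<in> Schubert n (1, 2 * n + 1)" using cell_subset_Schubert[OF ab(1)] ab(2) by blast
qed

text \<open>On the cell y equals e_1, so only Plucker coordinates involving the index 1 survive, and
  then e_1 satisfies the equations of the plane. Conversely, a flag with e_1 in V2 has 1 as one of
  its two labels.\<close>

lemma Schubert_plane_through_kernel:
  assumes "n \<ge> 2"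
  shows "Schubert n (2 * n + 1, 1) = {F \<in> IF n. evec 1 \<in> snd F}"
proof (intro set_eqI iffI)
  have w: "(2 * n + 1, 1) \<in> Wodd n" using assms by (auto simp: Wodd_iff lbar_def)
  fix F
  {
    assume a: "F \<in> Schubert n (2 * n + 1, 1)"
    then have IF: "F \<in> IF n" using Schubert_IF by blast
    then obtain x y where F: "F = flag_of x y" "plucker x y \<noteq> 0" by (rule flag_cases)
    have *: "plucker x y (j, k) = 0" if "j \<noteq> 1" "k \<noteq> 1" for j k
    proof (rule form_zero_on_Schubert[OF w bihom.coord2 a[unfolded F(1)]])
      fix x y :: cvec assume "supp_le 1 y" "y \<in> E n"
      then have "y i = 0" if "i \<noteq> 1" for i
        using that E_zero_outside[of y n i] by (cases "i = 0") (simp_all add: supp_le_def)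
      then show "plucker x y (j, k) = 0" using that by (simp add: plucker_apply)
    qed
    have "evec 1 \<in> cvec.span {x, y}"
      unfolding mem_span2_iff_plucker[OF F(2)]
    proof (intro allI)
      fix i j k
      show "evec 1 i * plucker x y (j, k) - evec 1 j * plucker x y (i, k) + evec 1 k * plucker x y (i, j) = 0"
        using *[of j k] *[of i k] *[of i j]
        by (cases "i = 1"; cases "j = 1"; cases "k = 1") (simp_all add: evec_def plucker_apply)
    qed
    then show "F \<in> {F \<in> IF n. evec 1 \<in> snd F}" using IF by (simp add: F(1) flag_of_def)
  }
  assume "F \<in> {F \<in> IF n. evec 1 \<in> snd F}"
  then have F: "F \<in> IF n" "evec 1 \<in> snd F" by auto
  obtain a b where ab: "(a, b) \<in> Wodd n" "F \<in> cell n (a, b)" using F(1) by (rule flag_in_some_cell)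
  then obtain x y where xy: "F = flag_of x y" "x a = 1" "supp_le a x" "y b = 1" "y a = 0" "supp_le b y"
    unfolding cell_iff by blast
  have W: "a \<in> {1..2 * n + 1}" "b \<in> {1..2 * n + 1}" "a \<noteq> b" using ab(1) by (auto simp: Wodd_iff)
  obtain c d where "evec 1 = vscale c x + vscale d y"
    using F(2) by (auto simp: xy(1) flag_of_def mem_span2)
  then have cd: "evec 1 i = c * x i + d * y i" for i by (simp add: vscale_def)
  \<comment> \<open>In the echelon basis the coefficients c and d are read off from the coordinates
    a and b, where e_1 would be zero.\<close>
  have ab1: "a = 1 \<or> b = 1"
  proof (rule ccontr)
    assume *: "\<not> ?thesis"
    then have "c = 0" using cd[of a] xy by (simp add: evec_def)
    moreover from this have "d = 0" using cd[of b] xy * by (simp add: evec_def)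
    ultimately show False using cd[of 1] by (simp add: evec_def)
  qed
  have w1: "(a, 1) \<in> Wodd n" if "a \<in> {2..2 * n + 1}" for a using that by (auto simp: Wodd_iff lbar_def)
  have le: "Schubert n (a, 1) \<subseteq> Schubert n (2 * n + 1, 1)" if "a \<in> {2..2 * n + 1}" for a
    using bruhat_le_first[OF w w1[OF that]] that by (cases "a = 2 * n + 1") (auto simp: bruhat_le_def)
  have "Schubert n (a, b) \<subseteq> Schubert n (2 * n + 1, 1)"
  proof (cases "b = 1")
    case True
    then show ?thesis using le[of a] W by auto
  next
    case False
    then have "a = 1" "b \<in> {2..2 * n + 1}" using ab1 W by auto
    then show ?thesis using le[of b] bruhat_le_swap[OF w1[of b]] by (auto simp: bruhat_le_def)
  qed
  then show "F \<in> Schubert n (2 * n + 1, 1)" using cell_subset_Schubert[OF ab(1)] ab(2) by blast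
qed

text \<open>Up to sign only the Plucker coordinate (1, 2) survives on the cell, hence on its
  closure, which forces the plane spanned by e_1 and e_2.\<close>

lemma Schubert_plane_fixed:
  assumes "n \<ge> 2"
  shows "Schubert n (2, 1) = {F \<in> IF n. snd F = cvec.span {evec 1, evec 2}}"
proof (intro set_eqI iffI)
  have w: "(2, 1) \<in> Wodd n" "(1, 2) \<in> Wodd n" using assms by (auto simp: Wodd_iff lbar_def)
  fix F
  {
    assume a: "F \<in> Schubert n (2, 1)"
    then have IF: "F \<in> IF n" using Schubert_IF by blast
    then obtain x y where F: "F = flag_of x y" "x \<in> E n" "y \<in> E n" "plucker x y \<noteq> 0" by (rule flag_cases)
    have p: "plucker x y (j, k) = 0" if "j > 2 \<or> k > 2" for j k
    proof (rule form_zero_on_Schubert[OF w(1) bihom.coord2 a[unfolded F(1)]])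
      fix x y :: cvec assume "supp_le 2 x" "supp_le 1 y"
      then show "plucker x y (j, k) = 0" using that by (auto simp: plucker_apply supp_le_def)
    qed
    define q where "q = plucker x y (1, 2)"
    have pl: "plucker x y = (\<lambda>ij. q * plucker (evec 1) (evec 2) ij)"
    proof
      fix ij :: "nat \<times> nat"
      obtain i j where ij: "ij = (i, j)" by (cases ij)
      have 0: "x 0 = 0" "y 0 = 0" using F(2,3) by (auto simp: E_def)
      consider "i > 2 \<or> j > 2" | "i \<in> {0, 1, 2}" "j \<in> {0, 1, 2}" by (cases "i > 2"; cases "j > 2"; fastforce)
      then show "plucker x y ij = q * plucker (evec 1) (evec 2) ij"
      proof cases
        case 1
        then have "plucker (evec 1) (evec 2) (i, j) = 0" by (auto simp: plucker_apply evec_def)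
        then show ?thesis using p[OF 1] by (simp add: ij)
      next
        case 2
        then show ?thesis using 0 by (auto simp: ij q_def plucker_apply evec_def)
      qed
    qed
    have "q \<noteq> 0"
    proof
      assume "q = 0"
      then have "plucker x y = 0" unfolding pl by (simp add: zero_fun_def)
      then show False using F(4) by simp
    qed
    \<comment> \<open>The scalar q is absorbed into e_1 so that the two bivectors become equal and
      not merely proportional.\<close>
    have "plucker (vscale q (evec 1)) (evec 2) = (\<lambda>ij. q * plucker (evec 1) (evec 2) ij)"
      by (auto simp: fun_eq_iff plucker_apply vscale_def algebra_simps)
    then have pq: "plucker (vscale q (evec 1)) (evec 2) = plucker x y" by (simp only: pl)
    then have "cvec.span {vscale q (evec 1), evec 2} = cvec.span {x, y}"
      by (rule span_eq_if_plucker_eq[OF F(4)])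
    moreover have "cvec.span {vscale q (evec 1), evec 2} = cvec.span {evec 1, evec 2}"
    proof (rule span2_eq)
      show "vscale q (evec 1) \<in> cvec.span {evec 1, evec 2}"
        by (intro cvec.span_scale cvec.span_base) simp
      show "evec 2 \<in> cvec.span {evec 1, evec 2}" by (rule cvec.span_base) simp
      show "plucker (vscale q (evec 1)) (evec 2) \<noteq> 0" using pq F(4) by simp
    qed
    ultimately show "F \<in> {F \<in> IF n. snd F = cvec.span {evec 1, evec 2}}"
      using IF by (simp add: F(1) flag_of_def)
  }
  assume "F \<in> {F \<in> IF n. snd F = cvec.span {evec 1, evec 2}}"
  then have F: "F \<in> IF n" "snd F = cvec.span {evec 1, evec 2}" by auto
  obtain a b where ab: "(a, b) \<in> Wodd n" "F \<in> cell n (a, b)" using F(1) by (rule flag_in_some_cell)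
  then obtain x y where xy: "F = flag_of x y" "x a = 1" "y b = 1"
    unfolding cell_iff by blast
  have supp: "v i = 0" if "v \<in> snd F" "i > 2" for v i
    using that by (auto simp: F(2) mem_span2 vscale_def evec_def)
  have "x \<in> snd F" "y \<in> snd F" using cvec.span_base by (auto simp: xy(1) flag_of_def)
  then have "a \<le> 2" "b \<le> 2" using supp[of x a] supp[of y b] xy by (auto simp: not_less[symmetric])
  then have "(a, b) = (2, 1) \<or> (a, b) = (1, 2)" using ab(1) by (auto simp: Wodd_iff)
  then have "Schubert n (a, b) \<subseteq> Schubert n (2, 1)"
    using bruhat_le_swap[OF w(1)] by (auto simp: bruhat_le_def)
  then show "F \<in> Schubert n (2, 1)" using cell_subset_Schubert[OF ab(1)] ab(2) by blast
qed

section \<open>Curve neighborhoods\<close>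

lemma form_value_deg0: "form_value 0 c p = c 0"
  by (auto simp: form_value_def split: prod.split)

lemma form_value_deg1:
  "form_value (Suc 0) c p = (case hcoords p of (s, t) \<Rightarrow> (\<lambda>i. c 0 i * t + c 1 i * s))"
  by (auto simp: form_value_def fun_eq_iff split: prod.split)

lemma P1_morphism_IF: "P1_morphism n d f \<Longrightarrow> f p \<in> IF n"
  by (simp add: P1_morphism_def)

lemma P1_morphism_fst_const:
  assumes "P1_morphism n d f" "fst d = 0"
  shows "fst (f p) = fst (f q)"
  using assms by (auto simp: P1_morphism_def form_value_deg0)

text \<open>Forms of degree 0 give one fixed bivector. It is nonzero because V2 is a plane, so it
  determines V2.\<close>

lemma P1_morphism_snd_const:
  assumes "P1_morphism n d f" "snd d = 0"
  shows "snd (f p) = snd (f q)"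
proof -
  obtain F G where FG: "\<And>p. \<exists>y z. snd (f p) = cvec.span {y, z} \<and> plucker y z = form_value (snd d) G p"
    using assms(1) unfolding P1_morphism_def by blast
  obtain y z where yz: "snd (f p) = cvec.span {y, z}" "plucker y z = G 0"
    using FG[of p] assms(2) by (auto simp: form_value_deg0)
  obtain y' z' where yz': "snd (f q) = cvec.span {y', z'}" "plucker y' z' = G 0"
    using FG[of q] assms(2) by (auto simp: form_value_deg0)
  obtain u v where uv: "f p = flag_of u v" "plucker u v \<noteq> 0"
    using flag_cases[OF P1_morphism_IF[OF assms(1)]] by metis
  then have "cvec.span {y, z} = cvec.span {u, v}" using yz by (simp add: flag_of_def)
  then obtain d where "d \<noteq> 0" "plucker y z = (\<lambda>ij. d * plucker u v ij)"
    using plucker_scale_if_span_eq uv(2) by metis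
  then have "plucker y z \<noteq> 0" using uv(2) by (auto simp: fun_eq_iff)
  then show ?thesis using span_eq_if_plucker_eq[of y z y' z'] yz yz' by simp
qed

text \<open>A quantity constant on each component takes equal values across every node, and the dual
  graph is connected. It is applied to V1 and to V2.\<close>

lemma stable_map_const:
  assumes S: "S \<in> stable_maps n d"
    and const: "\<And>v p q. v \<in> comps S \<Longrightarrow> h (cmap S v p) = h (cmap S v q)"
  shows "h (map_at S (mark1 S)) = h (map_at S (mark2 S))"
proof -
  have S': "genus0_curve S" "smooth_distinct_marks S" "morphism_to_IF n S"
    using S by (auto simp: stable_maps_def)
  have step: "h (cmap S u p) = h (cmap S v q)" if "(u, v) \<in> adjacent S" for u v p q
  proof -
    obtain p' q' where e: "((u, p'), (v, q')) \<in> nodes S" using \<open>(u, v) \<in> adjacent S\<close> by (auto simp: adjacent_def)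
    then have "cmap S u p' = cmap S v q'" using S'(3) by (force simp: morphism_to_IF_def map_at_def)
    moreover have "(u, p') \<in> node_branches S" "(v, q') \<in> node_branches S"
      using e unfolding node_branches_def by force+
    then have "u \<in> comps S" "v \<in> comps S" using S'(1) by (auto simp: genus0_curve_def)
    ultimately show ?thesis using const by metis
  qed
  have "\<forall>p q. h (cmap S u p) = h (cmap S v q)" if "(u, v) \<in> (adjacent S \<union> (adjacent S)\<inverse>)\<^sup>*" "u \<in> comps S" for u v
    using that
  proof (induction rule: rtrancl_induct)
    case base
    then show ?case using const by blast
  next
    case (step v w)
    then show ?case using \<open>\<And>v u p q. (u, v) \<in> adjacent S \<Longrightarrow> h (cmap S u p) = h (cmap S v q)\<close>
      by (metis UnE converseD)
  qed
  moreover have "fst (mark1 S) \<in> comps S" "fst (mark2 S) \<in> comps S"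
    using S'(2) by (auto simp: smooth_distinct_marks_def)
  moreover from this have "(fst (mark1 S), fst (mark2 S)) \<in> (adjacent S \<union> (adjacent S)\<inverse>)\<^sup>*"
    using S'(1) by (auto simp: genus0_curve_def)
  ultimately show ?thesis unfolding map_at_def by blast
qed

lemma curve_nbhd_IF: "curve_nbhd n d \<Omega> \<subseteq> IF n"
  by (fastforce simp: curve_nbhd_def stable_maps_def smooth_distinct_marks_def morphism_to_IF_def
      map_at_def dest: P1_morphism_IF)

lemma stable_map_cdeg:
  assumes "S \<in> stable_maps n d" "v \<in> comps S"
  shows "P1_morphism n (cdeg S v) (cmap S v)"
    "fst d = 0 \<Longrightarrow> fst (cdeg S v) = 0" "snd d = 0 \<Longrightarrow> snd (cdeg S v) = 0"
  using assms by (auto simp: stable_maps_def morphism_to_IF_def total_degree_def genus0_curve_def)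

text \<open>A sum of natural numbers is zero only if every summand is, so each component has first
  degree 0 and V1 is constant along the whole curve.\<close>

lemma curve_nbhd_fst_const:
  assumes "F \<in> curve_nbhd n (0, d2) \<Omega>"
  obtains G where "G \<in> \<Omega>" "fst F = fst G"
proof -
  obtain S where S: "S \<in> stable_maps n (0, d2)" "F = map_at S (mark2 S)" "map_at S (mark1 S) \<in> \<Omega>"
    using assms by (auto simp: curve_nbhd_def)
  have "fst (map_at S (mark1 S)) = fst (map_at S (mark2 S))"
  proof (rule stable_map_const[OF S(1)])
    fix v p q assume v: "v \<in> comps S"
    show "fst (cmap S v p) = fst (cmap S v q)"
      by (rule P1_morphism_fst_const[OF stable_map_cdeg(1)[OF S(1) v]])
        (use stable_map_cdeg(2)[OF S(1) v] in simp)
  qed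
  then show ?thesis using that S by metis
qed

lemma curve_nbhd_snd_const:
  assumes "F \<in> curve_nbhd n (d1, 0) \<Omega>"
  obtains G where "G \<in> \<Omega>" "snd F = snd G"
proof -
  obtain S where S: "S \<in> stable_maps n (d1, 0)" "F = map_at S (mark2 S)" "map_at S (mark1 S) \<in> \<Omega>"
    using assms by (auto simp: curve_nbhd_def)
  have "snd (map_at S (mark1 S)) = snd (map_at S (mark2 S))"
  proof (rule stable_map_const[OF S(1)])
    fix v p q assume v: "v \<in> comps S"
    show "snd (cmap S v p) = snd (cmap S v q)"
      by (rule P1_morphism_snd_const[OF stable_map_cdeg(1)[OF S(1) v]])
        (use stable_map_cdeg(3)[OF S(1) v] in simp)
  qed
  then show ?thesis using that S by metis
qed

section \<open>Curves in the fibres of the two projections\<close>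

lemma P1_morphism_const:
  assumes "F \<in> IF n"
  shows "P1_morphism n (0, 0) (\<lambda>p. F)"
proof -
  obtain x y where F: "F = flag_of x y" using assms by (rule flag_cases)
  have "\<forall>p :: P1. fst F = cvec.span {form_value (fst (0, 0 :: nat)) (\<lambda>_. x) p} \<and>
      (\<exists>y' z. snd F = cvec.span {y', z} \<and> plucker y' z = form_value (snd (0 :: nat, 0)) (\<lambda>_. plucker x y) p)"
    by (auto simp: F flag_of_def form_value_deg0)
  then show ?thesis unfolding P1_morphism_def using assms by blast
qed

text \<open>
  For \<open>p = q\<close> the marked points are put on an additional contracted component.
\<close>

lemma curve_nbhd_if_P1_morphism:
  assumes f: "P1_morphism n d f" and d: "d \<noteq> (0, 0)" and \<Omega>: "f p \<in> \<Omega>"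
  shows "f q \<in> curve_nbhd n d \<Omega>"
proof (cases "p = q")
  case False
  define S where "S = \<lparr>comps = {0}, nodes = {}, cmap = (\<lambda>_. f), cdeg = (\<lambda>_. d), mark1 = (0, p), mark2 = (0, q)\<rparr>"
  have "S \<in> stable_maps n d"
    using f d False by (auto simp: stable_maps_def S_def genus0_curve_def node_branches_def adjacent_def
        smooth_distinct_marks_def morphism_to_IF_def stable_def total_degree_def)
  moreover have "map_at S (mark1 S) = f p" "map_at S (mark2 S) = f q" by (simp_all add: S_def map_at_def)
  ultimately show ?thesis using \<Omega> unfolding curve_nbhd_def by (auto intro!: exI[of _ S])
next
  case True
  \<comment> \<open>The contracted component 0 carries the marks at \<open>None\<close> and
    \<open>Some 0\<close> and the node at \<open>Some 1\<close>, the three special points that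
    stability demands.\<close>
  define S where "S = \<lparr>comps = {0, 1}, nodes = {((0, Some 1), (1, p))},
    cmap = (\<lambda>v. if v = 0 then (\<lambda>_. f p) else f), cdeg = (\<lambda>v. if v = 0 then (0, 0) else d),
    mark1 = (0, None), mark2 = (0, Some 0)\<rparr>"
  have br: "node_branches S = {(0, Some 1), (1, p)}" by (auto simp: S_def node_branches_def)
  have adj: "adjacent S = {(0, 1)}" by (auto simp: S_def adjacent_def)
  have "genus0_curve S"
    unfolding genus0_curve_def br adj by (auto simp: S_def)
  moreover have "smooth_distinct_marks S"
    unfolding smooth_distinct_marks_def br by (auto simp: S_def)
  moreover have "morphism_to_IF n S"
    unfolding morphism_to_IF_def using f P1_morphism_const[OF P1_morphism_IF[OF f, of p]]
    by (auto simp: S_def map_at_def)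
  moreover have "stable S"
  proof -
    have "{r. (0, r) \<in> node_branches S \<union> {mark1 S, mark2 S}} = {Some 1, None, Some 0}"
      unfolding br by (auto simp: S_def)
    then show ?thesis unfolding stable_def using d by (auto simp: S_def)
  qed
  moreover have "total_degree S = d" by (simp add: total_degree_def S_def)
  ultimately have "S \<in> stable_maps n d" by (simp add: stable_maps_def)
  moreover have "map_at S (mark1 S) = f p" "map_at S (mark2 S) = f p" by (simp_all add: S_def map_at_def)
  ultimately show ?thesis using \<Omega> True unfolding curve_nbhd_def by (auto intro!: exI[of _ S])
qed

lemma hcoords_nonzero: "hcoords p \<noteq> (0, 0)"
  by (simp add: hcoords_def split: option.split)

lemma hcoords_None [simp]: "hcoords None = (1, 0)"
  and hcoords_Some [simp]: "hcoords (Some z) = (z, 1)"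
  by (simp_all add: hcoords_def)

lemma P1_morphism_first:
  assumes "flag_of x y \<in> IF n"
  shows "P1_morphism n (1, 0) (\<lambda>p. case hcoords p of (s, t) \<Rightarrow>
    (cvec.span {vscale s x + vscale t y}, cvec.span {x, y}))" (is "P1_morphism n _ ?f")
  unfolding P1_morphism_def
proof (intro conjI allI exI)
  fix p :: P1
  obtain s t where st: "hcoords p = (s, t)" by fastforce
  have xy: "x \<in> E n" "y \<in> E n" "plucker x y \<noteq> 0" "omega n x y = 0"
    using assms by (simp_all add: flag_of_in_IF_iff)
  have "s \<noteq> 0 \<or> t \<noteq> 0" using hcoords_nonzero[of p] st by auto
  \<comment> \<open>This z completes s x + t y to a basis of V2; the determinant is s in the first
    case and - t in the second.\<close>
  define z where "z = (if s \<noteq> 0 then y else x)"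
  define u where "u = vscale s x + vscale t y"
  define c where "c = (if s \<noteq> 0 then s else - t)"
  have "c \<noteq> 0" using \<open>s \<noteq> 0 \<or> t \<noteq> 0\<close> by (simp add: c_def)
  have "plucker u z = (\<lambda>ij. c * plucker x y ij)"
    by (auto simp: z_def u_def c_def fun_eq_iff plucker_apply vscale_def algebra_simps)
  then have pl: "plucker u z \<noteq> 0" using xy(3) \<open>c \<noteq> 0\<close> by (auto simp: fun_eq_iff)
  have "omega n u z = 0"
    using xy(4) omega_skew[of n y x] by (simp add: u_def z_def omega_bilinear)
  moreover have "u \<in> E n" "z \<in> E n" unfolding u_def z_def using xy by (auto intro: E_add E_scale)
  ultimately have "flag_of u z \<in> IF n" using pl by (simp add: flag_of_in_IF_iff)
  moreover have "cvec.span {u, z} = cvec.span {x, y}"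
  proof (rule span2_eq[OF _ _ pl])
    show "u \<in> cvec.span {x, y}" unfolding u_def
      by (intro cvec.span_add cvec.span_scale cvec.span_base) auto
    show "z \<in> cvec.span {x, y}" unfolding z_def by (rule cvec.span_base) simp
  qed
  ultimately show "?f p \<in> IF n" by (simp add: st flag_of_def u_def)
  \<comment> \<open>In \<open>form_value\<close> the index j is the exponent of s, so the
    coefficient for j = 0 is the vector multiplied by t.\<close>
  have "form_value (fst (1, 0 :: nat)) (\<lambda>j. if j = 0 then y else x) p = u"
    by (simp add: form_value_deg1 st u_def fun_eq_iff vscale_def)
  then show "fst (?f p) = cvec.span {form_value (fst (1, 0 :: nat)) (\<lambda>j. if j = 0 then y else x) p}"
    by (simp add: st u_def)
  show "snd (?f p) = cvec.span {x, y}" by (simp add: st)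
  show "plucker x y = form_value (snd (1 :: nat, 0)) (\<lambda>_. plucker x y) p"
    by (simp add: form_value_deg0)
qed

text \<open>A pencil of isotropic planes through V1. As z is outside the plane of x and y, no member
  degenerates, and the bivector of x and s y + t z is linear in (s, t).\<close>

lemma P1_morphism_second:
  assumes "flag_of x y \<in> IF n" "z \<in> E n" "omega n x z = 0" "z \<notin> cvec.span {x, y}"
  shows "P1_morphism n (0, 1) (\<lambda>p. case hcoords p of (s, t) \<Rightarrow>
    flag_of x (vscale s y + vscale t z))" (is "P1_morphism n _ ?f")
  unfolding P1_morphism_def
proof (intro conjI allI exI)
  fix p :: P1
  obtain s t where st: "hcoords p = (s, t)" by fastforce
  have xy: "x \<in> E n" "y \<in> E n" "plucker x y \<noteq> 0" "omega n x y = 0"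
    using assms by (simp_all add: flag_of_in_IF_iff)
  have "s \<noteq> 0 \<or> t \<noteq> 0" using hcoords_nonzero[of p] st by auto
  define u where "u = vscale s y + vscale t z"
  have "plucker x u \<noteq> 0"
  proof
    assume "plucker x u = 0"
    then obtain c where c: "u = vscale c x" using dependent_if_plucker_zero[of x u] xy(3) by auto
    show False
    proof (cases "t = 0")
      case False
      then have "z = vscale (1 / t) (vscale c x - vscale s y)"
        unfolding c[symmetric] by (simp add: u_def)
      also have "\<dots> \<in> cvec.span {x, y}"
        by (intro cvec.span_scale cvec.span_diff cvec.span_base) auto
      finally show False using assms(4) by simp
    next
      case True
      then have "s \<noteq> 0" "vscale s y = vscale c x" using \<open>s \<noteq> 0 \<or> t \<noteq> 0\<close> c by (auto simp: u_def)
      then have "y = vscale (1 / s) (vscale c x)" by (metis cvec.scale_scale cvec.scale_one nonzero_eq_divide_eq)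
      then have "plucker x y = 0" by (auto simp: fun_eq_iff plucker_apply vscale_def)
      then show False using xy by simp
    qed
  qed
  moreover have "u \<in> E n" unfolding u_def using xy assms by (intro E_add E_scale)
  moreover have "omega n x u = 0" using xy assms by (simp add: u_def omega_bilinear)
  ultimately show "?f p \<in> IF n" using xy by (simp add: st flag_of_in_IF_iff flip: u_def)
  show "fst (?f p) = cvec.span {form_value (fst (0, 1 :: nat)) (\<lambda>_. x) p}"
    by (simp add: st flag_of_def form_value_deg0)
  show "snd (?f p) = cvec.span {x, case hcoords p of (s, t) \<Rightarrow> vscale s y + vscale t z}"
    by (simp add: st flag_of_def)
  show "plucker x (case hcoords p of (s, t) \<Rightarrow> vscale s y + vscale t z) =
      form_value (snd (0 :: nat, 1)) (\<lambda>j. if j = 0 then plucker x z else plucker x y) p"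
    by (auto simp: st form_value_deg1 fun_eq_iff plucker_apply vscale_def algebra_simps)
qed

text \<open>In the line P(V2) the flag G is the point [1 : 0], and F, with V1 spanned by c x + d y,
  is the point [c : d].\<close>

lemma curve_nbhd_first:
  assumes "F \<in> IF n" "G \<in> IF n" "snd F = snd G" "G \<in> \<Omega>"
  shows "F \<in> curve_nbhd n (1, 0) \<Omega>"
proof -
  obtain x y where G: "G = flag_of x y" using assms(2) by (rule flag_cases)
  obtain u v where F: "F = flag_of u v" "plucker u v \<noteq> 0" using assms(1) by (rule flag_cases)
  let ?f = "\<lambda>p. case hcoords p of (s, t) \<Rightarrow> (cvec.span {vscale s x + vscale t y}, cvec.span {x, y})"
  have "u \<in> cvec.span {x, y}"
    using assms(3) cvec.span_base[of u "{u, v}"] unfolding F(1) G by (simp add: flag_of_def)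
  then obtain c d where u: "u = vscale c x + vscale d y" by (auto simp: mem_span2)
  have "\<exists>q. ?f q = F"
  proof (cases "d = 0")
    case True
    have "u \<noteq> 0" using F(2) by auto
    then have "cvec.span {u} = cvec.span {x}"
      using u True by (intro span1_eq) (auto simp: mem_span1)
    then have "?f None = F" using assms(3) by (simp add: F(1) G flag_of_def)
    then show ?thesis by blast
  next
    case False
    then have "vscale (c / d) x + y = vscale (1 / d) u"
      by (simp add: u vscale_def fun_eq_iff field_simps)
    moreover have "u \<noteq> 0" using F(2) by auto
    then have "cvec.span {vscale (1 / d) u} = cvec.span {u}"
      using False by (intro span1_eq) (auto simp: mem_span1)
    ultimately have "?f (Some (c / d)) = F" using assms(3) by (simp add: F(1) G flag_of_def)
    then show ?thesis by blast
  qed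
  then obtain q where q: "?f q = F" ..
  have "?f None = G" by (simp add: G flag_of_def)
  then have "?f None \<in> \<Omega>" using assms(4) by simp
  then have "?f q \<in> curve_nbhd n (1, 0) \<Omega>"
    using assms(2) unfolding G by (intro curve_nbhd_if_P1_morphism[OF P1_morphism_first, where p = None]) auto
  then show ?thesis using q by simp
qed

lemma omega_diff_right: "omega n x (y - y') = omega n x y - omega n x y'"
  using omega_add_right[of n x "y - y'" y'] by simp

text \<open>Otherwise the plane would contain every vector of E orthogonal to x: the kernel vector
  e_1, a nonzero one on the coordinates 2, 3 and another on the coordinates 4, 5. These are three
  independent vectors; the label 5 exists because n is at least 2.\<close>

lemma isotropic_plane_extends:
  assumes "n \<ge> 2" "flag_of x y \<in> IF n"
  obtains z where "z \<in> E n" "omega n x z = 0" "z \<notin> cvec.span {x, y}"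
proof (rule ccontr)
  assume "\<not> thesis"
  then have *: "z \<in> cvec.span {x, y}" if "z \<in> E n" "omega n x z = 0" for z
    using that \<open>\<And>z. \<lbrakk>z \<in> E n; omega n x z = 0; z \<notin> cvec.span {x, y}\<rbrakk> \<Longrightarrow> thesis\<close> by blast
  have ex: "\<exists>z \<in> cvec.span {x, y}. (z i \<noteq> 0 \<or> z j \<noteq> 0) \<and> (\<forall>k. k \<noteq> i \<longrightarrow> k \<noteq> j \<longrightarrow> z k = 0)"
    if "i \<noteq> j" "i \<in> {2..2 * n + 1}" "j \<in> {2..2 * n + 1}" for i j
  proof -
    define a b where "a = omega n x (evec i)" and "b = omega n x (evec j)"
    define z where "z = (if a = 0 then evec i else vscale b (evec i) - vscale a (evec j))"
    have "z \<in> E n" using that by (auto simp: z_def intro!: E_diff E_scale)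
    moreover have "omega n x z = 0"
      by (auto simp: z_def omega_diff_right omega_bilinear a_def b_def)
    moreover have "\<forall>k. k \<noteq> i \<longrightarrow> k \<noteq> j \<longrightarrow> z k = 0" by (simp add: z_def vscale_def evec_def)
    moreover have "z i \<noteq> 0 \<or> z j \<noteq> 0" using that(1) by (auto simp: z_def vscale_def evec_def)
    ultimately show ?thesis using * by (intro bexI[of _ z]) auto
  qed
  obtain z where z: "z \<in> cvec.span {x, y}" "z 2 \<noteq> 0 \<or> z 3 \<noteq> 0" "\<forall>k. k \<noteq> 2 \<longrightarrow> k \<noteq> 3 \<longrightarrow> z k = 0"
    using ex[of 2 3] assms(1) by auto
  obtain z' where z': "z' \<in> cvec.span {x, y}" "z' 4 \<noteq> 0 \<or> z' 5 \<noteq> 0"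
    using ex[of 4 5] assms(1) by auto
  have "evec 1 \<in> cvec.span {x, y}" by (intro *) (simp_all add: omega_evec_right)
  moreover have "plucker (evec 1) z (1, 2) \<noteq> 0 \<or> plucker (evec 1) z (1, 3) \<noteq> 0"
    using z by (simp add: plucker_apply evec_def)
  then have "plucker (evec 1) z \<noteq> 0" by auto
  ultimately have "z' \<in> cvec.span {evec 1, z}" using span2_eq[OF _ z(1)] z'(1) by blast
  then show False using z'(2) z(3) by (auto simp: mem_span2 vscale_def evec_def)
qed

text \<open>If the planes differ, they span a pencil. If F = G, a curve of degree (0, 1) through the
  flag still has to be produced, and an auxiliary z supplies it.\<close>

lemma curve_nbhd_second:
  assumes "n \<ge> 2" "F \<in> IF n" "G \<in> IF n" "fst F = fst G" "G \<in> \<Omega>"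
  shows "F \<in> curve_nbhd n (0, 1) \<Omega>"
proof -
  obtain x y where G: "G = flag_of x y" "plucker x y \<noteq> 0" using assms(3) by (rule flag_cases)
  obtain u v where F: "F = flag_of u v" "v \<in> E n" "omega n u v = 0" using assms(2) by (rule flag_cases)
  have "u \<in> cvec.span {x}"
    using assms(4) cvec.span_base[of u "{u}"] by (simp add: F(1) G(1) flag_of_def)
  moreover have "x \<in> cvec.span {u}"
    using assms(4) cvec.span_base[of x "{x}"] by (simp add: F(1) G(1) flag_of_def)
  ultimately obtain c d where "u = vscale c x" "x = vscale d u" unfolding mem_span1 by blast
  have xv: "omega n x v = 0" using F(3) \<open>x = vscale d u\<close> by (simp add: omega_bilinear)
  have F': "F = flag_of x v"
    unfolding F(1)
  proof (rule flag_of_eq[symmetric])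
    show "v \<in> cvec.span {u, v}" by (rule cvec.span_base) simp
    have "plucker x v = (\<lambda>ij. d * plucker u v ij)"
      unfolding \<open>x = vscale d u\<close> by (auto simp: fun_eq_iff plucker_apply vscale_def algebra_simps)
    moreover have "plucker u v \<noteq> 0" using assms(2) unfolding F(1) by (simp add: flag_of_in_IF_iff)
    moreover have "d \<noteq> 0" using G(2) \<open>x = vscale d u\<close> by auto
    ultimately show "plucker x v \<noteq> 0" by (auto simp: fun_eq_iff)
  qed fact
  let ?f = "\<lambda>z p. case hcoords p of (s, t) \<Rightarrow> flag_of x (vscale s y + vscale t z)"
  show ?thesis
  proof (cases "v \<in> cvec.span {x, y}")
    case False
    have "?f v None \<in> \<Omega>" using assms(5) G(1) by simp
    then have "?f v (Some 0) \<in> curve_nbhd n (0, 1) \<Omega>"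
      using assms(3) F(2) xv False unfolding G(1)
      by (intro curve_nbhd_if_P1_morphism[OF P1_morphism_second, where p = None]) auto
    then show ?thesis using F' by simp
  next
    case True
    obtain z where z: "z \<in> E n" "omega n x z = 0" "z \<notin> cvec.span {x, y}"
      using isotropic_plane_extends[OF assms(1)] assms(3) G(1) by blast
    have "plucker x v \<noteq> 0" using assms(2) F' by (simp add: flag_of_in_IF_iff)
    then have "F = G" unfolding F' G(1) by (intro flag_of_eq[OF cvec.span_base True]) simp_all
    have "?f z None \<in> \<Omega>" using assms(5) G(1) by simp
    then have "?f z None \<in> curve_nbhd n (0, 1) \<Omega>"
      using assms(3) z unfolding G(1)
      by (intro curve_nbhd_if_P1_morphism[OF P1_morphism_second, where p = None]) auto
    then show ?thesis using G(1) \<open>F = G\<close> by simp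
  qed
qed

section \<open>Edges and cycles\<close>

lemma irreducible_component_self: "irreducible_in T A \<Longrightarrow> irreducible_component T A A"
  by (auto simp: irreducible_component_def)

text \<open>The curves sweep out the fibre over the plane spanned by e_1 and e_2, which is
  X(2|1).\<close>

lemma quantum_edge_point:
  assumes "n \<ge> 2"
  shows "quantum_edge n (1, 2) (2, 1)"
proof -
  have w: "(1, 2) \<in> Wodd n" "(2, 1) \<in> Wodd n" using assms by (auto simp: Wodd_iff lbar_def)
  have sub: "Schubert n (1, 2) \<subseteq> Schubert n (2, 1)"
    using bruhat_le_swap[OF w(2)] by (simp add: bruhat_le_def)
  have "curve_nbhd n (1, 0) (Schubert n (1, 2)) = Schubert n (2, 1)"
  proof
    show "curve_nbhd n (1, 0) (Schubert n (1, 2)) \<subseteq> Schubert n (2, 1)"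
    proof
      fix F assume F: "F \<in> curve_nbhd n (1, 0) (Schubert n (1, 2))"
      then obtain G where "G \<in> Schubert n (1, 2)" "snd F = snd G" by (rule curve_nbhd_snd_const)
      moreover have "F \<in> IF n" using F curve_nbhd_IF by blast
      ultimately show "F \<in> Schubert n (2, 1)" using sub unfolding Schubert_plane_fixed[OF assms] by auto
    qed
    show "Schubert n (2, 1) \<subseteq> curve_nbhd n (1, 0) (Schubert n (1, 2))"
    proof
      fix F assume "F \<in> Schubert n (2, 1)"
      then have F: "F \<in> IF n" "snd F = cvec.span {evec 1, evec 2}"
        unfolding Schubert_plane_fixed[OF assms] by auto
      have G: "flag_of (evec 1) (evec 2) \<in> Schubert n (1, 2)" by (rule coord_flag_in_Schubert[OF w(1)])
      show "F \<in> curve_nbhd n (1, 0) (Schubert n (1, 2))"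
        using F by (intro curve_nbhd_first[OF _ subsetD[OF Schubert_IF G] _ G]) (simp_all add: flag_of_def)
    qed
  qed
  then have "irreducible_component (zariski n) (curve_nbhd n (1, 0) (Schubert n (1, 2))) (Schubert n (2, 1))"
    using irreducible_component_self[OF irreducible_Schubert[OF w(2)]] by simp
  moreover have "ell n (2, 1) = 1" "ell n (1, 2) = 0"
    using w by (simp_all add: ell_eq cell_dim_def numeral_2_eq_2)
  ultimately show ?thesis
    unfolding quantum_edge_def by (intro exI[of _ "(1, 0)"]) (simp add: anticanonical_degree_def)
qed

lemma cell_dim_1: "b \<in> {2..2 * n + 1} \<Longrightarrow> cell_dim n (1, b) = b - 2"
proof -
  assume b: "b \<in> {2..2 * n + 1}"
  then have "{1..<b} - {1, lbar n 1} = {2..<b}" by (auto simp: lbar_def)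
  then show ?thesis by (simp add: cell_dim_def)
qed

text \<open>
  The curve neighborhood consists of the flags over \<open>V1 \<subseteq> \<langle>e_1, e_2\<rangle>\<close>.  Since \<open>e_1\<close> spans the kernel
  of the form, \<open>V2\<close> is arbitrary over \<open>V1 = \<langle>e_1\<rangle>\<close>, but elsewhere its last coordinate vanishes; so
  the neighborhood is reducible.
\<close>

lemma quantum_edge_line:
  assumes "n \<ge> 2"
  shows "quantum_edge n (2, 1) (1, 2 * n + 1)"
proof -
  have w: "(2, 1) \<in> Wodd n" "(1, 2 * n + 1) \<in> Wodd n" "(1, 2) \<in> Wodd n"
    using assms by (auto simp: Wodd_iff lbar_def)
  let ?N = "curve_nbhd n (0, 1) (Schubert n (2, 1))"
  have N: "x 2 = 0 \<or> (\<forall>i. plucker x y (i, 2 * n + 1) = 0)" and N': "supp_le 2 x" "x \<in> E n"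
    if xy: "flag_of x y \<in> ?N" for x y
  proof -
    obtain G where G: "G \<in> Schubert n (2, 1)" "fst (flag_of x y) = fst G"
      using curve_nbhd_fst_const[OF xy] by blast
    obtain u v where uv: "G = flag_of u v" using G(1) Schubert_IF flag_cases by blast
    have "supp_le 2 u" using Schubert_fst_supp[OF w(1)] G(1) uv by simp
    moreover have "x \<in> cvec.span {u}"
      using G(2) cvec.span_base[of x "{x}"] by (simp add: uv flag_of_def)
    ultimately show supp: "supp_le 2 x" by (auto simp: mem_span1 supp_le_def vscale_def)
    have IF: "flag_of x y \<in> IF n" using xy curve_nbhd_IF by blast
    then show "x \<in> E n" by (simp add: flag_of_in_IF_iff)
    have "lbar n 2 = 2 * n + 1" by (simp add: lbar_def)
    moreover have "y \<in> E n" "omega n x y = 0" using IF by (simp_all add: flag_of_in_IF_iff)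
    \<comment> \<open>For x in the span of e_1 and e_2 isotropy reduces to this product, since e_1
      lies in the kernel and the bar of 2 is 2n+1.\<close>
    ultimately have "x 2 * y (2 * n + 1) = 0"
      using omega_leading[of 2 n x y] supp supp_le_E[of y n] assms by simp
    moreover have "x (2 * n + 1) = 0" using supp assms by (simp add: supp_le_def)
    ultimately show "x 2 = 0 \<or> (\<forall>i. plucker x y (i, 2 * n + 1) = 0)" by (auto simp: plucker_apply)
  qed
  have sub: "Schubert n (1, 2 * n + 1) \<subseteq> ?N"
  proof
    fix F assume "F \<in> Schubert n (1, 2 * n + 1)"
    then have F: "F \<in> IF n" "fst F = cvec.span {evec 1}" unfolding Schubert_line_fixed[OF assms] by auto
    have G: "flag_of (evec 1) (evec 2) \<in> Schubert n (2, 1)"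
      using coord_flag_in_Schubert[OF w(3)] bruhat_le_swap[OF w(1)] by (auto simp: bruhat_le_def)
    show "F \<in> ?N"
      using F by (intro curve_nbhd_second[OF assms _ subsetD[OF Schubert_IF G] _ G]) (simp_all add: flag_of_def)
  qed
  have "irreducible_component (zariski n) ?N (Schubert n (1, 2 * n + 1))"
    unfolding irreducible_component_def
  proof (intro conjI allI impI sub irreducible_Schubert[OF w(2)])
    fix Z assume Z: "Schubert n (1, 2 * n + 1) \<subseteq> Z \<and> Z \<subseteq> ?N \<and> irreducible_in (zariski n) Z"
    \<comment> \<open>The neighborhood lies in the union of \<open>?C\<close>, where V1 has no
      e_2-component, and \<open>?D\<close>, where the last coordinate vanishes on V2. An irreducible
      set containing X(1|2n+1) is not inside \<open>?D\<close>, so it lies in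
      \<open>?C\<close>.\<close>
    let ?C = "IF n - nonvanishing n (\<lambda>x p. x 2)"
    let ?D = "\<Inter>i. IF n - nonvanishing n (\<lambda>x p. p (i, 2 * n + 1))"
    have C: "flag_of x y \<in> nonvanishing n (\<lambda>x p. x 2) \<longleftrightarrow> x 2 \<noteq> 0"
      and D: "flag_of x y \<in> nonvanishing n (\<lambda>x p. p (i, 2 * n + 1)) \<longleftrightarrow> plucker x y (i, 2 * n + 1) \<noteq> 0"
      if "flag_of x y \<in> IF n" for x y i
      using nonvanishing_iff[OF bihom.coord1 that] nonvanishing_iff[OF bihom.coord2 that] by auto
    have "Z \<subseteq> ?C \<union> ?D"
    proof
      fix F assume F: "F \<in> Z"
      then have "F \<in> ?N" "F \<in> IF n" using Z curve_nbhd_IF by blast+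
      then obtain x y where xy: "F = flag_of x y" using flag_cases by blast
      then show "F \<in> ?C \<union> ?D"
        using N[of x y] C[of x y] D[of x y] \<open>F \<in> ?N\<close> \<open>F \<in> IF n\<close> by auto
    qed
    moreover have "closedin (zariski n) ?D"
      by (intro closedin_INT closedin_vanishing[OF bihom.coord2]) simp
    ultimately have "Z \<subseteq> ?C \<or> Z \<subseteq> ?D"
      using Z closedin_vanishing[OF bihom.coord1] by (intro irreducible_inD[of "zariski n"]) auto
    moreover have "\<not> Z \<subseteq> ?D"
    proof
      assume "Z \<subseteq> ?D"
      moreover have "flag_of (evec 1) (evec (2 * n + 1)) \<in> Z" using coord_flag_in_Schubert[OF w(2)] Z by blast
      ultimately have "plucker (evec 1) (evec (2 * n + 1)) (1, 2 * n + 1) = 0"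
        using D by blast
      then show False using assms by (simp add: plucker_apply evec_def)
    qed
    ultimately have ZC: "Z \<subseteq> ?C" by blast
    have "Z \<subseteq> Schubert n (1, 2 * n + 1)"
    proof
      fix F assume F: "F \<in> Z"
      then have FN: "F \<in> ?N" "F \<in> IF n" "F \<notin> nonvanishing n (\<lambda>x p. x 2)" using Z curve_nbhd_IF ZC by blast+
      then obtain x y where xy: "F = flag_of x y" "plucker x y \<noteq> 0" using flag_cases by blast
      have "x 2 = 0" using C[of x y] FN unfolding xy by blast
      then have "supp_le 1 x" using N'(1)[of x y] FN(1) unfolding xy supp_le_def
        by (metis One_nat_def Suc_1 Suc_lessI)
      then have "x \<in> cvec.span {evec 1}"
        using supp_le_1_in_span N'(2)[of x y] FN(1) unfolding xy by blast
      moreover have "x \<noteq> 0" using xy(2) by auto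
      ultimately have "fst F = cvec.span {evec 1}" using span1_eq by (simp add: xy(1) flag_of_def)
      then show "F \<in> Schubert n (1, 2 * n + 1)" using FN(2) unfolding Schubert_line_fixed[OF assms] by auto
    qed
    then show "Z = Schubert n (1, 2 * n + 1)" using Z by blast
  qed
  moreover have "ell n (2, 1) = 1" "ell n (1, 2 * n + 1) = 2 * n - 1"
    using w assms cell_dim_1[of "2 * n + 1" n] by (simp_all add: ell_eq cell_dim_def)
  ultimately show ?thesis
    unfolding quantum_edge_def using assms
    by (intro exI[of _ "(0, 1)"]) (simp add: anticanonical_degree_def of_nat_diff)
qed

text \<open>Starting from flags with V1 spanned by e_1 and moving V1 inside V2, the surviving
  condition is that V2 contains e_1.\<close>

lemma quantum_edge_kernel:
  assumes "n \<ge> 2"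
  shows "quantum_edge n (1, 2 * n + 1) (2 * n + 1, 1)"
proof -
  have w: "(1, 2 * n + 1) \<in> Wodd n" "(2 * n + 1, 1) \<in> Wodd n"
    using assms by (auto simp: Wodd_iff lbar_def)
  have "curve_nbhd n (1, 0) (Schubert n (1, 2 * n + 1)) = Schubert n (2 * n + 1, 1)"
  proof
    show "curve_nbhd n (1, 0) (Schubert n (1, 2 * n + 1)) \<subseteq> Schubert n (2 * n + 1, 1)"
    proof
      fix F assume F: "F \<in> curve_nbhd n (1, 0) (Schubert n (1, 2 * n + 1))"
      then obtain G where G: "G \<in> Schubert n (1, 2 * n + 1)" "snd F = snd G" by (rule curve_nbhd_snd_const)
      then have "G \<in> IF n" "fst G = cvec.span {evec 1}" unfolding Schubert_line_fixed[OF assms] by auto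
      then have "evec 1 \<in> snd G" using cvec.span_base[of "evec 1" "{evec 1}"] by (auto simp: IF_def)
      moreover have "F \<in> IF n" using F curve_nbhd_IF by blast
      ultimately show "F \<in> Schubert n (2 * n + 1, 1)"
        using G(2) unfolding Schubert_plane_through_kernel[OF assms] by auto
    qed
    show "Schubert n (2 * n + 1, 1) \<subseteq> curve_nbhd n (1, 0) (Schubert n (1, 2 * n + 1))"
    proof
      fix F assume "F \<in> Schubert n (2 * n + 1, 1)"
      then have F: "F \<in> IF n" "evec 1 \<in> snd F"
        unfolding Schubert_plane_through_kernel[OF assms] by auto
      obtain x y where xy: "F = flag_of x y" "plucker x y \<noteq> 0" "omega n x y = 0" "x \<in> E n" "y \<in> E n"
        using F(1) by (rule flag_cases)
      \<comment> \<open>A vector of V2 independent of e_1: x itself, unless x is proportional to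
        e_1.\<close>
      define z where "z = (if plucker (evec 1) x \<noteq> 0 then x else y)"
      have e1: "evec 1 \<noteq> (0 :: cvec)" by (metis evec_same zero_fun_apply zero_neq_one)
      have pl: "plucker (evec 1) z \<noteq> 0"
      proof (cases "plucker (evec 1) x = 0")
        case True
        then obtain c where c: "x = vscale c (evec 1)" using dependent_if_plucker_zero e1 by blast
        have "plucker x y = (\<lambda>ij. c * plucker (evec 1) y ij)"
          unfolding c by (auto simp: fun_eq_iff plucker_apply vscale_def algebra_simps)
        then show ?thesis using xy(2) True by (auto simp: z_def fun_eq_iff)
      qed (simp add: z_def)
      have "z \<in> cvec.span {x, y}" unfolding z_def by (rule cvec.span_base) simp
      then have span: "cvec.span {evec 1, z} = cvec.span {x, y}"
        using F(2) pl by (intro span2_eq) (simp_all add: xy(1) flag_of_def)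
      have "flag_of (evec 1) z \<in> IF n"
        using pl xy by (auto simp: flag_of_in_IF_iff omega_evec_left z_def)
      moreover have "fst (flag_of (evec 1) z) = cvec.span {evec 1}" by (simp add: flag_of_def)
      ultimately have "flag_of (evec 1) z \<in> Schubert n (1, 2 * n + 1)"
        unfolding Schubert_line_fixed[OF assms] by auto
      then show "F \<in> curve_nbhd n (1, 0) (Schubert n (1, 2 * n + 1))"
        using F(1) \<open>flag_of (evec 1) z \<in> IF n\<close> span
        by (intro curve_nbhd_first[of F n "flag_of (evec 1) z"]) (simp_all add: xy(1) flag_of_def)
    qed
  qed
  then have "irreducible_component (zariski n) (curve_nbhd n (1, 0) (Schubert n (1, 2 * n + 1))) (Schubert n (2 * n + 1, 1))"
    using irreducible_component_self[OF irreducible_Schubert[OF w(2)]] by simp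
  moreover have "ell n (1, 2 * n + 1) = 2 * n - 1" "ell n (2 * n + 1, 1) = 2 * n"
    using w assms cell_dim_1[of "2 * n + 1" n] by (simp_all add: ell_eq cell_dim_def)
  ultimately show ?thesis
    unfolding quantum_edge_def using assms
    by (intro exI[of _ "(1, 0)"]) (simp add: anticanonical_degree_def of_nat_diff)
qed

text \<open>Because e_1 is orthogonal to everything, every V1 lies in an isotropic plane containing
  e_1. Moving V2 while V1 stays fixed therefore reaches every flag.\<close>

lemma quantum_edge_top:
  assumes "n \<ge> 2"
  shows "quantum_edge n (2 * n + 1, 1) (2 * n + 1, 2 * n)"
proof -
  have w: "(2 * n + 1, 1) \<in> Wodd n" "(2 * n + 1, 2 * n) \<in> Wodd n"
    using assms by (auto simp: Wodd_iff lbar_def)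
  have "curve_nbhd n (0, 1) (Schubert n (2 * n + 1, 1)) = Schubert n (2 * n + 1, 2 * n)"
    unfolding Schubert_top[OF assms]
  proof
    show "IF n \<subseteq> curve_nbhd n (0, 1) (Schubert n (2 * n + 1, 1))"
    proof
      fix F assume F: "F \<in> IF n"
      then obtain x y where xy: "F = flag_of x y" "plucker x y \<noteq> 0" "x \<in> E n" by (rule flag_cases)
      obtain G where G: "G \<in> IF n" "fst F = fst G" "evec 1 \<in> snd G"
      proof (cases "plucker x (evec 1) = 0")
        case True
        have "x \<noteq> 0" using xy(2) by auto
        then obtain c where c: "evec 1 = vscale c x" using dependent_if_plucker_zero[OF True] by blast
        have "evec 1 \<in> cvec.span {x, y}" unfolding c
          by (intro cvec.span_scale cvec.span_base) simp
        then show ?thesis using that[of F] F by (simp add: xy(1) flag_of_def)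
      next
        case False
        have "flag_of x (evec 1) \<in> IF n"
          using False xy(3) by (auto simp: flag_of_in_IF_iff omega_evec_right)
        moreover have "evec 1 \<in> cvec.span {x, evec 1}" by (rule cvec.span_base) simp
        ultimately show ?thesis using that[of "flag_of x (evec 1)"] by (simp add: xy(1) flag_of_def)
      qed
      then have "G \<in> Schubert n (2 * n + 1, 1)" unfolding Schubert_plane_through_kernel[OF assms] by auto
      then show "F \<in> curve_nbhd n (0, 1) (Schubert n (2 * n + 1, 1))"
        using curve_nbhd_second[OF assms F G(1,2)] by blast
    qed
  qed (rule curve_nbhd_IF)
  then have "irreducible_component (zariski n) (curve_nbhd n (0, 1) (Schubert n (2 * n + 1, 1))) (Schubert n (2 * n + 1, 2 * n))"
    using irreducible_component_self[OF irreducible_Schubert[OF w(2)]] by simp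
  moreover have "{1..<2 * n} - {2 * n + 1, lbar n (2 * n + 1)} = {1..<2 * n} - {2}"
    by (auto simp: lbar_def)
  then have "cell_dim n (2 * n + 1, 2 * n) = 4 * n - 2"
    using assms by (simp add: cell_dim_def card_Diff_singleton_if)
  then have "ell n (2 * n + 1, 1) = 2 * n" "ell n (2 * n + 1, 2 * n) = 4 * n - 2"
    using w by (simp_all add: ell_eq cell_dim_def)
  ultimately show ?thesis
    unfolding quantum_edge_def using assms
    by (intro exI[of _ "(0, 1)"]) (simp add: anticanonical_degree_def of_nat_diff)
qed

section \<open>Connectivity of the graph and two of its cycles\<close>

abbreviation graph_edge :: "nat \<Rightarrow> nat \<times> nat \<Rightarrow> nat \<times> nat \<Rightarrow> bool" where
  "graph_edge n u v \<equiv> classical_edge n u v \<or> quantum_edge n u v"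

lemma arcs_ends_graph [simp]:
  "verts (quantum_bruhat_graph n) = Wodd n"
  "arcs_ends (quantum_bruhat_graph n) = {(u, v). u \<in> Wodd n \<and> v \<in> Wodd n \<and> graph_edge n u v}"
  by (simp_all add: quantum_bruhat_graph_def)

lemma strongly_connected_graph:
  assumes n: "n \<ge> 2"
  shows "strongly_connected (quantum_bruhat_graph n)"
proof -
  define R where "R = rtrancl_on (Wodd n) {(u, v). u \<in> Wodd n \<and> v \<in> Wodd n \<and> graph_edge n u v}"
  have w: "(1, 2) \<in> Wodd n" "(2, 1) \<in> Wodd n" "(1, 2 * n + 1) \<in> Wodd n" "(2 * n + 1, 1) \<in> Wodd n"
    "(2 * n + 1, 2 * n) \<in> Wodd n"
    using n by (auto simp: Wodd_iff lbar_def)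
  have edge: "(u, v) \<in> R" if "u \<in> Wodd n" "v \<in> Wodd n" "graph_edge n u v" for u v
    unfolding R_def using that by (intro rtrancl_on_into_rtrancl_on[OF rtrancl_on_refl]) auto
  have trans: "(u, w) \<in> R" if "(u, v) \<in> R" "(v, w) \<in> R" for u v w
    using that rtrancl_on_trans unfolding R_def by fast
  have down: "(w, (1, 2)) \<in> R" if "w \<in> Wodd n" for w
    using that
  proof (induction "cell_dim n w" arbitrary: w rule: less_induct)
    case less
    show ?case
    proof (cases "w = (1, 2)")
      case False
      obtain v where v: "v \<in> Wodd n" "cell_dim n w = Suc (cell_dim n v)" "Schubert n v \<subset> Schubert n w"
        using lower_cover[OF less.prems False] .
      have "(v, (1, 2)) \<in> R" using v by (intro less.hyps) auto
      then show ?thesis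
        using edge[OF less.prems v(1)] classical_edge_if_cover[OF v(1) less.prems v(2,3)] trans by blast
    qed (use w in \<open>simp add: R_def\<close>)
  qed
  have up: "((2 * n + 1, 2 * n), w) \<in> R" if "w \<in> Wodd n" for w
    using that
  proof (induction "4 * n - cell_dim n w" arbitrary: w rule: less_induct)
    case less
    show ?case
    proof (cases "w = (2 * n + 1, 2 * n)")
      case False
      obtain u where u: "u \<in> Wodd n" "cell_dim n u = Suc (cell_dim n w)" "Schubert n w \<subset> Schubert n u"
        using upper_cover[OF less.prems False n] .
      have "cell_dim n u \<le> 4 * n" using cell_dim_le[OF u(1)] .
      then have "((2 * n + 1, 2 * n), u) \<in> R" using u by (intro less.hyps) auto
      then show ?thesis
        using edge[OF u(1) less.prems] classical_edge_if_cover[OF less.prems u(1,2,3)] trans by blast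
    qed (use w in \<open>simp add: R_def\<close>)
  qed
  have "((1, 2), (2, 1)) \<in> R" "((2, 1), (1, 2 * n + 1)) \<in> R" "((1, 2 * n + 1), (2 * n + 1, 1)) \<in> R"
    "((2 * n + 1, 1), (2 * n + 1, 2 * n)) \<in> R"
    using w quantum_edge_point[OF n] quantum_edge_line[OF n] quantum_edge_kernel[OF n] quantum_edge_top[OF n]
    by (auto intro: edge)
  then have "((1, 2), (2 * n + 1, 2 * n)) \<in> R" using trans by blast
  then have "(u, v) \<in> R" if "u \<in> Wodd n" "v \<in> Wodd n" for u v
    using down[OF that(1)] up[OF that(2)] trans by blast
  then show ?thesis
    unfolding strongly_connected_def reachable_def arcs_ends_graph R_def[symmetric] using w(1) by blast
qed

text \<open>As the arcs are pairs of vertices, walks can be expressed by \<open>pcas\<close> and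
  \<open>pawalk_verts\<close>, which simplify on explicit lists.\<close>

lemma cycle_graph_iff:
  "pre_digraph.cycle (quantum_bruhat_graph n) p \<longleftrightarrow>
     (\<exists>u. u \<in> Wodd n \<and> set p \<subseteq> {(u, v). u \<in> Wodd n \<and> v \<in> Wodd n \<and> graph_edge n u v} \<and>
       pcas u p u \<and> distinct (tl (pawalk_verts u p)) \<and> p \<noteq> [])"
  by (auto simp: pre_digraph.cycle_def pre_digraph.awalk_def quantum_bruhat_graph_def
      cas_with_proj_eq awalk_verts_with_proj_eq)

lemma short_cycle:
  assumes n: "n \<ge> 2"
  shows "pre_digraph.cycle (quantum_bruhat_graph n) [((1, 2), (2, 1)), ((2, 1), (1, 2))]"
proof -
  have w: "(1, 2) \<in> Wodd n" "(2, 1) \<in> Wodd n" using n by (auto simp: Wodd_iff lbar_def)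
  have "classical_edge n (2, 1) (1, 2)"
    using w cell_dim_swap[OF w(2)] Schubert_swap_strict[OF w(2)] by (intro classical_edge_if_cover) simp_all
  then show ?thesis
    unfolding cycle_graph_iff using w quantum_edge_point[OF n] by (intro exI[of _ "(1, 2)"]) simp
qed

text \<open>The descending path \<open>(1|k+2), \<dots>, (1|2)\<close>, followed by the edge to \<open>(2|1)\<close>.\<close>

fun descent :: "nat \<Rightarrow> ((nat \<times> nat) \<times> (nat \<times> nat)) list" where
  "descent 0 = [((1, 2), (2, 1))]"
| "descent (Suc k) = ((1, Suc k + 2), (1, k + 2)) # descent k"

lemma length_descent [simp]: "length (descent k) = Suc k"
  by (induction k) auto

lemma pcas_descent: "pcas (1, k + 2) (descent k) (2, 1)"
  by (induction k) auto

text \<open>Bounds the second labels still to come, so that prepending a vertex with a larger label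
  causes no repetition.\<close>

lemma set_pawalk_descent: "set (pawalk_verts (1, k + 2) (descent k)) \<subseteq> insert (2, 1) {(1, j) | j. j \<le> k + 2}"
proof (induction k)
  case (Suc k)
  then show ?case by fastforce
qed simp

lemma distinct_descent: "distinct (pawalk_verts (1, k + 2) (descent k))"
proof (induction k)
  case (Suc k)
  then show ?case using set_pawalk_descent[of k] by auto
qed simp

lemma descent_edges:
  assumes n: "n \<ge> 2" and "k \<le> 2 * n - 1"
  shows "set (descent k) \<subseteq> {(u, v). u \<in> Wodd n \<and> v \<in> Wodd n \<and> graph_edge n u v}"
  using assms(2)
proof (induction k)
  case 0
  have "(1, 2) \<in> Wodd n" "(2, 1) \<in> Wodd n" using n by (auto simp: Wodd_iff lbar_def)
  then show ?case using quantum_edge_point[OF n] by simp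
next
  case (Suc k)
  have w: "(1, Suc k + 2) \<in> Wodd n" "(1, k + 2) \<in> Wodd n"
    using Suc.prems n by (auto simp: Wodd_iff lbar_def)
  have "cell_dim n (1, Suc k + 2) = Suc (cell_dim n (1, k + 2))"
    using Suc.prems n cell_dim_1[of "Suc k + 2" n] cell_dim_1[of "k + 2" n] by simp
  then have "classical_edge n (1, Suc k + 2) (1, k + 2)"
    using w Schubert_second_strict[OF w] by (intro classical_edge_if_cover) simp_all
  then show ?case using Suc w by simp
qed

lemma long_cycle:
  assumes n: "n \<ge> 2"
  shows "pre_digraph.cycle (quantum_bruhat_graph n) (((2, 1), (1, 2 * n + 1)) # descent (2 * n - 1))"
proof -
  have w: "(2, 1) \<in> Wodd n" "(1, 2 * n + 1) \<in> Wodd n" using n by (auto simp: Wodd_iff lbar_def)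
  \<comment> \<open>\<open>descent k\<close> starts at (1|k+2); this value of k makes it start where
    the quantum edge from (2|1) ends.\<close>
  have k: "2 * n - 1 + 2 = 2 * n + 1" using n by simp
  show ?thesis
    unfolding cycle_graph_iff
    using w quantum_edge_line[OF n] descent_edges[OF n order_refl]
      pcas_descent[of "2 * n - 1", unfolded k] distinct_descent[of "2 * n - 1", unfolded k]
    by (intro exI[of _ "(2, 1)"]) simp
qed

theorem theorem6p5:
  fixes n :: nat
  assumes "n \<ge> 2"
  shows "combinatorial_property_O (quantum_bruhat_graph n) {2, 2 * n - 1} \<and>
         strongly_connected (quantum_bruhat_graph n) \<and>
         Gcd {length p | p. pre_digraph.cycle (quantum_bruhat_graph n) p} = gcd 2 (2 * n - 1) \<and>
         gcd 2 (2 * n - 1) = 1"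
proof -
  let ?L = "{length p | p. pre_digraph.cycle (quantum_bruhat_graph n) p}"
  have len: "length p \<in> ?L" if "pre_digraph.cycle (quantum_bruhat_graph n) p" for p
    using that by blast
  have "2 \<in> ?L" using len[OF short_cycle[OF assms]] by (simp only: list.size One_nat_def add_Suc add_0 numeral_2_eq_2 add_Suc_right add_0_right)
  have "length (((2, 1), (1, 2 * n + 1)) # descent (2 * n - 1)) = 2 * n + 1" using assms by simp
  then have "2 * n + 1 \<in> ?L" using len[OF long_cycle[OF assms]] by (simp only:)
  \<comment> \<open>The two cycle lengths give divisors relations for 2n and 2n+1, which differ by
    one.\<close>
  have "Gcd ?L dvd 2 * n" using Gcd_dvd[OF \<open>2 \<in> ?L\<close>] by (rule dvd_mult2)
  then have "Gcd ?L dvd 1" using Gcd_dvd[OF \<open>2 * n + 1 \<in> ?L\<close>] by (rule dvd_add_right_iff[THEN iffD1])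
  then have L: "Gcd ?L = 1" by (simp only: nat_dvd_1_iff_1)
  have "odd (2 * n - 1)" using assms by simp
  then have g: "gcd 2 (2 * n - 1) = 1" by (metis coprime_iff_gcd_eq_1 coprime_left_2_iff_odd)
  then show ?thesis
    using L strongly_connected_graph[OF assms] by (simp add: combinatorial_property_O_def)
qed

end
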